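(* Let $m\ge 1$ be an integer and let $(\rho_x)_{x\in\mathbb{Z}}\subset[0,1]$ satisfy $\rho_0=1$, $\rho_x=0$ for $x>0$, $\rho_i=\rho_{i-m}$ for every $i\le -1$, and $\rho_{-1},\dots,\rho_{-m}$ not all $0$. Let $\nu$ be the Bernoulli product measure on $\{0,1\}^{\mathbb{Z}}$ with $\nu(\eta(x)=1)=\rho_x$ for all $x\in\mathbb{Z}$, and let $\bar\rho=\frac1m\sum_{j=1}^m\rho_{-j}$. Let $X_t=\max\{x\in\mathbb{Z}:\eta_t(x)=1\}$ be the position at time $t$ of the right-most particle of the symmetric exclusion process $(\eta_t)$ with jump probabilities $(p_i)$ started from $\nu$. Put $$a_t=\log\left(\frac{t}{\sqrt{2\pi}\,\log t}\right),\qquad b_t=\sqrt{\frac{t}{\log t}}.$$ Then for all $x\in\mathbb{R}$, $$\lim_{t\to\infty}\mathbb{P}_\nu\left(\frac{X_t}{\sigma b_t}-a_t\le x\right)=\exp\left(-\sigma\bar\rho\, e^{-x}\right).$$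
   Context: Standing assumptions: $(p_i)_{i\in\mathbb{Z}}$ are probabilities ($p_i\ge 0$, $\sum_i p_i=1$) that are symmetric ($p_i=p_{-i}$), such that the translation-invariant random walk on $\mathbb{Z}$ with jump probabilities $p(x,x+i)=p_i$ is irreducible, and such that $\sum_i e^{\theta i}p_i<\infty$ for some $\theta>0$. Set $\sigma^2=\sum_i i^2p_i$, $\sigma>0$. The symmetric exclusion process $(\eta_t)_{t\ge0}$ is the Markov process on $\{0,1\}^{\mathbb{Z}}$ with generator $\mathcal{L}f(\eta)=\sum_{x,y\in\mathbb{Z}}p_{y-x}\,\eta(x)(1-\eta(y))[f(\eta^{x,y})-f(\eta)]$ for functions $f$ depending on finitely many coordinates, where $\eta^{x,y}$ is $\eta$ with the values at $x$ and $y$ exchanged. $\mathbb{P}_\nu$ is the probability measure under which $\eta_0$ has law $\nu$. *)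

theory Defs
  imports "HOL-Probability.Probability"
begin

section \<open>The random walk\<close>

text \<open>\<^term>\<open>rw_steps p n x\<close> is the law, after \<open>n\<close> steps, of the walk on the integers started in
  \<open>x\<close> with increment law \<open>p\<close>.\<close>

primrec rw_steps :: "int pmf \<Rightarrow> nat \<Rightarrow> int \<Rightarrow> int pmf" where
  "rw_steps p 0 x = return_pmf x"
| "rw_steps p (Suc n) x = bind_pmf (rw_steps p n x) (\<lambda>y. map_pmf (\<lambda>i. y + i) p)"

definition rw_irreducible :: "int pmf \<Rightarrow> bool" where
  "rw_irreducible p \<longleftrightarrow> (\<forall>x y. \<exists>n. pmf (rw_steps p n x) y > 0)"


section \<open>Configurations\<close>

text \<open>A configuration in \<open>{0,1}\<^sup>\<int>\<close> is a predicate on the integers, \<^term>\<open>True\<close> meaning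
  ``occupied''. Topologically, \<^typ>\<open>int \<Rightarrow> bool\<close> carries the product of the discrete topologies,
  for which it is compact.\<close>

type_synonym config = "int \<Rightarrow> bool"

definition config_space :: "config measure" where
  "config_space = Pi\<^sub>M UNIV (\<lambda>_. count_space UNIV)"

definition bernoulli_product :: "(int \<Rightarrow> real) \<Rightarrow> config measure" where
  "bernoulli_product \<rho> = Pi\<^sub>M UNIV (\<lambda>x. measure_pmf (bernoulli_pmf (\<rho> x)))"

definition exchange :: "config \<Rightarrow> int \<Rightarrow> int \<Rightarrow> config" where
  "exchange \<eta> x y = \<eta>(x := \<eta> y, y := \<eta> x)"

text \<open>The maximum is unspecified for configurations without a right-most particle. (\<^term>\<open>Max\<close> is
  not usable here, because the configurations of interest have infinitely many particles.)\<close>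

definition rightmost :: "config \<Rightarrow> int" where
  "rightmost \<eta> = (GREATEST x. \<eta> x)"


section \<open>Markov semigroups on the continuous functions\<close>

text \<open>As the configuration space is compact, \<^typ>\<open>config \<Rightarrow>\<^sub>C real\<close> is the Banach space of all
  continuous real functions on it, with the supremum norm. Only \<^term>\<open>S t\<close> for \<open>t \<ge> 0\<close> matters.\<close>

type_synonym semigroup = "real \<Rightarrow> (config \<Rightarrow>\<^sub>C real) \<Rightarrow> (config \<Rightarrow>\<^sub>C real)"

definition markov_semigroup :: "semigroup \<Rightarrow> bool" where
  "markov_semigroup S \<longleftrightarrow>
     (\<forall>t\<ge>0. linear (S t)) \<and>
     (\<forall>f. S 0 f = f) \<and>
     (\<forall>s\<ge>0. \<forall>t\<ge>0. \<forall>f. S (s + t) f = S s (S t f)) \<and>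
     (\<forall>t\<ge>0. S t (const_bcontfun 1) = const_bcontfun 1) \<and>
     (\<forall>t\<ge>0. \<forall>f. (\<forall>\<eta>. 0 \<le> apply_bcontfun f \<eta>) \<longrightarrow> (\<forall>\<eta>. 0 \<le> apply_bcontfun (S t f) \<eta>)) \<and>
     (\<forall>f. \<forall>t\<ge>0. continuous (at_right t) (\<lambda>s. S s f))"

text \<open>The infinitesimal generator, as a graph; the limit is uniform in the configuration.\<close>

definition generator_graph :: "semigroup \<Rightarrow> ((config \<Rightarrow>\<^sub>C real) \<times> (config \<Rightarrow>\<^sub>C real)) set" where
  "generator_graph S = {(f, g). ((\<lambda>h. (S h f - f) /\<^sub>R h) \<longlongrightarrow> g) (at_right 0)}"


section \<open>The symmetric exclusion process\<close>

definition cylinder :: "(config \<Rightarrow> real) \<Rightarrow> bool" where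
  "cylinder f \<longleftrightarrow> (\<exists>A. finite A \<and> (\<forall>\<eta> \<zeta>. (\<forall>x\<in>A. \<eta> x = \<zeta> x) \<longrightarrow> f \<eta> = f \<zeta>))"

text \<open>For a cylinder function the sum converges absolutely: its terms vanish unless \<open>x\<close> or \<open>y\<close>
  lies in the finite set on which the function depends.\<close>

definition exclusion_pregenerator :: "int pmf \<Rightarrow> (config \<Rightarrow> real) \<Rightarrow> config \<Rightarrow> real" where
  "exclusion_pregenerator p f \<eta> =
     (\<Sum>\<^sub>\<infinity>(x, y)\<in>UNIV. pmf p (y - x) * of_bool (\<eta> x) * (1 - of_bool (\<eta> y))
        * (f (exchange \<eta> x y) - f \<eta>))"

text \<open>``Having generator \<open>L\<close>'' is meant in the usual sense for interacting particle systems: \<open>L\<close>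
  is given on the cylinder functions, and the generator of the semigroup is the closure of this
  operator.\<close>

definition exclusion_semigroup :: "int pmf \<Rightarrow> semigroup \<Rightarrow> bool" where
  "exclusion_semigroup p S \<longleftrightarrow> markov_semigroup S \<and>
     generator_graph S =
       closure {(f, g). cylinder (apply_bcontfun f) \<and>
                        apply_bcontfun g = exclusion_pregenerator p (apply_bcontfun f)}"

definition past :: "'a measure \<Rightarrow> (real \<Rightarrow> 'a \<Rightarrow> config) \<Rightarrow> real \<Rightarrow> 'a measure" where
  "past M \<eta> s =
     sigma (space M) {\<eta> u -` A \<inter> space M | u A. 0 \<le> u \<and> u \<le> s \<and> A \<in> sets config_space}"

definition cadlag :: "(real \<Rightarrow> config) \<Rightarrow> bool" where
  "cadlag \<omega> \<longleftrightarrow> (\<forall>t\<ge>0. continuous (at_right t) \<omega>) \<and> (\<forall>t>0. \<exists>l. (\<omega> \<longlongrightarrow> l) (at_left t))"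

definition markov_process_with ::
  "semigroup \<Rightarrow> 'a measure \<Rightarrow> (real \<Rightarrow> 'a \<Rightarrow> config) \<Rightarrow> bool" where
  "markov_process_with S M \<eta> \<longleftrightarrow>
     prob_space M \<and>
     (\<forall>t\<ge>0. \<eta> t \<in> measurable M config_space) \<and>
     (\<forall>\<omega>\<in>space M. cadlag (\<lambda>t. \<eta> t \<omega>)) \<and>
     (\<forall>s\<ge>0. \<forall>t\<ge>0. \<forall>f :: config \<Rightarrow>\<^sub>C real.
        AE \<omega> in M. real_cond_exp M (past M \<eta> s) (\<lambda>\<omega>'. apply_bcontfun f (\<eta> (s + t) \<omega>')) \<omega>
                     = apply_bcontfun (S t f) (\<eta> s \<omega>))"

text \<open>Here \<^term>\<open>M\<close> plays the role of \<open>\<bbbP>\<close> with initial law \<^term>\<open>\<nu>\<close>. The semigroup is determined by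
  its generator, so the existential quantifier does not introduce a choice.\<close>

definition symmetric_exclusion_process ::
  "int pmf \<Rightarrow> config measure \<Rightarrow> 'a measure \<Rightarrow> (real \<Rightarrow> 'a \<Rightarrow> config) \<Rightarrow> bool" where
  "symmetric_exclusion_process p \<nu> M \<eta> \<longleftrightarrow>
     (\<exists>S. exclusion_semigroup p S \<and> markov_process_with S M \<eta>) \<and>
     distr M config_space (\<eta> 0) = \<nu>"


section \<open>Normalising functions\<close>

definition a_norm :: "real \<Rightarrow> real" where
  "a_norm t = ln (t / (sqrt (2 * pi) * ln t))"

definition b_norm :: "real \<Rightarrow> real" where
  "b_norm t = sqrt (t / ln t)"

end

theory Submission
  imports Defs
begin

text \<open>Let \<open>g\<^sub>r\<close> solve the backward heat equation for the walk with \<open>g\<^sub>0\<close> the indicator of the sites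
  beyond the level \<open>N\<close>. Along the exclusion process, \<open>\<Prod>\<^sub>x (1 - g\<^bsub>t-s\<^esub>(x) \<eta>\<^sub>s(x))\<close> interpolates between
  the indicator of ``no particle beyond \<open>N\<close> at time \<open>t\<close>'' and a product of independent factors at
  time \<open>0\<close>, and its drift is exactly \<open>- \<Sum> p(x,y) \<eta>(x) \<eta>(y) (g(x) - g(y))\<^sup>2 R\<close> over pairs, with
  \<open>R \<ge> 0\<close>. Hence the emptiness probability is at most \<open>exp (- \<Lambda>)\<close>, where \<open>\<Lambda>\<close> is the expected
  number of particles beyond \<open>N\<close>.

  For the matching lower bound the drift has to be small. The same inequality applied to two sites
  gives \<open>E \<eta>(x) \<eta>(y) \<le> e\<^sup>2 u(x) u(y)\<close> for the one-point function \<open>u\<close>. Where \<open>u \<le> \<epsilon>\<close>, the drift is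
  therefore absorbed by \<open>\<epsilon>\<close> times the drift of \<open>\<Sum> g\<^sup>2 \<eta>\<close>, which costs at most \<open>\<epsilon> \<Lambda>\<close> in total. The
  remaining sites lie within \<open>O(\<surd>t)\<close> of the origin, far below \<open>N\<close>, where the gradient of \<open>g\<close> is small
  enough by a local estimate with an exponential tilt.

  Finally \<open>\<Lambda>\<close> is evaluated at moderate deviations by shifting the contour in Fourier inversion to
  the tilt \<open>N / (\<sigma>\<^sup>2 t)\<close>.\<close>


section \<open>Transition probabilities of the continuous-time walk\<close>

text \<open>The generator is prescribed only on cylinder functions, whereas \<open>g\<close> lives
  on all sites. Every computation along the process is therefore done on a finite window; pairs of
  sites that leave it cost at most a multiple of \<open>tail_err\<close>, which vanishes as the
  window grows with \<open>t\<close> fixed. The semigroup gives access only to forward increments,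
  so expectations have right derivatives and monotonicity has to be drawn from these. The lower
  bound works because of a separation of scales. With
  \<open>\<theta> = N / (\<sigma>\<^sup>2 t)\<close>, the quantity \<open>sqrt t * \<theta>\<close>
  is of order \<open>sqrt (ln t)\<close>, and \<open>sqrt t * \<theta>\<^sup>2 * exp
  (\<sigma>\<^sup>2 t \<theta>\<^sup>2 / 2)\<close> has a positive limit, which is what makes the
  expected number of particles beyond \<open>N\<close> of order one. Giving up a strip of width
  \<open>\<kappa> * sqrt t\<close> multiplies tail probabilities only by
  \<open>exp (\<kappa> * sqrt t * \<theta>)\<close>, which grows more slowly than any power of
  \<open>t\<close>. The gradient error is \<open>sqrt t\<close> times the square of such a tail, of
  order \<open>1 / sqrt t\<close> up to subpolynomial factors.\<close>

lemma has_sum_swap_abs: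
  fixes f :: "'a \<Rightarrow> 'b \<Rightarrow> 'c::banach"
  assumes F: "\<And>x. (f x has_sum F x) UNIV"
    and G: "\<And>x. ((\<lambda>y. norm (f x y)) has_sum G x) UNIV"
    and G_sum: "G summable_on UNIV"
    and S: "(F has_sum S) UNIV"
  shows "(\<lambda>x. norm (f x y)) summable_on UNIV"
    and "((\<lambda>y. \<Sum>\<^sub>\<infinity>x. f x y) has_sum S) UNIV"
proof -
  have abs: "(\<lambda>(x, y). f x y) abs_summable_on UNIV \<times> UNIV"
  proof -
    have "norm (\<Sum>\<^sub>\<infinity>y. norm (f x y)) = G x" for x
      using infsumI[OF G[of x]] has_sum_nonneg[OF G[of x]] by simp
    with G_sum have "(\<lambda>x. norm (\<Sum>\<^sub>\<infinity>y. norm (f x y))) summable_on UNIV"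
      by simp
    then show ?thesis
      using G has_sum_imp_summable
      by (subst Infinite_Sum.abs_summable_on_Sigma_iff) auto
  qed
  then have "(\<lambda>(y, x). norm (f x y)) summable_on UNIV \<times> UNIV"
    by (subst summable_on_swap) (simp add: case_prod_unfold)
  then show 1: "(\<lambda>x. norm (f x y)) summable_on UNIV" for y
    using summable_on_SigmaD1[of "\<lambda>y x. norm (f x y)" UNIV "\<lambda>_. UNIV" y] by simp
  have "((\<lambda>(x, y). f x y) has_sum S) (UNIV \<times> UNIV)"
    using has_sum_SigmaI[of UNIV "\<lambda>(x, y). f x y" "\<lambda>_. UNIV" F S]
      F S abs_summable_summable[OF abs] by simp
  then have "((\<lambda>(y, x). f x y) has_sum S) (UNIV \<times> UNIV)"
    by (subst has_sum_swap) (simp add: case_prod_unfold)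
  from has_sum_SigmaD[OF this, of "\<lambda>y. \<Sum>\<^sub>\<infinity>x. f x y"] 1
  show "((\<lambda>y. \<Sum>\<^sub>\<infinity>x. f x y) has_sum S) UNIV"
    by (simp add: abs_summable_summable)
qed

lemma has_sum_shift_int:
  fixes f :: "int \<Rightarrow> 'c::{comm_monoid_add, topological_space}"
  shows "((\<lambda>x. f (x - k)) has_sum S) UNIV \<longleftrightarrow> (f has_sum S) UNIV"
  by (rule has_sum_reindex_bij_witness[of _ "\<lambda>x. x + k" "\<lambda>x. x - k"]) auto

lemma has_sum_reflect_int:
  fixes f :: "int \<Rightarrow> 'c::{comm_monoid_add, topological_space}"
  shows "((\<lambda>x. f (k - x)) has_sum S) UNIV \<longleftrightarrow> (f has_sum S) UNIV"
  by (rule has_sum_reindex_bij_witness[of _ "\<lambda>x. k - x" "\<lambda>x. k - x"]) auto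

text \<open>Cauchy products over the integers; this makes generating functions multiplicative under
  convolution in \<open>rw_prob_mgf\<close>.\<close>

lemma has_sum_convolution_int:
  fixes a b :: "int \<Rightarrow> 'c::{banach, real_normed_field}"
  assumes a: "(a has_sum A) UNIV" "(\<lambda>k. norm (a k)) summable_on UNIV"
    and b: "(b has_sum B) UNIV" "(\<lambda>k. norm (b k)) summable_on UNIV"
  shows "(\<lambda>k. norm (a k * b (x - k))) summable_on UNIV"
    and "((\<lambda>x. \<Sum>\<^sub>\<infinity>k. a k * b (x - k)) has_sum (A * B)) UNIV"
proof -
  define B' where "B' = (\<Sum>\<^sub>\<infinity>k. norm (b k))"
  have B': "((\<lambda>k. norm (b k)) has_sum B') UNIV"
    unfolding B'_def using b by simp
  have 1: "((\<lambda>x. a k * b (x - k)) has_sum (a k * B)) UNIV" for k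
    using has_sum_shift_int[of b k B] b(1) by (intro has_sum_cmult_right) auto
  have 2: "((\<lambda>x. norm (a k * b (x - k))) has_sum (norm (a k) * B')) UNIV" for k
    using has_sum_shift_int[of "\<lambda>j. norm (b j)" k B'] B'
    by (simp add: norm_mult has_sum_cmult_right)
  have 3: "(\<lambda>k. norm (a k) * B') summable_on UNIV"
    using a(2) by (rule summable_on_cmult_left)
  have 4: "((\<lambda>k. a k * B) has_sum (A * B)) UNIV"
    using a(1) by (rule has_sum_cmult_left)
  show "(\<lambda>k. norm (a k * b (x - k))) summable_on UNIV"
    by (rule has_sum_swap_abs(1)[OF 1 2 3 4])
  show "((\<lambda>x. \<Sum>\<^sub>\<infinity>k. a k * b (x - k)) has_sum (A * B)) UNIV"
    by (rule has_sum_swap_abs(2)[OF 1 2 3 4])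
qed

text \<open>Summability is not assumed: a divergent family has value 0 by convention, and a
  divergent real family stays divergent over the complex numbers, because real parts of summable
  families are summable.\<close>

lemma infsum_complex_of_real:
  "(\<Sum>\<^sub>\<infinity>x\<in>A. complex_of_real (f x)) = complex_of_real (infsum f A)"
proof (cases "f summable_on A")
  case True
  then show ?thesis
    by (intro infsumI has_sum_of_real) simp
next
  case False
  then have "\<not> (\<lambda>x. complex_of_real (f x)) summable_on A"
    using summable_on_Re[of "\<lambda>x. complex_of_real (f x)" A] by auto
  with False show ?thesis
    by (simp add: infsum_not_exists)
qed

lemma pmf_has_sum_1: "(pmf p has_sum 1) UNIV"
proof -
  have 1: "(\<lambda>x. norm (pmf p x)) summable_on UNIV"
    using pmf_abs_summable[of p UNIV] unfolding abs_summable_equivalent[symmetric] .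
  have "infsum (pmf p) UNIV = 1"
    using infsetsum_infsum[OF pmf_abs_summable[of p UNIV]] infsetsum_pmf_eq_1[of p UNIV] by simp
  with 1 show ?thesis
    by (simp add: has_sum_iff abs_summable_summable)
qed

section \<open>The walk in discrete and in continuous time, with its generating functions\<close>

definition rw_jump :: "int pmf \<Rightarrow> (int \<Rightarrow> real) \<Rightarrow> int \<Rightarrow> real" where
  "rw_jump p f x = (\<Sum>\<^sub>\<infinity>k. pmf p k * f (x - k))"

primrec rw_prob :: "int pmf \<Rightarrow> nat \<Rightarrow> int \<Rightarrow> real" where
  "rw_prob p 0 = (\<lambda>x. of_bool (x = 0))"
| "rw_prob p (Suc n) = rw_jump p (rw_prob p n)"

text \<open>The continuous-time walk jumps at rate 1, so its number of steps up to time
  \<open>t\<close> is Poisson with mean \<open>t\<close>. The formula averages the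
  \<open>n\<close>-step laws over this number.\<close>

definition walk_prob :: "int pmf \<Rightarrow> real \<Rightarrow> int \<Rightarrow> real" where
  "walk_prob p t x = exp (- t) * (\<Sum>n. rw_prob p n x * (t ^ n / fact n))"

definition mgf :: "int pmf \<Rightarrow> complex \<Rightarrow> complex" where
  "mgf p s = (\<Sum>\<^sub>\<infinity>k. complex_of_real (pmf p k) * exp (s * of_int k))"

text \<open>The absolute value makes this single condition control \<open>mgf p s\<close> for all
  complex \<open>s\<close> in the strip where the real part has modulus at most
  \<open>\<theta>\<close>.\<close>

definition mgf_finite :: "int pmf \<Rightarrow> real \<Rightarrow> bool" where
  "mgf_finite p \<theta> \<longleftrightarrow> (\<lambda>k. pmf p k * exp (\<theta> * \<bar>real_of_int k\<bar>)) summable_on UNIV"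

lemma mgf_finite_0: "mgf_finite p 0"
  using pmf_has_sum_1[of p] by (auto simp: mgf_finite_def has_sum_imp_summable)

lemma mgf_norm_summable:
  assumes "mgf_finite p \<theta>" "\<bar>Re s\<bar> \<le> \<theta>"
  shows "(\<lambda>k. norm (complex_of_real (pmf p k) * exp (s * of_int k))) summable_on UNIV"
proof (rule summable_on_comparison_test)
  show "(\<lambda>k. pmf p k * exp (\<theta> * \<bar>real_of_int k\<bar>)) summable_on UNIV"
    using assms(1) by (simp add: mgf_finite_def)
  fix k :: int
  have "Re s * of_int k \<le> \<bar>Re s * of_int k\<bar>" by simp
  also have "\<dots> \<le> \<theta> * \<bar>real_of_int k\<bar>"
    using assms(2) by (simp add: abs_mult mult_right_mono)
  finally show "norm (complex_of_real (pmf p k) * exp (s * of_int k))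
      \<le> pmf p k * exp (\<theta> * \<bar>real_of_int k\<bar>)"
    by (simp add: norm_mult norm_exp_eq_Re mult_left_mono)
qed auto

lemma mgf_has_sum:
  assumes "mgf_finite p \<theta>" "\<bar>Re s\<bar> \<le> \<theta>"
  shows "((\<lambda>k. complex_of_real (pmf p k) * exp (s * of_int k)) has_sum mgf p s) UNIV"
  using abs_summable_summable[OF mgf_norm_summable[OF assms]] by (simp add: mgf_def)

lemma rw_prob_nonneg: "rw_prob p n x \<ge> 0"
  by (induction n arbitrary: x) (auto simp: rw_jump_def intro!: infsum_nonneg)

lemma rw_prob_mgf:
  assumes "mgf_finite p \<theta>" "\<bar>Re s\<bar> \<le> \<theta>"
  shows "((\<lambda>x. complex_of_real (rw_prob p n x) * exp (s * of_int x)) has_sum mgf p s ^ n) UNIV"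
  using assms(2)
proof (induction n arbitrary: s)
  case 0
  show ?case
    by (rule has_sum_finite_neutralI[of "{0}"]) auto
next
  case (Suc n)
  \<comment> \<open>Summability of the norms at \<open>s\<close> is the induction hypothesis at the
    real point \<open>Re s\<close>; this is why the induction leaves \<open>s\<close> free.\<close>
  have abs: "(\<lambda>x. norm (complex_of_real (rw_prob p n x) * exp (s * of_int x))) summable_on UNIV"
    if "\<bar>Re s\<bar> \<le> \<theta>" for s
  proof -
    have "(\<lambda>x. Re (complex_of_real (rw_prob p n x) * exp (complex_of_real (Re s) * of_int x))) summable_on UNIV"
      using that by (intro summable_on_Re has_sum_imp_summable[OF Suc.IH]) auto
    then show ?thesis
      by (simp add: norm_mult norm_exp_eq_Re rw_prob_nonneg Re_exp)
  qed
  let ?a = "\<lambda>k. complex_of_real (pmf p k) * exp (s * of_int k)"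
  let ?b = "\<lambda>x. complex_of_real (rw_prob p n x) * exp (s * of_int x)"
  note conv = has_sum_convolution_int[OF mgf_has_sum[OF assms(1) Suc.prems]
      mgf_norm_summable[OF assms(1) Suc.prems] Suc.IH[OF Suc.prems] abs[OF Suc.prems]]
  have "(\<Sum>\<^sub>\<infinity>k. ?a k * ?b (x - k)) = complex_of_real (rw_prob p (Suc n) x) * exp (s * of_int x)" for x
  proof -
    have eq: "?a k * ?b (x - k) = complex_of_real (pmf p k * rw_prob p n (x - k)) * exp (s * of_int x)" for k
      by (simp add: algebra_simps flip: exp_add)
    have "(\<Sum>\<^sub>\<infinity>k. ?a k * ?b (x - k))
        = (\<Sum>\<^sub>\<infinity>k. complex_of_real (pmf p k * rw_prob p n (x - k))) * exp (s * of_int x)"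
      unfolding eq by (rule infsum_cmult_left') 
    then show ?thesis
      by (simp add: rw_jump_def infsum_complex_of_real flip: of_real_mult)
  qed
  then show ?case using conv(2) by simp
qed


lemma mgf_0: "mgf p 0 = 1"
  using pmf_has_sum_1[of p] by (simp add: mgf_def infsum_complex_of_real infsumI)

lemma rw_prob_has_sum_1: "(rw_prob p n has_sum 1) UNIV"
  using has_sum_Re[OF rw_prob_mgf[OF mgf_finite_0, of 0 p n]] by (simp add: mgf_0)

lemma rw_prob_le_1: "rw_prob p n x \<le> 1"
  using finite_sum_le_has_sum[OF rw_prob_has_sum_1[of p n], of "{x}"] rw_prob_nonneg by auto

lemma rw_jump_has_sum:
  assumes "\<And>x. norm (f x) \<le> C"
  shows "((\<lambda>k. pmf p k * f (x - k)) has_sum rw_jump p f x) UNIV"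
proof -
  have "(\<lambda>k. pmf p k * C) summable_on UNIV"
    using pmf_has_sum_1 has_sum_imp_summable by (intro summable_on_cmult_left) blast
  then have "(\<lambda>k. norm (pmf p k * f (x - k))) summable_on UNIV"
    by (rule summable_on_comparison_test) (use assms in \<open>auto simp: abs_mult intro!: mult_left_mono\<close>)
  then show ?thesis
    unfolding rw_jump_def by (simp add: abs_summable_summable)
qed

definition rmgf :: "int pmf \<Rightarrow> real \<Rightarrow> real" where
  "rmgf p r = (\<Sum>\<^sub>\<infinity>k. pmf p k * exp (r * of_int k))"

lemma exp_of_real_int: "exp (complex_of_real r * of_int k) = of_real (exp (r * of_int k))"
  by (simp flip: exp_of_real)

lemma mgf_of_real: "mgf p (of_real r) = of_real (rmgf p r)"
  unfolding mgf_def rmgf_def exp_of_real_int of_real_mult[symmetric]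
  by (rule infsum_complex_of_real)

lemma rw_prob_rmgf:
  assumes "mgf_finite p \<theta>" "\<bar>r\<bar> \<le> \<theta>"
  shows "((\<lambda>x. rw_prob p n x * exp (r * of_int x)) has_sum rmgf p r ^ n) UNIV"
  using has_sum_Re[OF rw_prob_mgf[OF assms(1), of "of_real r" n]] assms(2)
  unfolding mgf_of_real exp_of_real_int of_real_mult[symmetric] of_real_power[symmetric] Re_complex_of_real
  by simp

lemma exp_has_sum: "((\<lambda>n. x ^ n / fact n) has_sum exp x) UNIV"
  for x :: "'a::{banach, real_normed_field}"
proof (rule norm_summable_imp_has_sum)
  show "(\<lambda>n. x ^ n / fact n) sums exp x"
    using exp_converges[of x] by (simp add: scaleR_conv_of_real field_simps)
  show "summable (\<lambda>n. norm (x ^ n / fact n))"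
    using summable_norm_exp[of x] by (simp add: norm_divide field_simps)
qed

lemma walk_prob_has_sum:
  "((\<lambda>n. rw_prob p n x * (t ^ n / fact n)) has_sum (exp t * walk_prob p t x)) UNIV"
proof -
  have nm: "summable (\<lambda>n. norm (rw_prob p n x * (t ^ n / fact n)))"
  proof (rule summable_comparison_test')
    show "summable (\<lambda>n. norm (t ^ n / fact n))"
      using summable_norm_exp[of t] by (simp add: field_simps)
    show "norm (norm (rw_prob p n x * (t ^ n / fact n))) \<le> norm (t ^ n / fact n)" for n
      using mult_right_mono[OF rw_prob_le_1[of p n x], of "norm (t ^ n / fact n)"] rw_prob_nonneg[of p n x]
      by (simp add: abs_mult)
  qed
  have "((\<lambda>n. rw_prob p n x * (t ^ n / fact n)) has_sum (\<Sum>n. rw_prob p n x * (t ^ n / fact n))) UNIV"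
    by (rule norm_summable_imp_has_sum[OF nm summable_sums[OF summable_norm_cancel[OF nm]]])
  moreover have "exp t * walk_prob p t x = (\<Sum>n. rw_prob p n x * (t ^ n / fact n))"
    by (simp add: walk_prob_def exp_minus)
  ultimately show ?thesis by simp
qed

lemma walk_prob_nonneg: "t \<ge> 0 \<Longrightarrow> walk_prob p t x \<ge> 0"
  using has_sum_nonneg[OF walk_prob_has_sum[of p x t]]
  by (simp add: rw_prob_nonneg zero_le_mult_iff)

lemma walk_prob_0: "walk_prob p 0 x = of_bool (x = 0)"
proof -
  have "((\<lambda>n. rw_prob p n x * (0 ^ n / fact n)) has_sum of_bool (x = 0)) UNIV"
    by (rule has_sum_finite_neutralI[of "{0}"]) auto
  from has_sum_unique[OF this walk_prob_has_sum] show ?thesis by simp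
qed

text \<open>The function \<open>exp t * walk_prob p t x\<close> is a power series in
  \<open>t\<close> with nonnegative coefficients, hence increasing. The estimate supplies one
  majorant, summable in \<open>x\<close>, for all times up to \<open>t\<close>.\<close>

lemma walk_prob_mono_time:
  assumes "0 \<le> r" "r \<le> t"
  shows "walk_prob p r x \<le> exp t * walk_prob p t x"
proof -
  have "exp r * walk_prob p r x \<le> exp t * walk_prob p t x"
  proof (rule has_sum_mono[OF walk_prob_has_sum walk_prob_has_sum])
    show "rw_prob p n x * (r ^ n / fact n) \<le> rw_prob p n x * (t ^ n / fact n)" for n
      using assms by (intro mult_left_mono divide_right_mono power_mono rw_prob_nonneg) auto
  qed
  moreover have "walk_prob p r x \<le> exp r * walk_prob p r x"
    using assms walk_prob_nonneg[of r p x] mult_right_mono[of 1 "exp r" "walk_prob p r x"] by simp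
  ultimately show ?thesis by linarith
qed

text \<open>Averaging the powers \<open>mgf p s ^ n\<close> over the Poisson number of steps gives
  an exponential series. The same computation at \<open>Re s\<close> bounds the norms and justifies
  exchanging the sums over steps and sites.\<close>

lemma walk_prob_mgf:
  assumes "mgf_finite p \<theta>" "\<bar>Re s\<bar> \<le> \<theta>" "t \<ge> 0"
  shows "((\<lambda>x. complex_of_real (walk_prob p t x) * exp (s * of_int x)) has_sum exp (of_real t * (mgf p s - 1))) UNIV"
proof -
  define f where "f = (\<lambda>n x. complex_of_real (t ^ n / fact n) * (complex_of_real (rw_prob p n x) * exp (s * of_int x)))"
  have F: "(f n has_sum (of_real t * mgf p s) ^ n / fact n) UNIV" for n
    using has_sum_cmult_right[OF rw_prob_mgf[OF assms(1,2), of n], of "complex_of_real (t ^ n / fact n)"]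
    by (simp add: f_def power_mult_distrib)
  have G: "((\<lambda>x. norm (f n x)) has_sum (t * rmgf p (Re s)) ^ n / fact n) UNIV" for n
    using has_sum_cmult_right[OF rw_prob_rmgf[OF assms(1), of "Re s" n], of "t ^ n / fact n"] assms(2,3)
    by (simp add: f_def norm_mult norm_divide norm_power rw_prob_nonneg norm_exp_eq_Re power_mult_distrib)
  have H: "(\<lambda>n. (t * rmgf p (Re s)) ^ n / fact n) summable_on UNIV"
    using exp_has_sum by (rule has_sum_imp_summable)
  note sw = has_sum_swap_abs[OF F G H exp_has_sum]
  have "(\<Sum>\<^sub>\<infinity>n. f n x) = of_real (exp t) * (complex_of_real (walk_prob p t x) * exp (s * of_int x))" for x
  proof -
    have "(\<Sum>\<^sub>\<infinity>n. f n x) = (\<Sum>\<^sub>\<infinity>n. complex_of_real (rw_prob p n x * (t ^ n / fact n))) * exp (s * of_int x)"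
      by (subst infsum_cmult_left'[symmetric]) (simp add: f_def mult_ac)
    also have "\<dots> = complex_of_real (exp t * walk_prob p t x) * exp (s * of_int x)"
      by (simp only: infsum_complex_of_real infsumI[OF walk_prob_has_sum])
    finally show ?thesis by (simp add: mult_ac)
  qed
  with sw(2) have "((\<lambda>x. of_real (exp (- t)) * (of_real (exp t) * (complex_of_real (walk_prob p t x) * exp (s * of_int x)))) has_sum
      of_real (exp (- t)) * exp (of_real t * mgf p s)) UNIV"
    by (intro has_sum_cmult_right) simp
  moreover have "of_real (exp (- t)) * (of_real (exp t) * z) = (z::complex)" for z
    by (simp only: mult.assoc[symmetric] of_real_mult[symmetric] exp_add[symmetric]) simp
  moreover have "of_real (exp (- t)) * exp (of_real t * mgf p s) = exp (of_real t * (mgf p s - 1))"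
    by (simp add: right_diff_distrib flip: exp_of_real exp_add)
  ultimately show ?thesis by simp
qed

lemma walk_prob_has_sum_1: "t \<ge> 0 \<Longrightarrow> (walk_prob p t has_sum 1) UNIV"
  using has_sum_Re[OF walk_prob_mgf[OF mgf_finite_0, of 0 t p]] by (simp add: mgf_0)

lemma walk_prob_le_1: "t \<ge> 0 \<Longrightarrow> walk_prob p t x \<le> 1"
  using finite_sum_le_has_sum[OF walk_prob_has_sum_1[of t p], of "{x}"] walk_prob_nonneg by auto

text \<open>Shifting the coefficients of a series in \<open>t ^ n / fact n\<close> differentiates
  it, and here the shifted coefficients are one further convolution with \<open>p\<close>. This is
  the source of the Kolmogorov equation in \<open>walk_prob_deriv\<close>.\<close>

lemma walk_prob_jump:
  assumes "t \<ge> 0"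
  shows "((\<lambda>n. rw_prob p (Suc n) x * (t ^ n / fact n)) has_sum exp t * rw_jump p (walk_prob p t) x) UNIV"
proof -
  define f where "f = (\<lambda>k n. pmf p k * (rw_prob p n (x - k) * (t ^ n / fact n)))"
  have F: "(f k has_sum pmf p k * (exp t * walk_prob p t (x - k))) UNIV" for k
    unfolding f_def by (intro has_sum_cmult_right walk_prob_has_sum)
  have nn: "norm (f k n) = f k n" for k n
    using assms by (simp add: f_def rw_prob_nonneg)
  have "((\<lambda>k. pmf p k * walk_prob p t (x - k)) has_sum rw_jump p (walk_prob p t) x) UNIV"
    using assms by (intro rw_jump_has_sum[of _ 1]) (simp add: walk_prob_nonneg walk_prob_le_1)
  from has_sum_cmult_right[OF this, of "exp t"]
  have S: "((\<lambda>k. pmf p k * (exp t * walk_prob p t (x - k))) has_sum exp t * rw_jump p (walk_prob p t) x) UNIV"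
    by (simp add: mult_ac)
  have "((\<lambda>n. \<Sum>\<^sub>\<infinity>k. f k n) has_sum exp t * rw_jump p (walk_prob p t) x) UNIV"
    by (rule has_sum_swap_abs(2)[OF F _ has_sum_imp_summable[OF S] S]) (simp only: nn F)
  moreover have "(\<Sum>\<^sub>\<infinity>k. f k n) = rw_prob p (Suc n) x * (t ^ n / fact n)" for n
    unfolding f_def rw_prob.simps rw_jump_def
    by (subst infsum_cmult_left'[symmetric]) (simp only: mult.assoc)
  ultimately show ?thesis by simp
qed

lemma walk_prob_deriv:
  assumes "t \<ge> 0"
  shows "((\<lambda>t. walk_prob p t x) has_real_derivative rw_jump p (walk_prob p t) x - walk_prob p t x) (at t)"
proof -
  define c where "c = (\<lambda>n. rw_prob p n x / fact n)"
  have sm: "summable (\<lambda>n. c n * y ^ n)" for y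
    using has_sum_imp_sums[OF walk_prob_has_sum[of p x y]] by (simp add: c_def sums_iff)
  have d: "((\<lambda>y. \<Sum>n. c n * y ^ n) has_real_derivative (\<Sum>n. diffs c n * t ^ n)) (at t)"
    by (rule termdiffs_strong_converges_everywhere) (rule sm)
  have "diffs c n * t ^ n = rw_prob p (Suc n) x * (t ^ n / fact n)" for n
    by (simp add: c_def diffs_def field_simps del: of_nat_Suc)
  then have e: "(\<Sum>n. diffs c n * t ^ n) = exp t * rw_jump p (walk_prob p t) x"
    using has_sum_imp_sums[OF walk_prob_jump[OF assms, of p x]] by (simp add: sums_iff)
  have w: "walk_prob p y x = exp (- y) * (\<Sum>n. c n * y ^ n)" for y
    by (simp add: walk_prob_def c_def field_simps)
  have "((\<lambda>y. exp (- y)) has_real_derivative - exp (- t)) (at t)"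
    by (auto intro!: derivative_eq_intros)
  from DERIV_mult[OF this d]
  have "((\<lambda>y. walk_prob p y x) has_real_derivative
      - exp (- t) * (\<Sum>n. c n * t ^ n) + (\<Sum>n. diffs c n * t ^ n) * exp (- t)) (at t)"
    by (simp only: w)
  moreover have "(\<Sum>n. diffs c n * t ^ n) * exp (- t) = rw_jump p (walk_prob p t) x"
    unfolding e by (simp add: exp_minus)
  moreover have "- exp (- t) * (\<Sum>n. c n * t ^ n) = - walk_prob p t x"
    by (simp only: w mult_minus_left)
  ultimately show ?thesis by simp
qed

locale symmetric_jumps =
  fixes p :: "int pmf"
  assumes pmf_sym: "pmf p (- i) = pmf p i"


section \<open>Moment generating function and spectral gap\<close>

lemma power_le_fact_exp:
  fixes x :: real
  assumes "x \<ge> 0"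
  shows "x ^ n \<le> fact n * exp x"
proof -
  have "x ^ n / fact n \<le> exp x"
    using finite_sum_le_has_sum[OF exp_has_sum[of x], of "{n}"] assms by simp
  then show ?thesis by (simp add: field_simps)
qed

text \<open>Averaging the third-order Taylor expansions at \<open>w\<close> and at
  \<open>- w\<close> cancels the odd terms and leaves a remainder of fourth order. The factor 1/6
  that this produces is dropped.\<close>

lemma exp_cosh_taylor:
  fixes w :: complex
  shows "norm ((exp w + exp (- w)) / 2 - 1 - w\<^sup>2 / 2) \<le> norm w ^ 4 * exp \<bar>Re w\<bar>"
proof -
  have 1: "norm (exp z - (1 + z + z\<^sup>2 / 2 + z ^ 3 / 6)) \<le> exp \<bar>Re z\<bar> * norm z ^ 4 / 6" for z :: complex
    using Taylor_exp[of z 3] by (simp add: numeral_eq_Suc fact_numeral)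
  have "norm ((exp w - (1 + w + w\<^sup>2 / 2 + w ^ 3 / 6)) + (exp (- w) - (1 + - w + (- w)\<^sup>2 / 2 + (- w) ^ 3 / 6)))
      \<le> exp \<bar>Re w\<bar> * norm w ^ 4 / 6 + exp \<bar>Re (- w)\<bar> * norm (- w) ^ 4 / 6"
    by (intro norm_triangle_mono 1)
  also have "(exp w - (1 + w + w\<^sup>2 / 2 + w ^ 3 / 6)) + (exp (- w) - (1 + - w + (- w)\<^sup>2 / 2 + (- w) ^ 3 / 6))
     = 2 * ((exp w + exp (- w)) / 2 - 1 - w\<^sup>2 / 2)"
    by (simp add: field_simps power3_eq_cube)
  finally have "2 * norm ((exp w + exp (- w)) / 2 - 1 - w\<^sup>2 / 2) \<le> exp \<bar>Re w\<bar> * norm w ^ 4 / 6 + exp \<bar>Re w\<bar> * norm w ^ 4 / 6"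
    by (simp only: norm_mult norm_numeral norm_minus_cancel minus_complex.simps uminus_complex.simps abs_minus_cancel)
  moreover have "exp \<bar>Re w\<bar> * norm w ^ 4 \<ge> 0" by simp
  ultimately have "norm ((exp w + exp (- w)) / 2 - 1 - w\<^sup>2 / 2) \<le> exp \<bar>Re w\<bar> * norm w ^ 4"
    by linarith
  then show ?thesis by (simp add: mult_ac)
qed

locale symmetric_walk = symmetric_jumps p for p +
  fixes \<theta>\<^sub>0 \<sigma> :: real
  assumes exponent_pos: "\<theta>\<^sub>0 > 0"
    and finite_mgf: "mgf_finite p \<theta>\<^sub>0"
    and irred: "rw_irreducible p"
    and std_pos: "\<sigma> > 0"
    and variance_eq: "\<sigma>\<^sup>2 = (\<Sum>\<^sub>\<infinity>i\<in>UNIV. (real_of_int i)\<^sup>2 * pmf p i)"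
begin

lemma mgf_has_sum':
  assumes "\<bar>Re s\<bar> \<le> \<theta>\<^sub>0"
  shows "((\<lambda>k. complex_of_real (pmf p k) * exp (s * of_int k)) has_sum mgf p s) UNIV"
  using mgf_has_sum[OF finite_mgf assms] .

lemma mgf_uminus: "mgf p (- s) = mgf p s"
  unfolding mgf_def
  by (rule infsum_reindex_bij_witness[of _ uminus uminus]) (auto simp: pmf_sym)

lemma mgf_has_sum_cosh:
  assumes "\<bar>Re s\<bar> \<le> \<theta>\<^sub>0"
  shows "((\<lambda>k. complex_of_real (pmf p k) * ((exp (s * of_int k) + exp (- (s * of_int k))) / 2)) has_sum mgf p s) UNIV"
proof -
  have "((\<lambda>k. complex_of_real (pmf p k) * exp (s * of_int k) + complex_of_real (pmf p k) * exp (- s * of_int k))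
      has_sum (mgf p s + mgf p (- s))) UNIV"
    using assms by (intro has_sum_add mgf_has_sum') auto
  from has_sum_divide_const[OF this, of 2] show ?thesis
    by (simp add: mgf_uminus ring_distribs add_divide_distrib)
qed

lemma exp_moment_has_sum:
  "((\<lambda>k. pmf p k * exp (\<theta>\<^sub>0 * \<bar>real_of_int k\<bar>)) has_sum (\<Sum>\<^sub>\<infinity>k. pmf p k * exp (\<theta>\<^sub>0 * \<bar>real_of_int k\<bar>))) UNIV"
  using finite_mgf by (simp add: mgf_finite_def)

text \<open>One half of the exponential weight absorbs the power of \<open>k\<close> and the other
  half is left over. This is where the restriction to \<open>\<theta>\<^sub>0 / 2\<close> in the
  Taylor estimates comes from.\<close>

lemma power_exp_moment_bound:
  "\<bar>real_of_int k\<bar> ^ n * exp (\<theta>\<^sub>0 / 2 * \<bar>real_of_int k\<bar>)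
     \<le> fact n * (2 / \<theta>\<^sub>0) ^ n * exp (\<theta>\<^sub>0 * \<bar>real_of_int k\<bar>)"
proof -
  have "(\<theta>\<^sub>0 / 2 * \<bar>real_of_int k\<bar>) ^ n \<le> fact n * exp (\<theta>\<^sub>0 / 2 * \<bar>real_of_int k\<bar>)"
    using exponent_pos by (intro power_le_fact_exp) auto
  then have "(2 / \<theta>\<^sub>0) ^ n * (\<theta>\<^sub>0 / 2 * \<bar>real_of_int k\<bar>) ^ n
      \<le> (2 / \<theta>\<^sub>0) ^ n * (fact n * exp (\<theta>\<^sub>0 / 2 * \<bar>real_of_int k\<bar>))"
    using exponent_pos by (intro mult_left_mono) auto
  moreover have "(2 / \<theta>\<^sub>0) ^ n * (\<theta>\<^sub>0 / 2 * \<bar>real_of_int k\<bar>) ^ n = \<bar>real_of_int k\<bar> ^ n"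
    using exponent_pos by (simp flip: power_mult_distrib)
  ultimately have "\<bar>real_of_int k\<bar> ^ n \<le> fact n * (2 / \<theta>\<^sub>0) ^ n * exp (\<theta>\<^sub>0 / 2 * \<bar>real_of_int k\<bar>)"
    by (simp add: mult_ac)
  then have "\<bar>real_of_int k\<bar> ^ n * exp (\<theta>\<^sub>0 / 2 * \<bar>real_of_int k\<bar>)
      \<le> fact n * (2 / \<theta>\<^sub>0) ^ n * exp (\<theta>\<^sub>0 / 2 * \<bar>real_of_int k\<bar>) * exp (\<theta>\<^sub>0 / 2 * \<bar>real_of_int k\<bar>)"
    by (intro mult_right_mono) auto
  then show ?thesis
    by (simp add: mult.assoc flip: exp_add)
qed

lemma pmf_power_moment_summable: "(\<lambda>k. pmf p k * \<bar>real_of_int k\<bar> ^ n) summable_on UNIV"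
proof (rule summable_on_comparison_test)
  show "(\<lambda>k. fact n * (2 / \<theta>\<^sub>0) ^ n * (pmf p k * exp (\<theta>\<^sub>0 * \<bar>real_of_int k\<bar>))) summable_on UNIV"
    using exp_moment_has_sum by (intro summable_on_cmult_right has_sum_imp_summable)
  fix k :: int
  have "\<bar>real_of_int k\<bar> ^ n * 1 \<le> \<bar>real_of_int k\<bar> ^ n * exp (\<theta>\<^sub>0 / 2 * \<bar>real_of_int k\<bar>)"
    using exponent_pos by (intro mult_left_mono) auto
  also note power_exp_moment_bound
  finally show "pmf p k * \<bar>real_of_int k\<bar> ^ n \<le> fact n * (2 / \<theta>\<^sub>0) ^ n * (pmf p k * exp (\<theta>\<^sub>0 * \<bar>real_of_int k\<bar>))"
    using mult_left_mono[of _ _ "pmf p k"] by (fastforce simp: mult_ac)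
qed auto

lemma variance_has_sum: "((\<lambda>k. pmf p k * (real_of_int k)\<^sup>2) has_sum \<sigma>\<^sup>2) UNIV"
proof -
  have "(\<lambda>k. pmf p k * (real_of_int k)\<^sup>2) summable_on UNIV"
    using pmf_power_moment_summable[of 2] by simp
  then show ?thesis
    unfolding variance_eq by (simp add: mult.commute)
qed

lemma mgf_taylor:
  obtains C where "C > 0"
    "\<And>s. norm s \<le> \<theta>\<^sub>0 / 2 \<Longrightarrow> norm (mgf p s - 1 - of_real (\<sigma>\<^sup>2) * s\<^sup>2 / 2) \<le> C * norm s ^ 4"
proof -
  define C where "C = fact 4 * (2 / \<theta>\<^sub>0) ^ 4 * (\<Sum>\<^sub>\<infinity>k. pmf p k * exp (\<theta>\<^sub>0 * \<bar>real_of_int k\<bar>))"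
  have C: "norm (mgf p s - 1 - of_real (\<sigma>\<^sup>2) * s\<^sup>2 / 2) \<le> C * norm s ^ 4" if s: "norm s \<le> \<theta>\<^sub>0 / 2" for s
  proof -
    have "\<bar>Re s\<bar> \<le> \<theta>\<^sub>0"
      using s abs_Re_le_cmod[of s] exponent_pos by linarith
    note m = mgf_has_sum_cosh[OF this]
    have one: "((\<lambda>k. complex_of_real (pmf p k)) has_sum 1) UNIV"
      using has_sum_of_real[OF pmf_has_sum_1[of p]] by simp
    have "((\<lambda>k. complex_of_real (pmf p k * (real_of_int k)\<^sup>2)) has_sum (complex_of_real (\<sigma>\<^sup>2))) UNIV"
      using has_sum_of_real[OF variance_has_sum] by blast
    from has_sum_cmult_left[OF this, of "s\<^sup>2 / 2"]
    have var: "((\<lambda>k. complex_of_real (pmf p k) * ((s * of_int k)\<^sup>2 / 2)) has_sum (of_real (\<sigma>\<^sup>2) * s\<^sup>2 / 2)) UNIV"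
      by (simp add: field_simps)
    let ?g = "\<lambda>k. fact 4 * (2 / \<theta>\<^sub>0) ^ 4 * norm s ^ 4 * (pmf p k * exp (\<theta>\<^sub>0 * \<bar>real_of_int k\<bar>))"
    have "norm (mgf p s + - 1 + - (of_real (\<sigma>\<^sup>2) * s\<^sup>2 / 2)) \<le>
      fact 4 * (2 / \<theta>\<^sub>0) ^ 4 * norm s ^ 4 * (\<Sum>\<^sub>\<infinity>k. pmf p k * exp (\<theta>\<^sub>0 * \<bar>real_of_int k\<bar>))"
    proof (rule norm_infsum_le)
      show "((\<lambda>k. complex_of_real (pmf p k) * ((exp (s * of_int k) + exp (- (s * of_int k))) / 2)
          + - complex_of_real (pmf p k) + - (complex_of_real (pmf p k) * ((s * of_int k)\<^sup>2 / 2)))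
          has_sum (mgf p s + - 1 + - (of_real (\<sigma>\<^sup>2) * s\<^sup>2 / 2))) UNIV"
        using m one var by (intro has_sum_add has_sum_uminusI)
      show "(?g has_sum fact 4 * (2 / \<theta>\<^sub>0) ^ 4 * norm s ^ 4 * (\<Sum>\<^sub>\<infinity>k. pmf p k * exp (\<theta>\<^sub>0 * \<bar>real_of_int k\<bar>))) UNIV"
        by (intro has_sum_cmult_right exp_moment_has_sum)
      fix k :: int
      let ?w = "s * of_int k"
      have eq: "complex_of_real (pmf p k) * ((exp ?w + exp (- ?w)) / 2)
          + - complex_of_real (pmf p k) + - (complex_of_real (pmf p k) * (?w\<^sup>2 / 2))
          = complex_of_real (pmf p k) * ((exp ?w + exp (- ?w)) / 2 - 1 - ?w\<^sup>2 / 2)"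
        by (simp add: algebra_simps)
      have "\<bar>Re ?w\<bar> \<le> \<theta>\<^sub>0 / 2 * \<bar>real_of_int k\<bar>"
      proof -
        have "\<bar>Re ?w\<bar> \<le> norm ?w" by (rule abs_Re_le_cmod)
        also have "\<dots> \<le> \<theta>\<^sub>0 / 2 * \<bar>real_of_int k\<bar>"
          using mult_right_mono[OF s, of "\<bar>real_of_int k\<bar>"] by (simp add: norm_mult)
        finally show ?thesis .
      qed
      then have "norm ?w ^ 4 * exp \<bar>Re ?w\<bar> \<le> norm s ^ 4 * (\<bar>real_of_int k\<bar> ^ 4 * exp (\<theta>\<^sub>0 / 2 * \<bar>real_of_int k\<bar>))"
        by (simp add: norm_mult power_mult_distrib mult_left_mono mult.assoc)
      also have "\<dots> \<le> norm s ^ 4 * (fact 4 * (2 / \<theta>\<^sub>0) ^ 4 * exp (\<theta>\<^sub>0 * \<bar>real_of_int k\<bar>))"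
        by (intro mult_left_mono power_exp_moment_bound) auto
      finally have "norm ((exp ?w + exp (- ?w)) / 2 - 1 - ?w\<^sup>2 / 2)
          \<le> norm s ^ 4 * (fact 4 * (2 / \<theta>\<^sub>0) ^ 4 * exp (\<theta>\<^sub>0 * \<bar>real_of_int k\<bar>))"
        using exp_cosh_taylor[of ?w] by linarith
      then have "pmf p k * norm ((exp ?w + exp (- ?w)) / 2 - 1 - ?w\<^sup>2 / 2)
          \<le> pmf p k * (norm s ^ 4 * (fact 4 * (2 / \<theta>\<^sub>0) ^ 4 * exp (\<theta>\<^sub>0 * \<bar>real_of_int k\<bar>)))"
        by (intro mult_left_mono) auto
      then show "norm (complex_of_real (pmf p k) * ((exp ?w + exp (- ?w)) / 2)
          + - complex_of_real (pmf p k) + - (complex_of_real (pmf p k) * (?w\<^sup>2 / 2))) \<le> ?g k"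
        unfolding eq norm_mult by (simp add: mult_ac)
    qed
    then show ?thesis by (simp add: C_def mult_ac)
  qed
  \<comment> \<open>Passing to \<open>\<bar>C\<bar> + 1\<close> gives a positive constant without an
    argument for the sign of the series that defines \<open>C\<close>.\<close>
  have "norm (mgf p s - 1 - of_real (\<sigma>\<^sup>2) * s\<^sup>2 / 2) \<le> (\<bar>C\<bar> + 1) * norm s ^ 4" if "norm s \<le> \<theta>\<^sub>0 / 2" for s
  proof -
    have "C * norm s ^ 4 \<le> (\<bar>C\<bar> + 1) * norm s ^ 4"
      by (intro mult_right_mono) auto
    with C[OF that] show ?thesis by linarith
  qed
  with that[of "\<bar>C\<bar> + 1"] show thesis by fastforce
qed

text \<open>One minus the characteristic function of \<open>p\<close> at \<open>u\<close>, which is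
  real by symmetry: the decay rate of the Fourier mode \<open>u\<close> under the walk.\<close>

definition gap :: "real \<Rightarrow> real" where
  "gap u = (\<Sum>\<^sub>\<infinity>k. pmf p k * (1 - cos (u * of_int k)))"

lemma gap_has_sum: "((\<lambda>k. pmf p k * (1 - cos (u * of_int k))) has_sum gap u) UNIV"
proof -
  have "(\<lambda>k. pmf p k * 2) summable_on UNIV"
    using pmf_has_sum_1 has_sum_imp_summable by (intro summable_on_cmult_left) blast
  then have "(\<lambda>k. pmf p k * (1 - cos (u * of_int k))) summable_on UNIV"
  proof (rule summable_on_comparison_test)
    fix k :: int
    have "1 - cos (u * real_of_int k) \<le> 2" using cos_ge_minus_one[of "u * real_of_int k"] by linarith
    then show "pmf p k * (1 - cos (u * real_of_int k)) \<le> pmf p k * 2" by (intro mult_left_mono) auto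
  qed auto
  then show ?thesis by (simp add: gap_def)
qed

lemma gap_nonneg: "gap u \<ge> 0"
  by (rule has_sum_nonneg[OF gap_has_sum]) auto

text \<open>Termwise this is \<open>(cosh a - 1) * (1 - cos b) \<ge> 0\<close>. It says that along a
  tilted line the integrand of the inversion formula decays in \<open>u\<close> at least as fast as
  along the imaginary axis, uniformly in the tilt.\<close>

lemma Re_mgf_gap:
  assumes "\<bar>\<theta>\<bar> \<le> \<theta>\<^sub>0"
  shows "Re (mgf p (Complex \<theta> u)) \<le> rmgf p \<theta> - gap u"
proof -
  have 1: "((\<lambda>k. pmf p k * (cosh (\<theta> * of_int k) * cos (u * of_int k))) has_sum Re (mgf p (Complex \<theta> u))) UNIV"
    using has_sum_Re[OF mgf_has_sum_cosh[of "Complex \<theta> u"]] assms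
    by (simp add: Re_exp cosh_def algebra_simps add_divide_distrib)
  have 2: "((\<lambda>k. pmf p k * cosh (\<theta> * of_int k)) has_sum rmgf p \<theta>) UNIV"
    using has_sum_Re[OF mgf_has_sum_cosh[of "of_real \<theta>"]] assms
    by (simp add: mgf_of_real Re_exp cosh_def algebra_simps add_divide_distrib)
  have 3: "((\<lambda>k. pmf p k * (cosh (\<theta> * of_int k) * cos (u * of_int k)) + pmf p k * (1 - cos (u * of_int k)))
     has_sum (Re (mgf p (Complex \<theta> u)) + gap u)) UNIV"
    by (intro has_sum_add 1 gap_has_sum)
  have "Re (mgf p (Complex \<theta> u)) + gap u \<le> rmgf p \<theta>"
  proof (rule has_sum_mono[OF 3 2])
    fix k :: int
    have "0 \<le> (cosh (\<theta> * of_int k) - 1) * (1 - cos (u * of_int k))"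
      using cosh_real_ge_1 by (intro mult_nonneg_nonneg) auto
    then have "cosh (\<theta> * of_int k) * cos (u * of_int k) + (1 - cos (u * of_int k)) \<le> cosh (\<theta> * of_int k)"
      by (simp add: algebra_simps)
    from mult_left_mono[OF this, of "pmf p k"]
    show "pmf p k * (cosh (\<theta> * of_int k) * cos (u * of_int k)) + pmf p k * (1 - cos (u * of_int k)) \<le> pmf p k * cosh (\<theta> * of_int k)"
      by (simp add: distrib_left)
  qed
  then show ?thesis by linarith
qed

text \<open>By \<open>1 - cos b = 2 * (sin (b / 2))\<^sup>2\<close>, the jump \<open>k\<close> alone
  contributes a fixed positive multiple of the squared sine to \<open>gap u\<close>.\<close>

lemma sin_le_gap_step:
  assumes "pmf p k > 0"
  shows "\<exists>C\<ge>0. \<forall>u. \<bar>sin (u * of_int k / 2)\<bar> \<le> C * sqrt (gap u)"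
proof (intro exI conjI allI)
  fix u :: real
  have "pmf p k * (1 - cos (u * of_int k)) \<le> gap u"
    using finite_sum_le_has_sum[OF gap_has_sum[of u], of "{k}"] by simp
  moreover have "1 - cos (u * of_int k) = 2 * (sin (u * of_int k / 2))\<^sup>2"
    using cos_double_sin[of "u * of_int k / 2"] by simp
  ultimately have "(sin (u * of_int k / 2))\<^sup>2 \<le> gap u / (2 * pmf p k)"
    using assms by (simp add: field_simps)
  then have "sqrt ((sin (u * of_int k / 2))\<^sup>2) \<le> sqrt (gap u / (2 * pmf p k))"
    by (rule real_sqrt_le_mono)
  then show "\<bar>sin (u * of_int k / 2)\<bar> \<le> (1 / sqrt (2 * pmf p k)) * sqrt (gap u)"
    by (simp add: real_sqrt_divide)
qed (use assms in auto)

text \<open>The addition theorem makes \<open>\<bar>sin\<bar>\<close> subadditive, so the bound for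
  single jumps propagates along every path that the walk can follow.\<close>

lemma sin_le_gap_reachable:
  assumes "x \<in> set_pmf (rw_steps p n 0)"
  shows "\<exists>C\<ge>0. \<forall>u. \<bar>sin (u * of_int x / 2)\<bar> \<le> C * sqrt (gap u)"
  using assms
proof (induction n arbitrary: x)
  case 0
  then show ?case by (auto intro!: exI[of _ 0])
next
  case (Suc n)
  then obtain y k where y: "y \<in> set_pmf (rw_steps p n 0)" and k: "k \<in> set_pmf p" and x: "x = y + k"
    by auto
  from Suc.IH[OF y] obtain C1 where C1: "C1 \<ge> 0" "\<And>u. \<bar>sin (u * of_int y / 2)\<bar> \<le> C1 * sqrt (gap u)"
    by blast
  from sin_le_gap_step[of k] k obtain C2 where C2: "C2 \<ge> 0" "\<And>u. \<bar>sin (u * of_int k / 2)\<bar> \<le> C2 * sqrt (gap u)"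
    by (auto simp: pmf_positive)
  show ?case
  proof (intro exI conjI allI)
    fix u :: real
    have "sin (u * of_int x / 2) = sin (u * of_int y / 2 + u * of_int k / 2)"
      by (simp add: x ring_distribs add_divide_distrib)
    also have "\<bar>\<dots>\<bar> \<le> \<bar>sin (u * of_int y / 2)\<bar> * \<bar>cos (u * of_int k / 2)\<bar> + \<bar>cos (u * of_int y / 2)\<bar> * \<bar>sin (u * of_int k / 2)\<bar>"
      unfolding sin_add by (rule order_trans[OF abs_triangle_ineq]) (simp add: abs_mult)
    also have "\<dots> \<le> \<bar>sin (u * of_int y / 2)\<bar> * 1 + 1 * \<bar>sin (u * of_int k / 2)\<bar>"
      by (intro add_mono mult_left_mono mult_right_mono abs_cos_le_one) auto
    also have "\<dots> \<le> (C1 + C2) * sqrt (gap u)"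
      using C1(2)[of u] C2(2)[of u] by (simp add: ring_distribs)
    finally show "\<bar>sin (u * of_int x / 2)\<bar> \<le> (C1 + C2) * sqrt (gap u)" .
  qed (use C1 C2 in auto)
qed

text \<open>Irreducibility enters here: the site 1 is reachable from 0, so
  \<open>\<bar>sin (u / 2)\<bar>\<close> is controlled by \<open>sqrt (gap u)\<close>, while
  concavity of the sine bounds it below by \<open>\<bar>u\<bar> / pi\<close>.\<close>

lemma gap_lower:
  obtains c where "c > 0" "\<And>u. \<bar>u\<bar> \<le> pi \<Longrightarrow> c * u\<^sup>2 \<le> gap u"
proof -
  obtain n where "pmf (rw_steps p n 0) 1 > 0"
    using irred by (auto simp: rw_irreducible_def)
  then have "1 \<in> set_pmf (rw_steps p n 0)" by (simp add: set_pmf_iff)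
  from sin_le_gap_reachable[OF this] obtain C where C: "C \<ge> 0" "\<And>u. \<bar>sin (u / 2)\<bar> \<le> C * sqrt (gap u)"
    by auto
  have "1 \<le> C * sqrt (gap pi)" using C(2)[of pi] by simp
  then have "C \<noteq> 0" by auto
  with C have Cpos: "C > 0" by simp
  have "(1 / (pi * C))\<^sup>2 * u\<^sup>2 \<le> gap u" if "\<bar>u\<bar> \<le> pi" for u
  proof -
    have "\<bar>u\<bar> / pi \<le> \<bar>sin (u / 2)\<bar>"
    proof -
      have pos: "v / pi \<le> sin (v / 2)" if "0 \<le> v" "v \<le> pi" for v :: real
      proof -
        have "concave_on {0..pi} sin"
          by (rule f''_le0_imp_concave[where f' = cos and f'' = "\<lambda>x. - sin x"])
             (auto intro!: derivative_eq_intros sin_ge_zero)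
        then have "(1 - v / pi) * sin 0 + (v / pi) * sin (pi / 2) \<le> sin ((1 - v / pi) *\<^sub>R 0 + (v / pi) *\<^sub>R (pi / 2))"
          using that by (intro concave_onD) (auto simp: field_simps)
        then show ?thesis by simp
      qed
      show ?thesis
      proof (cases "u \<ge> 0")
        case True
        with pos[of u] that show ?thesis by simp
      next
        case False
        with pos[of "- u"] that show ?thesis by simp
      qed
    qed
    also note C(2)[of u]
    finally have "\<bar>u\<bar> / (pi * C) \<le> sqrt (gap u)"
      using Cpos by (simp add: field_simps)
    then have "(\<bar>u\<bar> / (pi * C))\<^sup>2 \<le> (sqrt (gap u))\<^sup>2"
      using Cpos by (intro power_mono) auto
    then show ?thesis
      using gap_nonneg[of u] by (simp add: power_divide)
  qed
  moreover have "(1 / (pi * C))\<^sup>2 > 0" using Cpos by simp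
  ultimately show thesis using that by blast
qed

end


section \<open>Fourier inversion\<close>

text \<open>Weierstrass M-test: the partial sums converge uniformly on the interval, which gives
  both integration term by term and continuity of the sum.\<close>

lemma has_sum_integral:
  fixes f :: "'k \<Rightarrow> real \<Rightarrow> complex"
  assumes cont: "\<And>k. continuous_on {a..b} (f k)"
    and bnd: "\<And>k u. u \<in> {a..b} \<Longrightarrow> norm (f k u) \<le> B k"
    and B: "B summable_on UNIV"
    and S: "\<And>u. u \<in> {a..b} \<Longrightarrow> ((\<lambda>k. f k u) has_sum S u) UNIV"
  shows "((\<lambda>k. integral {a..b} (f k)) has_sum integral {a..b} S) UNIV"
    and "continuous_on {a..b} S"
proof -
  have ul: "uniform_limit {a..b} (\<lambda>X u. \<Sum>k\<in>X. f k u) S (finite_subsets_at_top UNIV)"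
    by (rule Weierstrass_m_test_general'[OF _ S B]) (use bnd in auto)
  show "continuous_on {a..b} S"
    by (rule uniform_limit_theorem[OF _ ul]) (auto intro!: continuous_on_sum cont)
  from ul have ul': "uniform_limit (cbox a b) (\<lambda>X u. \<Sum>k\<in>X. f k u) S (finite_subsets_at_top UNIV)"
    by simp
  obtain I J where I: "\<And>X. ((\<lambda>u. \<Sum>k\<in>X. f k u) has_integral I X) (cbox a b)"
    and J: "(S has_integral J) (cbox a b)" and lim: "(I \<longlongrightarrow> J) (finite_subsets_at_top UNIV)"
    using uniform_limit_integral_cbox[OF ul'] cont by (auto intro!: continuous_on_sum)
  have "I X = (\<Sum>k\<in>X. integral {a..b} (f k))" if "finite X" for X
  proof -
    have "((\<lambda>u. \<Sum>k\<in>X. f k u) has_integral (\<Sum>k\<in>X. integral {a..b} (f k))) {a..b}"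
      using that by (intro has_integral_sum) (auto intro!: integrable_integral integrable_continuous_interval cont)
    with I[of X] show ?thesis by (auto intro: has_integral_unique)
  qed
  then have "((\<lambda>X. \<Sum>k\<in>X. integral {a..b} (f k)) \<longlongrightarrow> J) (finite_subsets_at_top UNIV)"
    using lim
    by (elim Lim_transform_eventually) (auto intro!: eventually_finite_subsets_at_top_weakI)
  moreover have "integral {a..b} S = J" using J by (auto intro: integral_unique)
  ultimately show "((\<lambda>k. integral {a..b} (f k)) has_sum integral {a..b} S) UNIV"
    by (simp add: has_sum_def)
qed

lemma integral_cis_int:
  "integral {-pi..pi} (\<lambda>u. exp (\<i> * of_real u * of_int k)) = (if k = 0 then of_real (2 * pi) else 0)"
proof (cases "k = 0")
  case True
  then show ?thesis by (simp add: scaleR_conv_of_real)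
next
  case False
  have "((\<lambda>u. exp (\<i> * of_real u * of_int k)) has_integral
      (exp (\<i> * of_real pi * of_int k) / (\<i> * of_int k) - exp (\<i> * of_real (- pi) * of_int k) / (\<i> * of_int k))) {-pi..pi}"
  proof (rule fundamental_theorem_of_calculus)
    fix u :: real
    have "((\<lambda>z. exp (\<i> * z * of_int k) / (\<i> * of_int k)) has_field_derivative exp (\<i> * of_real u * of_int k)) (at (of_real u))"
      using False by (auto intro!: derivative_eq_intros)
    from has_vector_derivative_real_field[OF this]
    show "((\<lambda>u. exp (\<i> * of_real u * of_int k) / (\<i> * of_int k)) has_vector_derivative exp (\<i> * of_real u * of_int k)) (at u within {-pi..pi})"
      .
  qed simp
  moreover have "exp (\<i> * of_real pi * of_int k) = exp (\<i> * of_real (- pi) * of_int k)"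
    by (rule exp_eq[THEN iffD2]) (auto intro!: exI[of _ k] simp: algebra_simps)
  ultimately show ?thesis using False by (simp add: integral_unique)
qed

lemma gaussian_integral:
  assumes "a > 0"
  shows "integrable lborel (\<lambda>u::real. exp (- (a * u\<^sup>2)))"
    and "(\<integral>u. exp (- (a * u\<^sup>2)) \<partial>lborel) = sqrt (pi / a)"
proof -
  define s where "s = 1 / sqrt (2 * a)"
  have s: "s > 0" "2 * s\<^sup>2 = 1 / a" using assms by (auto simp: s_def power_divide)
  have eq: "exp (- (a * u\<^sup>2)) = sqrt (pi / a) * normal_density 0 s u" for u
  proof -
    have "2 * pi * s\<^sup>2 = pi / a" using s(2) by (simp add: field_simps)
    moreover have "u\<^sup>2 / (2 * s\<^sup>2) = a * u\<^sup>2" using s(2) by simp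
    ultimately show ?thesis using assms by (simp add: normal_density_def)
  qed
  show "integrable lborel (\<lambda>u::real. exp (- (a * u\<^sup>2)))"
    unfolding eq using integrable_normal_density[OF s(1), of 0] by simp
  show "(\<integral>u. exp (- (a * u\<^sup>2)) \<partial>lborel) = sqrt (pi / a)"
    unfolding eq using integral_normal_density[OF s(1), of 0] by simp
qed

context symmetric_walk
begin

lemma walk_prob_rmgf:
  assumes "\<bar>\<theta>\<bar> \<le> \<theta>\<^sub>0" "t \<ge> 0"
  shows "((\<lambda>x. walk_prob p t x * exp (\<theta> * of_int x)) has_sum exp (t * (rmgf p \<theta> - 1))) UNIV"
  using has_sum_Re[OF walk_prob_mgf[OF finite_mgf, of "of_real \<theta>" t]] assms
  unfolding mgf_of_real exp_of_real_int of_real_mult[symmetric] Re_complex_of_real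
  by (simp add: Re_exp)

lemma continuous_on_mgf_line:
  assumes "\<bar>\<theta>\<bar> \<le> \<theta>\<^sub>0"
  shows "continuous_on {a..b} (\<lambda>u. mgf p (Complex \<theta> u))"
proof (rule has_sum_integral(2))
  show "continuous_on {a..b} (\<lambda>u. complex_of_real (pmf p k) * exp (Complex \<theta> u * of_int k))" for k
    unfolding Complex_eq by (intro continuous_intros)
  show "(\<lambda>k. pmf p k * exp (\<theta>\<^sub>0 * \<bar>real_of_int k\<bar>)) summable_on UNIV"
    using exp_moment_has_sum by (rule has_sum_imp_summable)
  show "((\<lambda>k. complex_of_real (pmf p k) * exp (Complex \<theta> u * of_int k)) has_sum mgf p (Complex \<theta> u)) UNIV" for u
    using assms by (intro mgf_has_sum') simp
  fix k :: int and u :: real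
  have "\<theta> * of_int k \<le> \<bar>\<theta> * of_int k\<bar>" by simp
  also have "\<dots> \<le> \<theta>\<^sub>0 * \<bar>real_of_int k\<bar>"
    using assms by (simp add: abs_mult mult_right_mono)
  finally show "norm (complex_of_real (pmf p k) * exp (Complex \<theta> u * of_int k)) \<le> pmf p k * exp (\<theta>\<^sub>0 * \<bar>real_of_int k\<bar>)"
    by (simp add: norm_mult norm_exp_eq_Re mult_left_mono)
qed

text \<open>The freedom in \<open>\<theta>\<close> replaces a contour shift. The Fourier coefficient
  is extracted from the series tilted by \<open>\<theta>\<close>, and the tilting factor
  \<open>exp (\<theta> * (k - x))\<close> equals 1 at the only index \<open>k = x\<close> that
  survives integration.\<close>

lemma walk_prob_inversion:
  assumes th: "\<bar>\<theta>\<bar> \<le> \<theta>\<^sub>0" and t: "t \<ge> 0"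
  shows "complex_of_real (2 * pi * walk_prob p t x)
     = integral {-pi..pi} (\<lambda>u. exp (of_real t * (mgf p (Complex \<theta> u) - 1) - Complex \<theta> u * of_int x))"
proof -
  let ?f = "\<lambda>k u. complex_of_real (walk_prob p t k) * exp (Complex \<theta> u * of_int k) * exp (- (Complex \<theta> u * of_int x))"
  have S: "((\<lambda>k. integral {-pi..pi} (?f k)) has_sum
      integral {-pi..pi} (\<lambda>u. exp (of_real t * (mgf p (Complex \<theta> u) - 1)) * exp (- (Complex \<theta> u * of_int x)))) UNIV"
  proof (rule has_sum_integral(1))
    show "continuous_on {-pi..pi} (?f k)" for k
      unfolding Complex_eq by (intro continuous_intros)
    show "(\<lambda>k. walk_prob p t k * exp (\<theta> * of_int k) * exp (- (\<theta> * of_int x))) summable_on UNIV"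
      using walk_prob_rmgf[OF assms] by (intro summable_on_cmult_left has_sum_imp_summable)
    show "norm (?f k u) \<le> walk_prob p t k * exp (\<theta> * of_int k) * exp (- (\<theta> * of_int x))" for k u
      using walk_prob_nonneg[OF t, of p k] by (simp add: norm_mult norm_exp_eq_Re)
    show "((\<lambda>k. ?f k u) has_sum exp (of_real t * (mgf p (Complex \<theta> u) - 1)) * exp (- (Complex \<theta> u * of_int x))) UNIV" for u
      using assms by (intro has_sum_cmult_left walk_prob_mgf[OF finite_mgf]) auto
  qed
  have I: "integral {-pi..pi} (?f k) = (if k = x then of_real (2 * pi * walk_prob p t x) else 0)" for k
  proof -
    have "?f k u = of_real (walk_prob p t k * exp (\<theta> * of_int (k - x))) * exp (\<i> * of_real u * of_int (k - x))" for u
    proof -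
      have eq: "Complex \<theta> u * of_int k + - (Complex \<theta> u * of_int x)
          = complex_of_real \<theta> * of_int (k - x) + \<i> * of_real u * of_int (k - x)"
        by (simp add: Complex_eq algebra_simps)
      have "?f k u = of_real (walk_prob p t k) * exp (Complex \<theta> u * of_int k + - (Complex \<theta> u * of_int x))"
        by (simp only: exp_add mult.assoc)
      also have "\<dots> = of_real (walk_prob p t k) * (of_real (exp (\<theta> * of_int (k - x))) * exp (\<i> * of_real u * of_int (k - x)))"
        unfolding eq exp_add exp_of_real_int ..
      finally show ?thesis by (simp only: of_real_mult mult.assoc)
    qed
    then have eq: "?f k = (\<lambda>u. of_real (walk_prob p t k * exp (\<theta> * of_int (k - x))) * exp (\<i> * of_real u * of_int (k - x)))"
      by (rule ext)
    show ?thesis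
      unfolding eq integral_mult_right integral_cis_int by simp
  qed
  have "((\<lambda>k. integral {-pi..pi} (?f k)) has_sum of_real (2 * pi * walk_prob p t x)) UNIV"
    by (rule has_sum_finite_neutralI[of "{x}"]) (auto simp: I)
  from has_sum_unique[OF this S] show ?thesis
    by (simp add: exp_diff exp_minus divide_inverse)
qed

lemma norm_exp_mgf:
  assumes "\<bar>\<theta>\<bar> \<le> \<theta>\<^sub>0" "t \<ge> 0" "\<And>u. \<bar>u\<bar> \<le> pi \<Longrightarrow> c * u\<^sup>2 \<le> gap u" "\<bar>u\<bar> \<le> pi"
  shows "norm (exp (of_real t * (mgf p (Complex \<theta> u) - 1) - Complex \<theta> u * of_int x))
    \<le> exp (t * (rmgf p \<theta> - 1) - \<theta> * of_int x) * exp (- (t * c * u\<^sup>2))"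
proof -
  have "Re (mgf p (Complex \<theta> u)) \<le> rmgf p \<theta> - c * u\<^sup>2"
    using Re_mgf_gap[OF assms(1), of u] assms(3)[OF assms(4)] by linarith
  then have "t * (Re (mgf p (Complex \<theta> u)) - 1) \<le> t * (rmgf p \<theta> - c * u\<^sup>2 - 1)"
    using assms(2) by (intro mult_left_mono) auto
  then show ?thesis
    by (simp add: norm_exp_eq_Re algebra_simps flip: exp_add)
qed

text \<open>The tilt contributes the exponential factor, and the spectral gap bounds the rest of the
  integrand by a Gaussian in \<open>u\<close> of total mass of order \<open>1 / sqrt r\<close>. The
  constant depends neither on the tilt nor on the time.\<close>

lemma walk_prob_local_bound:
  obtains C where "C > 0"
    "\<And>r \<theta> x. r > 0 \<Longrightarrow> \<bar>\<theta>\<bar> \<le> \<theta>\<^sub>0 \<Longrightarrow> walk_prob p r x \<le> C / sqrt r * exp (r * (rmgf p \<theta> - 1) - \<theta> * of_int x)"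
proof -
  obtain c where c: "c > 0" "\<And>u. \<bar>u\<bar> \<le> pi \<Longrightarrow> c * u\<^sup>2 \<le> gap u" using gap_lower by blast
  define C where "C = sqrt (pi / c)"
  have Cpos: "C > 0" using c by (simp add: C_def)
  have "walk_prob p r x \<le> C / sqrt r * exp (r * (rmgf p \<theta> - 1) - \<theta> * of_int x)"
    if r: "r > 0" and th: "\<bar>\<theta>\<bar> \<le> \<theta>\<^sub>0" for r \<theta> x
  proof -
    let ?f = "\<lambda>u. exp (of_real r * (mgf p (Complex \<theta> u) - 1) - Complex \<theta> u * of_int x)"
    let ?E = "exp (r * (rmgf p \<theta> - 1) - \<theta> * of_int x)"
    have gi: "integrable lborel (\<lambda>u. exp (- (r * c * u\<^sup>2)))"
      using r c by (intro gaussian_integral) simp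
    then have g: "((\<lambda>u. exp (- (r * c * u\<^sup>2))) has_integral sqrt (pi / (r * c))) UNIV"
      using has_integral_integral_lborel[OF gi] gaussian_integral(2)[of "r * c"] r c by simp
    have gint: "(\<lambda>u. exp (- (r * c * u\<^sup>2))) integrable_on {-pi..pi}"
      by (intro integrable_continuous_interval continuous_intros)
    have "integral {-pi..pi} (\<lambda>u. exp (- (r * c * u\<^sup>2))) \<le> integral UNIV (\<lambda>u. exp (- (r * c * u\<^sup>2)))"
      using g by (intro integral_subset_le gint) auto
    also have "\<dots> = C / sqrt r"
      using g r by (simp add: integral_unique C_def real_sqrt_divide real_sqrt_mult)
    finally have gb: "integral {-pi..pi} (\<lambda>u. exp (- (r * c * u\<^sup>2))) \<le> C / sqrt r" .
    have cont: "continuous_on {-pi..pi} ?f"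
      unfolding Complex_eq[symmetric] by (intro continuous_intros continuous_on_mgf_line[OF th])
    have "norm (complex_of_real (2 * pi * walk_prob p r x)) \<le> integral {-pi..pi} (\<lambda>u. ?E * exp (- (r * c * u\<^sup>2)))"
      unfolding walk_prob_inversion[OF th less_imp_le[OF r]]
    proof (rule integral_norm_bound_integral)
      show "?f integrable_on {-pi..pi}" by (rule integrable_continuous_interval[OF cont])
      show "(\<lambda>u. ?E * exp (- (r * c * u\<^sup>2))) integrable_on {-pi..pi}"
        by (intro integrable_continuous_interval continuous_intros)
      show "norm (?f u) \<le> ?E * exp (- (r * c * u\<^sup>2))" if "u \<in> {-pi..pi}" for u
        using that r by (intro norm_exp_mgf th c) auto
    qed
    also have "\<dots> = ?E * integral {-pi..pi} (\<lambda>u. exp (- (r * c * u\<^sup>2)))" by simp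
    also have "\<dots> \<le> ?E * (C / sqrt r)" by (intro mult_left_mono gb) simp
    finally have "2 * pi * walk_prob p r x \<le> ?E * (C / sqrt r)"
      using walk_prob_nonneg[of r p x] r by (simp only: norm_of_real)
    moreover have "1 * walk_prob p r x \<le> 2 * pi * walk_prob p r x"
      using pi_ge_two walk_prob_nonneg[of r p x] r by (intro mult_right_mono) auto
    ultimately show ?thesis by (simp add: mult_ac)
  qed
  with Cpos that show thesis by blast
qed

text \<open>Exponential Markov inequality with the tilt \<open>\<theta>\<close>.\<close>

lemma walk_tail_bound:
  assumes "0 \<le> \<theta>" "\<theta> \<le> \<theta>\<^sub>0" "t \<ge> 0"
  shows "walk_prob p t summable_on {y..}"
    and "(\<Sum>\<^sub>\<infinity>x\<in>{y..}. walk_prob p t x) \<le> exp (t * (rmgf p \<theta> - 1) - \<theta> * of_int y)"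
proof -
  show s: "walk_prob p t summable_on {y..}"
    using has_sum_imp_summable[OF walk_prob_has_sum_1[OF assms(3), of p]] by (rule summable_on_subset_banach) simp
  have w: "((\<lambda>x. walk_prob p t x * exp (\<theta> * of_int x) * exp (- (\<theta> * of_int y))) has_sum
     exp (t * (rmgf p \<theta> - 1)) * exp (- (\<theta> * of_int y))) UNIV"
    using assms by (intro has_sum_cmult_left walk_prob_rmgf) auto
  have "(walk_prob p t has_sum (\<Sum>\<^sub>\<infinity>x\<in>{y..}. walk_prob p t x)) {y..}" using s by simp
  then have "(\<Sum>\<^sub>\<infinity>x\<in>{y..}. walk_prob p t x) \<le> exp (t * (rmgf p \<theta> - 1)) * exp (- (\<theta> * of_int y))"
  proof (rule has_sum_mono_neutral[OF _ w])
    fix x assume "x \<in> {y..} \<inter> UNIV"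
    then have "\<theta> * of_int y \<le> \<theta> * of_int x" using assms by (intro mult_left_mono) auto
    then have "1 \<le> exp (\<theta> * of_int x - \<theta> * of_int y)" by simp
    from mult_left_mono[OF this walk_prob_nonneg[OF assms(3), of p x]]
    show "walk_prob p t x \<le> walk_prob p t x * exp (\<theta> * of_int x) * exp (- (\<theta> * of_int y))"
      by (simp add: exp_diff exp_minus divide_inverse mult.assoc)
  qed (use walk_prob_nonneg[OF assms(3)] in auto)
  then show "(\<Sum>\<^sub>\<infinity>x\<in>{y..}. walk_prob p t x) \<le> exp (t * (rmgf p \<theta> - 1) - \<theta> * of_int y)"
    by (simp add: exp_diff exp_minus divide_inverse)
qed

lemma rmgf_taylor:
  obtains C where "C > 0"
    "\<And>\<theta>. \<bar>\<theta>\<bar> \<le> \<theta>\<^sub>0 / 2 \<Longrightarrow> \<bar>rmgf p \<theta> - 1 - \<sigma>\<^sup>2 * \<theta>\<^sup>2 / 2\<bar> \<le> C * \<theta> ^ 4"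
proof -
  obtain C where C: "C > 0" "\<And>s. norm s \<le> \<theta>\<^sub>0 / 2 \<Longrightarrow> norm (mgf p s - 1 - of_real (\<sigma>\<^sup>2) * s\<^sup>2 / 2) \<le> C * norm s ^ 4"
    using mgf_taylor by blast
  have "\<bar>rmgf p \<theta> - 1 - \<sigma>\<^sup>2 * \<theta>\<^sup>2 / 2\<bar> \<le> C * \<theta> ^ 4" if "\<bar>\<theta>\<bar> \<le> \<theta>\<^sub>0 / 2" for \<theta>
  proof -
    have "mgf p (of_real \<theta>) - 1 - of_real (\<sigma>\<^sup>2) * (of_real \<theta>)\<^sup>2 / 2 = of_real (rmgf p \<theta> - 1 - \<sigma>\<^sup>2 * \<theta>\<^sup>2 / 2)"
      by (simp add: mgf_of_real)
    with C(2)[of "of_real \<theta>"] that show ?thesis by (simp only: norm_of_real) (simp add: power_even_abs)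
  qed
  with C(1) that show thesis by blast
qed

end


section \<open>Moderate deviations\<close>

lemma of_nat_power_has_sum:
  fixes z :: "'a::{banach, real_normed_field}"
  assumes "norm z < 1"
  shows "((\<lambda>k. of_nat k * z ^ k) has_sum z / (1 - z)\<^sup>2) UNIV"
proof (rule norm_summable_imp_has_sum)
  have s: "(\<lambda>k. of_nat k * z ^ k) sums (z / (1 - z)\<^sup>2)"
    if "norm z < 1" for z :: "'b::{banach, real_normed_field}"
  proof -
    have "(\<lambda>k. z * (of_nat (Suc k) * z ^ k)) sums (z * (1 / (1 - z)\<^sup>2))"
      by (intro sums_mult geometric_deriv_sums that)
    then have "(\<lambda>k. of_nat (Suc k) * z ^ Suc k) sums (z / (1 - z)\<^sup>2)"
      by (simp add: mult_ac)
    from sums_Suc[OF this] show ?thesis by simp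
  qed
  show "(\<lambda>k. of_nat k * z ^ k) sums (z / (1 - z)\<^sup>2)" by (rule s[OF assms])
  show "summable (\<lambda>k. norm (of_nat k * z ^ k))"
    using sums_summable[OF s[of "norm z"]] assms by (simp add: norm_mult norm_power)
qed

lemma power_has_sum:
  fixes z :: "'a::{banach, real_normed_field}"
  assumes "norm z < 1"
  shows "((\<lambda>k. z ^ k) has_sum 1 / (1 - z)) UNIV"
  by (rule norm_summable_imp_has_sum[OF _ geometric_sums[OF assms]])
     (use assms in \<open>simp add: norm_power\<close>)

text \<open>A rewriting of \<open>1 + \<theta> \<le> exp \<theta>\<close>, used to bound the poles
  of geometric series at 0 by powers of \<open>1 / \<theta>\<close>.\<close>

lemma one_minus_exp_ge:
  fixes \<theta> :: real
  shows "\<theta> * exp (- \<theta>) \<le> 1 - exp (- \<theta>)"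
proof -
  have "(1 + \<theta>) * exp (- \<theta>) \<le> exp \<theta> * exp (- \<theta>)"
    by (intro mult_right_mono exp_ge_add_one_self) auto
  then show ?thesis by (simp add: ring_distribs flip: exp_add)
qed

lemma one_minus_exp_quotient_tendsto:
  "((\<lambda>s::complex. s / (1 - exp (- s))) \<longlongrightarrow> 1) (at 0)"
proof -
  have "((\<lambda>s::complex. 1 - exp (- s)) has_field_derivative 1) (at 0)"
    by (auto intro!: derivative_eq_intros)
  then have "((\<lambda>s::complex. (1 - exp (- s)) / s) \<longlongrightarrow> 1) (at 0)"
    by (simp add: has_field_derivative_iff)
  from tendsto_divide[OF tendsto_const[of 1] this] show ?thesis by simp
qed

text \<open>The Laplace transform of the sequence \<open>S\<close>. It is later taken for the
  cumulated initial densities, whose linear growth becomes a double pole at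
  \<open>s = 0\<close>.\<close>

definition gen_series :: "(nat \<Rightarrow> real) \<Rightarrow> complex \<Rightarrow> complex" where
  "gen_series S s = (\<Sum>\<^sub>\<infinity>k. of_real (S k) * exp (- s) ^ k)"

lemma gen_series_bound:
  assumes S: "\<And>k. \<bar>S k\<bar> \<le> real k" and s: "Re s > 0"
  shows "((\<lambda>k. of_real (S k) * exp (- s) ^ k) has_sum gen_series S s) UNIV"
    and "norm (gen_series S s) * (Re s)\<^sup>2 \<le> exp (Re s)"
proof -
  define x where "x = exp (- Re s)"
  have x: "0 < x" "x < 1" using s by (auto simp: x_def)
  have nx: "norm (exp (- s)) = x" by (simp add: x_def)
  have m: "((\<lambda>k. real k * x ^ k) has_sum x / (1 - x)\<^sup>2) UNIV"
    using x by (intro of_nat_power_has_sum) auto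
  have b: "norm (of_real (S k) * exp (- s) ^ k) \<le> real k * x ^ k" for k
    unfolding norm_mult norm_power nx using S[of k] x by (simp add: mult_right_mono)
  have "(\<lambda>k. norm (of_real (S k) * exp (- s) ^ k)) summable_on UNIV"
    by (rule summable_on_comparison_test[OF has_sum_imp_summable[OF m] b]) auto
  then show h: "((\<lambda>k. of_real (S k) * exp (- s) ^ k) has_sum gen_series S s) UNIV"
    by (simp add: abs_summable_summable gen_series_def)
  have "norm (gen_series S s) \<le> x / (1 - x)\<^sup>2"
    by (rule norm_infsum_le[OF h m b])
  then have "norm (gen_series S s) * (Re s)\<^sup>2 \<le> x / (1 - x)\<^sup>2 * (Re s)\<^sup>2"
    by (intro mult_right_mono) auto
  also have "\<dots> \<le> x / (Re s * x)\<^sup>2 * (Re s)\<^sup>2"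
    using one_minus_exp_ge[of "Re s"] s x
    by (intro mult_right_mono divide_left_mono power_mono) (auto simp: x_def)
  also have "\<dots> = exp (Re s)"
    using s by (simp add: x_def exp_minus field_simps power2_eq_square)
  finally show "norm (gen_series S s) * (Re s)\<^sup>2 \<le> exp (Re s)" .
qed

text \<open>A bounded deviation from the line \<open>r * k\<close> produces only a simple pole at 0,
  which is negligible against the double pole of the linear part.\<close>

lemma gen_series_affine_bound:
  assumes S: "\<And>k. \<bar>S k\<bar> \<le> real k" and r: "\<And>k. \<bar>S k - r * real k\<bar> \<le> B" and s: "Re s > 0"
  shows "norm (gen_series S s - of_real r * (exp (- s) / (1 - exp (- s))\<^sup>2)) * Re s \<le> B * exp (Re s)"
proof -
  define x where "x = exp (- Re s)"
  have x: "0 < x" "x < 1" using s by (auto simp: x_def)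
  have B: "B \<ge> 0" using r[of 0] by simp
  have nx: "norm (exp (- s)) = x" by (simp add: x_def)
  have "((\<lambda>k. of_nat k * exp (- s) ^ k) has_sum (exp (- s) / (1 - exp (- s))\<^sup>2)) UNIV"
    using x nx by (intro of_nat_power_has_sum) simp
  from has_sum_cmult_right[OF this, of "of_real r"]
  have a: "((\<lambda>k. of_real r * (of_nat k * exp (- s) ^ k)) has_sum of_real r * (exp (- s) / (1 - exp (- s))\<^sup>2)) UNIV" .
  have d: "((\<lambda>k. of_real (S k) * exp (- s) ^ k + - (of_real r * (of_nat k * exp (- s) ^ k))) has_sum
      (gen_series S s + - (of_real r * (exp (- s) / (1 - exp (- s))\<^sup>2)))) UNIV"
    by (intro has_sum_add has_sum_uminusI a gen_series_bound(1) S s)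
  have m: "((\<lambda>k. B * x ^ k) has_sum B * (1 / (1 - x))) UNIV"
    using x by (intro has_sum_cmult_right power_has_sum) auto
  have "norm (gen_series S s + - (of_real r * (exp (- s) / (1 - exp (- s))\<^sup>2))) \<le> B * (1 / (1 - x))"
  proof (rule norm_infsum_le[OF d m])
    fix k
    have "of_real (S k) * exp (- s) ^ k + - (of_real r * (of_nat k * exp (- s) ^ k))
        = complex_of_real (S k - r * real k) * exp (- s) ^ k"
      by (simp add: algebra_simps)
    then show "norm (of_real (S k) * exp (- s) ^ k + - (of_real r * (of_nat k * exp (- s) ^ k))) \<le> B * x ^ k"
      using r[of k] x by (simp only: norm_mult norm_power nx norm_of_real) (simp add: mult_right_mono)
  qed
  then have "norm (gen_series S s - of_real r * (exp (- s) / (1 - exp (- s))\<^sup>2)) * Re s \<le> B * (1 / (1 - x)) * Re s"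
    using s by (intro mult_right_mono) auto
  also have "\<dots> \<le> B * (1 / (Re s * x)) * Re s"
    using one_minus_exp_ge[of "Re s"] s x B
    by (intro mult_right_mono mult_left_mono divide_left_mono) (auto simp: x_def)
  also have "\<dots> = B * exp (Re s)"
    using s by (simp add: x_def exp_minus field_simps)
  finally show ?thesis .
qed

context symmetric_walk
begin

text \<open>Summing the inversion formula over the sites \<open>N + k\<close> moves
  \<open>gen_series\<close> into the integrand. The tilt must be strictly positive for the
  dominating series in \<open>exp (- \<theta>)\<close> to converge.\<close>

lemma walk_series_inversion:
  assumes S: "\<And>k. \<bar>S k\<bar> \<le> real k" and th: "0 < \<theta>" "\<theta> \<le> \<theta>\<^sub>0" and t: "t \<ge> 0"
  shows "((\<lambda>k. walk_prob p t (N + int k) * S k) has_sum (\<Sum>\<^sub>\<infinity>k. walk_prob p t (N + int k) * S k)) UNIV"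
    and "complex_of_real (2 * pi * (\<Sum>\<^sub>\<infinity>k. walk_prob p t (N + int k) * S k))
       = integral {-pi..pi} (\<lambda>u. exp (of_real t * (mgf p (Complex \<theta> u) - 1) - Complex \<theta> u * of_int N) * gen_series S (Complex \<theta> u))"
    and "continuous_on {-pi..pi} (\<lambda>u. exp (of_real t * (mgf p (Complex \<theta> u) - 1) - Complex \<theta> u * of_int N) * gen_series S (Complex \<theta> u))"
proof -
  let ?e = "\<lambda>u. exp (of_real t * (mgf p (Complex \<theta> u) - 1) - Complex \<theta> u * of_int N)"
  let ?f = "\<lambda>k u. ?e u * (of_real (S k) * exp (- Complex \<theta> u) ^ k)"
  define x where "x = exp (- \<theta>)"
  have x: "0 < x" "x < 1" using th by (auto simp: x_def)
  have ath: "\<bar>\<theta>\<bar> \<le> \<theta>\<^sub>0" using th by simp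
  have cont: "continuous_on {-pi..pi} (?f k)" for k
    by (intro continuous_intros continuous_on_mgf_line[OF ath])
  have bnd: "norm (?f k u) \<le> exp (t * (rmgf p \<theta> - 1) - \<theta> * of_int N) * (real k * x ^ k)" if "u \<in> {-pi..pi}" for k u
  proof -
    have "norm (?e u) \<le> exp (t * (rmgf p \<theta> - 1) - \<theta> * of_int N)"
      using norm_exp_mgf[OF ath t, of 0 u N] that gap_nonneg by (simp add: abs_le_iff)
    moreover have "norm (of_real (S k) * exp (- Complex \<theta> u) ^ k) \<le> real k * x ^ k"
      using S[of k] x by (simp add: norm_mult norm_power x_def mult_right_mono)
    ultimately show ?thesis
      unfolding norm_mult[of "?e u"] by (intro mult_mono) auto
  qed
  have B: "(\<lambda>k. exp (t * (rmgf p \<theta> - 1) - \<theta> * of_int N) * (real k * x ^ k)) summable_on UNIV"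
    using x by (intro summable_on_cmult_right has_sum_imp_summable[OF of_nat_power_has_sum]) auto
  have sum: "((\<lambda>k. ?f k u) has_sum ?e u * gen_series S (Complex \<theta> u)) UNIV" for u
    by (intro has_sum_cmult_right gen_series_bound(1) S) (use th in simp)
  note hs = has_sum_integral[OF cont bnd B sum]
  show "continuous_on {-pi..pi} (\<lambda>u. ?e u * gen_series S (Complex \<theta> u))" by (rule hs(2))
  have I: "integral {-pi..pi} (?f k) = of_real (2 * pi * (walk_prob p t (N + int k) * S k))" for k
  proof -
    have "?f k u = of_real (S k) * exp (of_real t * (mgf p (Complex \<theta> u) - 1) - Complex \<theta> u * of_int (N + int k))" for u
    proof -
      have "of_real t * (mgf p (Complex \<theta> u) - 1) - Complex \<theta> u * of_int (N + int k)
         = (of_real t * (mgf p (Complex \<theta> u) - 1) - Complex \<theta> u * of_int N) + of_nat k * (- Complex \<theta> u)"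
        by (simp add: algebra_simps)
      then show ?thesis
        by (simp only: exp_add exp_of_nat_mult mult_ac)
    qed
    then have "integral {-pi..pi} (?f k) = of_real (S k) * complex_of_real (2 * pi * walk_prob p t (N + int k))"
      by (simp only: integral_mult_right walk_prob_inversion[OF ath t])
    then show ?thesis by simp
  qed
  have fin: "((\<lambda>k. complex_of_real (2 * pi * (walk_prob p t (N + int k) * S k))) has_sum
     integral {-pi..pi} (\<lambda>u. ?e u * gen_series S (Complex \<theta> u))) UNIV"
    using hs(1) unfolding I .
  then have "(\<lambda>k. Re (complex_of_real (2 * pi * (walk_prob p t (N + int k) * S k)))) summable_on UNIV"
    by (intro summable_on_Re has_sum_imp_summable)
  then have "(\<lambda>k. 2 * pi * (walk_prob p t (N + int k) * S k)) summable_on UNIV"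
    by (simp only: Re_complex_of_real)
  from summable_on_cmult_right[OF this, of "1 / (2 * pi)"]
  have "(\<lambda>k. walk_prob p t (N + int k) * S k) summable_on UNIV" by simp
  then show s: "((\<lambda>k. walk_prob p t (N + int k) * S k) has_sum (\<Sum>\<^sub>\<infinity>k. walk_prob p t (N + int k) * S k)) UNIV"
    by simp
  from has_sum_of_real[OF has_sum_cmult_right[OF s, of "2 * pi"]] fin
  show "complex_of_real (2 * pi * (\<Sum>\<^sub>\<infinity>k. walk_prob p t (N + int k) * S k))
       = integral {-pi..pi} (\<lambda>u. ?e u * gen_series S (Complex \<theta> u))"
    by (rule has_sum_unique)
qed

text \<open>The saddle point method. For \<open>\<theta> = N / (\<sigma>\<^sup>2 t)\<close> the
  linear term of the exponent in \<open>u\<close> cancels, and at the scale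
  \<open>u = v / sqrt t\<close> the integrand becomes Gaussian. By \<open>th1\<close> the imaginary
  part \<open>u\<close> is negligible against \<open>\<theta>\<close> in the pole of
  \<open>gen_series\<close>, and by \<open>th2\<close> the quartic remainder of the exponent
  disappears.\<close>

lemma walk_series_asymptotics:
  fixes N :: "real \<Rightarrow> int" and \<theta> :: "real \<Rightarrow> real"
  assumes S: "\<And>k. \<bar>S k\<bar> \<le> real k" and r: "\<And>k. \<bar>S k - r * real k\<bar> \<le> B"
    and N: "\<And>t. real_of_int (N t) = \<sigma>\<^sup>2 * t * \<theta> t"
    and th0: "(\<theta> \<longlongrightarrow> 0) at_top"
    and th1: "filterlim (\<lambda>t. sqrt t * \<theta> t) at_top at_top"
    and th2: "((\<lambda>t. sqrt t * (\<theta> t)\<^sup>2) \<longlongrightarrow> 0) at_top"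
  shows "((\<lambda>t. sqrt t * (\<theta> t)\<^sup>2 * exp (\<sigma>\<^sup>2 * t * (\<theta> t)\<^sup>2 / 2) * (\<Sum>\<^sub>\<infinity>k. walk_prob p t (N t + int k) * S k))
    \<longlongrightarrow> r / (\<sigma> * sqrt (2 * pi))) at_top"
proof -
  obtain C where C: "C > 0" "\<And>s. norm s \<le> \<theta>\<^sub>0 / 2 \<Longrightarrow> norm (mgf p s - 1 - of_real (\<sigma>\<^sup>2) * s\<^sup>2 / 2) \<le> C * norm s ^ 4"
    using mgf_taylor by blast
  obtain C' where C': "C' > 0" "\<And>\<theta>. \<bar>\<theta>\<bar> \<le> \<theta>\<^sub>0 / 2 \<Longrightarrow> \<bar>rmgf p \<theta> - 1 - \<sigma>\<^sup>2 * \<theta>\<^sup>2 / 2\<bar> \<le> C' * \<theta> ^ 4"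
    using rmgf_taylor by blast
  obtain c where c: "c > 0" "\<And>u. \<bar>u\<bar> \<le> pi \<Longrightarrow> c * u\<^sup>2 \<le> gap u" using gap_lower by blast
  define h where "h = (\<lambda>t u. exp (of_real t * (mgf p (Complex (\<theta> t) u) - 1) - Complex (\<theta> t) u * of_int (N t)) * gen_series S (Complex (\<theta> t) u))"
  \<comment> \<open>\<open>K\<close> compensates the double pole and the size of the exponential at
    the saddle point; the further factor \<open>sqrt t\<close> in the claim is the Jacobian of
    \<open>u = v / sqrt t\<close>.\<close>
  define K where "K = (\<lambda>t. (\<theta> t)\<^sup>2 * exp (\<sigma>\<^sup>2 * t * (\<theta> t)\<^sup>2 / 2))"
  define G where "G = (\<lambda>t v. (indicator {-pi..pi} (v / sqrt t) * K t) *\<^sub>R h t (v / sqrt t))"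

  have "eventually (\<lambda>t. sqrt t * \<theta> t > 0) at_top"
    using th1 by (auto simp: filterlim_at_top_dense)
  then have ev_pos: "eventually (\<lambda>t. t > 0 \<and> \<theta> t > 0) at_top"
    using eventually_gt_at_top[of 0] by eventually_elim (auto simp: zero_less_mult_iff)
  have ev_small: "eventually (\<lambda>t. \<bar>\<theta> t\<bar> < min (\<theta>\<^sub>0 / 2) 1) at_top"
    using tendstoD[OF th0, of "min (\<theta>\<^sub>0 / 2) 1"] exponent_pos by simp
  have "((\<lambda>t. C' * (sqrt t * (\<theta> t)\<^sup>2)\<^sup>2) \<longlongrightarrow> C' * 0\<^sup>2) at_top"
    by (intro tendsto_intros th2)
  then have "eventually (\<lambda>t. C' * (sqrt t * (\<theta> t)\<^sup>2)\<^sup>2 < 1) at_top"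
    by (intro order_tendstoD) auto
  \<comment> \<open>The quartic Taylor error \<open>t * \<theta> ^ 4\<close> is the square of the
    quantity that tends to 0 by \<open>th2\<close>.\<close>
  then have ev_quart: "eventually (\<lambda>t. t * (C' * (\<theta> t) ^ 4) < 1) at_top"
    using eventually_gt_at_top[of 0]
    by eventually_elim (simp add: power_mult_distrib mult_ac flip: power_mult)

  have G_eq: "eventually (\<lambda>t. sqrt t * K t * (\<Sum>\<^sub>\<infinity>k. walk_prob p t (N t + int k) * S k)
       = Re (integral\<^sup>L lborel (G t)) / (2 * pi)) at_top"
    using ev_pos ev_small
  proof eventually_elim
    case (elim t)
    have th: "0 < \<theta> t" "\<theta> t \<le> \<theta>\<^sub>0" and t: "t \<ge> 0" using elim exponent_pos by auto
    have cont: "continuous_on {-pi..pi} (h t)"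
      unfolding h_def by (rule walk_series_inversion(3)[OF S th t])
    have "complex_of_real (2 * pi * (\<Sum>\<^sub>\<infinity>k. walk_prob p t (N t + int k) * S k)) = integral {-pi..pi} (h t)"
      unfolding h_def by (rule walk_series_inversion(2)[OF S th t])
    also have "\<dots> = (LINT u:{-pi..pi}|lborel. h t u)"
      using borel_integrable_atLeastAtMost'[OF cont] by (intro set_borel_integral_eq_integral(2)[symmetric])
    also have "\<dots> = (1 / sqrt t) *\<^sub>R (\<integral>v. indicator {-pi..pi} (v / sqrt t) *\<^sub>R h t (v / sqrt t) \<partial>lborel)"
      using lborel_integral_real_affine[of "1 / sqrt t" "\<lambda>u. indicator {-pi..pi} u *\<^sub>R h t u" 0] elim
      by (simp add: set_lebesgue_integral_def)
    finally have "complex_of_real (2 * pi * (\<Sum>\<^sub>\<infinity>k. walk_prob p t (N t + int k) * S k))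
        = (1 / sqrt t) *\<^sub>R (\<integral>v. indicator {-pi..pi} (v / sqrt t) *\<^sub>R h t (v / sqrt t) \<partial>lborel)" .
    then have "(sqrt t * K t) *\<^sub>R complex_of_real (2 * pi * (\<Sum>\<^sub>\<infinity>k. walk_prob p t (N t + int k) * S k))
       = K t *\<^sub>R (\<integral>v. indicator {-pi..pi} (v / sqrt t) *\<^sub>R h t (v / sqrt t) \<partial>lborel)"
      using elim by simp
    also have "\<dots> = integral\<^sup>L lborel (G t)"
      unfolding G_def integral_scaleR_right[symmetric] by (simp add: mult.commute)
    finally have "Re ((sqrt t * K t) *\<^sub>R complex_of_real (2 * pi * (\<Sum>\<^sub>\<infinity>k. walk_prob p t (N t + int k) * S k)))
        = Re (integral\<^sup>L lborel (G t))" by simp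
    then show ?case by (simp add: field_simps)
  qed

  have meas: "eventually (\<lambda>t. G t \<in> borel_measurable lborel) at_top"
    using ev_pos ev_small
  proof eventually_elim
    case (elim t)
    have th: "0 < \<theta> t" "\<theta> t \<le> \<theta>\<^sub>0" and t: "t \<ge> 0" using elim exponent_pos by auto
    have "continuous_on {-pi..pi} (h t)"
      unfolding h_def by (rule walk_series_inversion(3)[OF S th t])
    then have [measurable]: "(\<lambda>u. indicator {-pi..pi} u *\<^sub>R h t u) \<in> borel_measurable borel"
      by (intro borel_measurable_continuous_on_indicator) auto
    have "(\<lambda>v. K t *\<^sub>R (\<lambda>u. indicator {-pi..pi} u *\<^sub>R h t u) (v / sqrt t)) \<in> borel_measurable borel"
      by measurable
    then show ?case by (simp add: G_def mult.commute)
  qed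

  \<comment> \<open>One factor \<open>exp 1\<close> bounds the quartic error in the exponent. The
    other comes from \<open>gen_series_bound\<close>, where
    \<open>exp (\<theta> t) \<le> exp 1\<close> because the tilt is eventually below 1.\<close>
  have dom: "eventually (\<lambda>t. \<forall>v. norm (G t v) \<le> exp 2 * exp (- (c * v\<^sup>2))) at_top"
    using ev_pos ev_small ev_quart
  proof eventually_elim
    case (elim t)
    show ?case
    proof
      fix v :: real
      define u where "u = v / sqrt t"
      show "norm (G t v) \<le> exp 2 * exp (- (c * v\<^sup>2))"
      proof (cases "\<bar>u\<bar> \<le> pi")
        case False
        then have "u \<notin> {-pi..pi}" by auto
        then show ?thesis by (simp add: G_def u_def)
      next
        case True
        have u2: "t * c * u\<^sup>2 = c * v\<^sup>2" using elim by (simp add: u_def power_divide)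
        have th: "\<bar>\<theta> t\<bar> \<le> \<theta>\<^sub>0" using elim exponent_pos by auto
        have "t * (rmgf p (\<theta> t) - 1 - \<sigma>\<^sup>2 * (\<theta> t)\<^sup>2 / 2) \<le> t * \<bar>rmgf p (\<theta> t) - 1 - \<sigma>\<^sup>2 * (\<theta> t)\<^sup>2 / 2\<bar>"
          using elim by (intro mult_left_mono abs_ge_self) simp
        also have "\<dots> \<le> t * (C' * (\<theta> t) ^ 4)"
          using elim by (intro mult_left_mono C'(2)) auto
        also have "\<dots> < 1" using elim by simp
        finally have "t * (rmgf p (\<theta> t) - 1 - \<sigma>\<^sup>2 * (\<theta> t)\<^sup>2 / 2) \<le> 1" by simp
        then have e1: "\<sigma>\<^sup>2 * t * (\<theta> t)\<^sup>2 / 2 + (t * (rmgf p (\<theta> t) - 1) - \<theta> t * of_int (N t)) \<le> 1"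
          unfolding N by (simp add: algebra_simps power2_eq_square)
        have "norm (exp (of_real t * (mgf p (Complex (\<theta> t) u) - 1) - Complex (\<theta> t) u * of_int (N t)))
            \<le> exp (t * (rmgf p (\<theta> t) - 1) - \<theta> t * of_int (N t)) * exp (- (c * v\<^sup>2))"
          using norm_exp_mgf[OF th _ c(2) True, of t "N t"] elim u2 by simp
        then have e2: "exp (\<sigma>\<^sup>2 * t * (\<theta> t)\<^sup>2 / 2) * norm (exp (of_real t * (mgf p (Complex (\<theta> t) u) - 1) - Complex (\<theta> t) u * of_int (N t)))
            \<le> exp (\<sigma>\<^sup>2 * t * (\<theta> t)\<^sup>2 / 2) * (exp (t * (rmgf p (\<theta> t) - 1) - \<theta> t * of_int (N t)) * exp (- (c * v\<^sup>2)))"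
          by (intro mult_left_mono) auto
        also have "\<dots> = exp (\<sigma>\<^sup>2 * t * (\<theta> t)\<^sup>2 / 2 + (t * (rmgf p (\<theta> t) - 1) - \<theta> t * of_int (N t))) * exp (- (c * v\<^sup>2))"
          by (simp add: exp_add)
        also have "\<dots> \<le> exp 1 * exp (- (c * v\<^sup>2))"
          using e1 by (intro mult_right_mono) auto
        finally have e3: "exp (\<sigma>\<^sup>2 * t * (\<theta> t)\<^sup>2 / 2) * norm (exp (of_real t * (mgf p (Complex (\<theta> t) u) - 1) - Complex (\<theta> t) u * of_int (N t)))
            \<le> exp 1 * exp (- (c * v\<^sup>2))" .
        have "norm (gen_series S (Complex (\<theta> t) u)) * (\<theta> t)\<^sup>2 \<le> exp (\<theta> t)"
          using gen_series_bound(2)[OF S, of "Complex (\<theta> t) u"] elim by simp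
        also have "\<dots> \<le> exp 1" using elim by auto
        finally have e4: "norm (gen_series S (Complex (\<theta> t) u)) * (\<theta> t)\<^sup>2 \<le> exp 1" .
        have "norm (G t v) = (exp (\<sigma>\<^sup>2 * t * (\<theta> t)\<^sup>2 / 2) * norm (exp (of_real t * (mgf p (Complex (\<theta> t) u) - 1) - Complex (\<theta> t) u * of_int (N t))))
            * (norm (gen_series S (Complex (\<theta> t) u)) * (\<theta> t)\<^sup>2)"
          using True by (simp add: G_def K_def h_def u_def[symmetric] norm_mult abs_le_iff mult_ac)
        also have "\<dots> \<le> (exp 1 * exp (- (c * v\<^sup>2))) * exp 1"
          by (intro mult_mono e3 e4) auto
        also have "\<dots> = exp 2 * exp (- (c * v\<^sup>2))"
          by (simp add: mult_ac flip: exp_add)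
        finally show ?thesis .
      qed
    qed
  qed

  have lim: "((\<lambda>t. G t v) \<longlongrightarrow> of_real (r * exp (- (\<sigma>\<^sup>2 / 2 * v\<^sup>2)))) at_top" for v
  proof -
    define s where "s = (\<lambda>t. Complex (\<theta> t) (v / sqrt t))"
    define w where "w = (\<lambda>t. v / (sqrt t * \<theta> t))"
    have sq: "filterlim sqrt at_top (at_top :: real filter)" by real_asymp
    have vt: "((\<lambda>t. v / sqrt t) \<longlongrightarrow> 0) at_top" by real_asymp
    have s0: "(s \<longlongrightarrow> 0) at_top"
      using tendsto_Complex[OF th0 vt] by (simp add: s_def zero_complex.code)
    have w0: "(w \<longlongrightarrow> 0) at_top"
      unfolding w_def by (rule tendsto_divide_0[OF tendsto_const filterlim_at_top_imp_at_infinity[OF th1]])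
    have ev_ind: "eventually (\<lambda>t. \<bar>v / sqrt t\<bar> < pi) at_top"
      using tendstoD[OF vt, of pi] by simp
    have s_small: "eventually (\<lambda>t. norm (s t) \<le> \<theta>\<^sub>0 / 2) at_top"
      using tendstoD[OF s0, of "\<theta>\<^sub>0 / 2"] exponent_pos by (auto elim: eventually_mono)
    have s_at: "filterlim s (at 0) at_top"
      unfolding filterlim_at using s0 ev_pos by (auto simp: s_def complex_eq_iff elim: eventually_mono)
    have rem: "((\<lambda>t. of_real t * (mgf p (s t) - 1 - of_real (\<sigma>\<^sup>2) * (s t)\<^sup>2 / 2)) \<longlongrightarrow> 0) at_top"
    proof (rule Lim_null_comparison)
      have "((\<lambda>t. C * (sqrt t * (\<theta> t)\<^sup>2 + v\<^sup>2 / sqrt t)\<^sup>2) \<longlongrightarrow> C * (0 + 0)\<^sup>2) at_top"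
        by (intro tendsto_intros th2 tendsto_divide_0[OF tendsto_const filterlim_at_top_imp_at_infinity[OF sq]])
      then show "((\<lambda>t. C * (sqrt t * (\<theta> t)\<^sup>2 + v\<^sup>2 / sqrt t)\<^sup>2) \<longlongrightarrow> 0) at_top" by simp
      show "eventually (\<lambda>t. norm (of_real t * (mgf p (s t) - 1 - of_real (\<sigma>\<^sup>2) * (s t)\<^sup>2 / 2)) \<le> C * (sqrt t * (\<theta> t)\<^sup>2 + v\<^sup>2 / sqrt t)\<^sup>2) at_top"
        using s_small eventually_gt_at_top[of 0]
      proof eventually_elim
        case (elim t)
        have "norm (of_real t * (mgf p (s t) - 1 - of_real (\<sigma>\<^sup>2) * (s t)\<^sup>2 / 2)) \<le> t * (C * norm (s t) ^ 4)"
          using C(2)[OF elim(1)] elim(2) by (simp add: norm_mult)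
        also have "norm (s t) ^ 4 = ((\<theta> t)\<^sup>2 + v\<^sup>2 / t)\<^sup>2"
        proof -
          have "(norm (s t))\<^sup>2 = (\<theta> t)\<^sup>2 + v\<^sup>2 / t"
            using elim by (simp add: s_def cmod_power2 power_divide)
          moreover have "norm (s t) ^ 4 = ((norm (s t))\<^sup>2)\<^sup>2" by (simp flip: power_mult)
          ultimately show ?thesis by simp
        qed
        also have "t * (C * ((\<theta> t)\<^sup>2 + v\<^sup>2 / t)\<^sup>2) = C * (sqrt t * (\<theta> t)\<^sup>2 + v\<^sup>2 / sqrt t)\<^sup>2"
        proof -
          have "sqrt t * (\<theta> t)\<^sup>2 + v\<^sup>2 / sqrt t = sqrt t * ((\<theta> t)\<^sup>2 + v\<^sup>2 / t)"
            using elim by (simp add: field_simps)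
          then show ?thesis using elim by (simp add: power_mult_distrib)
        qed
        finally show ?case .
      qed
    qed
    \<comment> \<open>Three factors: \<open>exp (- s)\<close> tends to 1,
      \<open>s / (1 - exp (- s))\<close> tends to 1 as \<open>s\<close> approaches 0, and
      \<open>\<theta> / s\<close> tends to 1 because \<open>s = \<theta> * (1 + \<i> * w)\<close>
      with \<open>w\<close> tending to 0.\<close>
    have D: "((\<lambda>t. of_real ((\<theta> t)\<^sup>2) * gen_series S (s t)) \<longlongrightarrow> of_real r) at_top"
    proof -
      have e0: "((\<lambda>t. exp (- s t)) \<longlongrightarrow> exp (- 0)) at_top" by (intro tendsto_intros s0)
      have q: "((\<lambda>t. s t / (1 - exp (- s t))) \<longlongrightarrow> 1) at_top"
        by (rule filterlim_compose[OF one_minus_exp_quotient_tendsto s_at])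
      have "((\<lambda>t. 1 / (1 + \<i> * of_real (w t))) \<longlongrightarrow> 1 / (1 + \<i> * of_real 0)) at_top"
        by (intro tendsto_intros w0) auto
      moreover have "eventually (\<lambda>t. 1 / (1 + \<i> * of_real (w t)) = of_real (\<theta> t) / s t) at_top"
        using ev_pos
      proof eventually_elim
        case (elim t)
        have "s t = of_real (\<theta> t) * (1 + \<i> * of_real (w t))"
          using elim by (simp add: s_def w_def Complex_eq field_simps)
        then show ?case using elim by simp
      qed
      ultimately have ts: "((\<lambda>t. of_real (\<theta> t) / s t) \<longlongrightarrow> 1) at_top"
        by (auto intro: Lim_transform_eventually)
      have "((\<lambda>t. of_real r * (exp (- s t) * (of_real (\<theta> t) / s t)\<^sup>2 * (s t / (1 - exp (- s t)))\<^sup>2)) \<longlongrightarrow> of_real r * (exp (- 0) * 1\<^sup>2 * 1\<^sup>2)) at_top"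
        by (intro tendsto_mult tendsto_power tendsto_const e0 ts q)
      moreover have "eventually (\<lambda>t. of_real r * (exp (- s t) * (of_real (\<theta> t) / s t)\<^sup>2 * (s t / (1 - exp (- s t)))\<^sup>2)
         = of_real ((\<theta> t)\<^sup>2) * (of_real r * (exp (- s t) / (1 - exp (- s t))\<^sup>2))) at_top"
        using ev_pos
      proof eventually_elim
        case (elim t)
        have "s t \<noteq> 0" using elim by (auto simp: s_def complex_eq_iff)
        then show ?case by (simp add: power_divide)
      qed
      ultimately have main: "((\<lambda>t. of_real ((\<theta> t)\<^sup>2) * (of_real r * (exp (- s t) / (1 - exp (- s t))\<^sup>2))) \<longlongrightarrow> of_real r) at_top"
        by (auto intro: Lim_transform_eventually)
      have err: "((\<lambda>t. of_real ((\<theta> t)\<^sup>2) * (gen_series S (s t) - of_real r * (exp (- s t) / (1 - exp (- s t))\<^sup>2))) \<longlongrightarrow> 0) at_top"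
      proof (rule Lim_null_comparison)
        have "((\<lambda>t. \<theta> t * (B * exp (\<theta> t))) \<longlongrightarrow> 0 * (B * exp 0)) at_top" by (intro tendsto_intros th0)
        then show "((\<lambda>t. \<theta> t * (B * exp (\<theta> t))) \<longlongrightarrow> 0) at_top" by simp
        show "eventually (\<lambda>t. norm (of_real ((\<theta> t)\<^sup>2) * (gen_series S (s t) - of_real r * (exp (- s t) / (1 - exp (- s t))\<^sup>2))) \<le> \<theta> t * (B * exp (\<theta> t))) at_top"
          using ev_pos
        proof eventually_elim
          case (elim t)
          have "norm (gen_series S (s t) - of_real r * (exp (- s t) / (1 - exp (- s t))\<^sup>2)) * \<theta> t \<le> B * exp (\<theta> t)"
            using gen_series_affine_bound[OF S r, of "s t"] elim by (simp add: s_def)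
          then have "\<theta> t * (norm (gen_series S (s t) - of_real r * (exp (- s t) / (1 - exp (- s t))\<^sup>2)) * \<theta> t) \<le> \<theta> t * (B * exp (\<theta> t))"
            using elim by (intro mult_left_mono) auto
          then show ?case by (simp add: norm_mult norm_power power2_eq_square mult_ac)
        qed
      qed
      from tendsto_add[OF err main] show ?thesis by (simp add: algebra_simps)
    qed
    have "((\<lambda>t. exp (of_real (- (\<sigma>\<^sup>2 / 2 * v\<^sup>2)) + of_real t * (mgf p (s t) - 1 - of_real (\<sigma>\<^sup>2) * (s t)\<^sup>2 / 2)) * (of_real ((\<theta> t)\<^sup>2) * gen_series S (s t)))
      \<longlongrightarrow> exp (of_real (- (\<sigma>\<^sup>2 / 2 * v\<^sup>2)) + 0) * of_real r) at_top"
      by (intro tendsto_mult tendsto_exp tendsto_add tendsto_const rem D)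
    moreover have "eventually (\<lambda>t. exp (of_real (- (\<sigma>\<^sup>2 / 2 * v\<^sup>2)) + of_real t * (mgf p (s t) - 1 - of_real (\<sigma>\<^sup>2) * (s t)\<^sup>2 / 2)) * (of_real ((\<theta> t)\<^sup>2) * gen_series S (s t)) = G t v) at_top"
      using ev_pos ev_ind
    proof eventually_elim
      case (elim t)
      have ind: "indicator {-pi..pi} (v / sqrt t) = (1::real)" using elim(2) unfolding abs_less_iff by (simp add: indicator_def)
      have sd: "Complex (\<theta> t) (v / sqrt t) = s t" by (simp add: s_def)
      have Nc: "complex_of_int (N t) = of_real (\<sigma>\<^sup>2 * t * \<theta> t)" by (simp flip: N)
      have s_eq: "s t = of_real (\<theta> t) + \<i> * of_real (v / sqrt t)" by (simp add: s_def Complex_eq)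
      have v2: "t * (v / sqrt t)\<^sup>2 = v\<^sup>2" using elim(1) by (simp add: power_divide)
      have i2: "of_real t * (\<i> * complex_of_real (v / sqrt t))\<^sup>2 = - of_real (v\<^sup>2)"
        unfolding v2[symmetric] by (simp only: power_mult_distrib i_squared of_real_mult of_real_power) simp
      \<comment> \<open>Completing the square: as \<open>N = \<sigma>\<^sup>2 t \<theta>\<close>,
        the quadratic part of the exponent is
        \<open>\<sigma>\<^sup>2 t (s - \<theta>)\<^sup>2 / 2\<close>, and
        \<open>s - \<theta>\<close> is purely imaginary.\<close>
      have "of_real (\<sigma>\<^sup>2 * t * (\<theta> t)\<^sup>2 / 2) - s t * of_real (\<sigma>\<^sup>2 * t * \<theta> t) + of_real t * (of_real (\<sigma>\<^sup>2) * (s t)\<^sup>2 / 2)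
          = of_real (\<sigma>\<^sup>2) / 2 * (of_real t * (s t - of_real (\<theta> t))\<^sup>2)"
        by (simp add: field_simps power2_eq_square)
      also have "\<dots> = of_real (- (\<sigma>\<^sup>2 / 2 * v\<^sup>2))"
        using i2 by (simp add: s_eq)
      finally have expo: "of_real (\<sigma>\<^sup>2 * t * (\<theta> t)\<^sup>2 / 2) - s t * of_real (\<sigma>\<^sup>2 * t * \<theta> t) + of_real t * (of_real (\<sigma>\<^sup>2) * (s t)\<^sup>2 / 2)
          = complex_of_real (- (\<sigma>\<^sup>2 / 2 * v\<^sup>2))" .
      have "of_real (- (\<sigma>\<^sup>2 / 2 * v\<^sup>2)) + of_real t * (mgf p (s t) - 1 - of_real (\<sigma>\<^sup>2) * (s t)\<^sup>2 / 2)
         = of_real (\<sigma>\<^sup>2 * t * (\<theta> t)\<^sup>2 / 2) + (of_real t * (mgf p (s t) - 1) - s t * of_int (N t))"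
        unfolding expo[symmetric] Nc by (simp add: algebra_simps)
      then show ?case
        unfolding G_def ind h_def K_def sd
        by (simp only: exp_add exp_of_real scaleR_conv_of_real of_real_mult mult_ac mult_1 mult_1_right of_real_1)
    qed
    ultimately have "((\<lambda>t. G t v) \<longlongrightarrow> exp (of_real (- (\<sigma>\<^sup>2 / 2 * v\<^sup>2)) + 0) * of_real r) at_top"
      by (rule Lim_transform_eventually)
    then show ?thesis by (simp only: add_0_right exp_of_real of_real_mult mult_ac)
  qed

  have "((\<lambda>t. integral\<^sup>L lborel (G t)) \<longlongrightarrow> (\<integral>v. complex_of_real (r * exp (- (\<sigma>\<^sup>2 / 2 * v\<^sup>2))) \<partial>lborel)) at_top"
  proof -
    \<comment> \<open>Dominated convergence asks for measurability at every \<open>t\<close>, but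
      \<open>G t\<close> is known to be measurable only for large \<open>t\<close>; it is replaced
      by 0 elsewhere.\<close>
    define G' where "G' = (\<lambda>t. if G t \<in> borel_measurable lborel then G t else (\<lambda>_. 0))"
    have eq: "eventually (\<lambda>t. G' t = G t) at_top"
      using meas by eventually_elim (simp add: G'_def)
    have "((\<lambda>t. integral\<^sup>L lborel (G' t)) \<longlongrightarrow> (\<integral>v. complex_of_real (r * exp (- (\<sigma>\<^sup>2 / 2 * v\<^sup>2))) \<partial>lborel)) at_top"
    proof (rule integral_dominated_convergence_at_top)
      show "G' t \<in> borel_measurable lborel" for t by (auto simp: G'_def)
      show "integrable lborel (\<lambda>v. exp 2 * exp (- (c * v\<^sup>2)))"
        using gaussian_integral(1)[OF c(1)] by simp
      show "AE v in lborel. ((\<lambda>t. G' t v) \<longlongrightarrow> complex_of_real (r * exp (- (\<sigma>\<^sup>2 / 2 * v\<^sup>2)))) at_top"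
      proof (rule AE_I2)
        fix v
        show "((\<lambda>t. G' t v) \<longlongrightarrow> complex_of_real (r * exp (- (\<sigma>\<^sup>2 / 2 * v\<^sup>2)))) at_top"
          using lim[of v] by (rule Lim_transform_eventually) (use eq in \<open>auto elim: eventually_mono\<close>)
      qed
      show "\<forall>\<^sub>F t in at_top. AE v in lborel. norm (G' t v) \<le> exp 2 * exp (- (c * v\<^sup>2))"
        using eq dom by eventually_elim auto
    qed simp
    then show ?thesis
      by (rule Lim_transform_eventually) (use eq in \<open>auto elim: eventually_mono\<close>)
  qed
  also have "(\<integral>v. complex_of_real (r * exp (- (\<sigma>\<^sup>2 / 2 * v\<^sup>2))) \<partial>lborel) = of_real (r * sqrt (pi / (\<sigma>\<^sup>2 / 2)))"
    using gaussian_integral(2)[of "\<sigma>\<^sup>2 / 2"] std_pos by simp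
  finally have "((\<lambda>t. Re (integral\<^sup>L lborel (G t)) / (2 * pi)) \<longlongrightarrow> Re (of_real (r * sqrt (pi / (\<sigma>\<^sup>2 / 2)))) / (2 * pi)) at_top"
    by (intro tendsto_intros) auto
  moreover have "Re (of_real (r * sqrt (pi / (\<sigma>\<^sup>2 / 2)))) / (2 * pi) = r / (\<sigma> * sqrt (2 * pi))"
    using std_pos by (simp add: real_sqrt_divide real_sqrt_mult field_simps)
  ultimately have "((\<lambda>t. Re (integral\<^sup>L lborel (G t)) / (2 * pi)) \<longlongrightarrow> r / (\<sigma> * sqrt (2 * pi))) at_top" by simp
  then have "((\<lambda>t. sqrt t * K t * (\<Sum>\<^sub>\<infinity>k. walk_prob p t (N t + int k) * S k)) \<longlongrightarrow> r / (\<sigma> * sqrt (2 * pi))) at_top"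
    using G_eq by (elim Lim_transform_eventually) (auto elim: eventually_mono)
  then show ?thesis by (simp add: K_def mult.assoc)
qed

end


section \<open>Cylinder functions\<close>

text \<open>With right derivatives only, the mean value theorem is not at hand. Adding a small slope
  makes the right derivative strictly positive, so the last point at which the tilted function is
  nonnegative cannot lie before \<open>b\<close>.\<close>

lemma mono_of_right_derivative:
  fixes f :: "real \<Rightarrow> real"
  assumes ab: "a \<le> b" and cont: "continuous_on {a..b} f"
    and der: "\<And>s. a \<le> s \<Longrightarrow> s < b \<Longrightarrow> \<exists>D\<ge>0. (f has_real_derivative D) (at s within {s..})"
  shows "f a \<le> f b"
proof (rule field_le_epsilon)
  fix e :: real assume e: "e > 0"
  define \<epsilon> where "\<epsilon> = e / (b - a + 1)"
  have eps: "\<epsilon> > 0" "\<epsilon> * (b - a) \<le> e" using ab e by (auto simp: \<epsilon>_def field_simps)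
  define g where "g = (\<lambda>x. f x - f a + \<epsilon> * (x - a))"
  have gc: "continuous_on {a..b} g" unfolding g_def by (intro continuous_intros cont)
  have "g b \<ge> 0"
  proof (rule ccontr)
    assume neg: "\<not> g b \<ge> 0"
    define A where "A = {x \<in> {a..b}. g x \<ge> 0}"
    have "A = {a..b} \<inter> g -` {0..}" by (auto simp: A_def)
    then have "closed A"
      using continuous_closed_preimage[OF gc, of "{0..}"] by simp
    then have "compact A"
      unfolding compact_eq_bounded_closed by (auto simp: A_def intro: bounded_subset[of "{a..b}"])
    moreover have "a \<in> A" using ab by (simp add: A_def g_def)
    ultimately obtain c where c: "c \<in> A" "\<And>x. x \<in> A \<Longrightarrow> x \<le> c"
      using compact_attains_sup[of A] by blast
    have cb: "a \<le> c" "c < b" "g c \<ge> 0" using c(1) neg by (auto simp: A_def less_le)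
    obtain D where D: "D \<ge> 0" "(f has_real_derivative D) (at c within {c..})" using der[OF cb(1,2)] by blast
    have "(g has_real_derivative (D + \<epsilon>)) (at c within {c..})"
      unfolding g_def by (auto intro!: derivative_eq_intros D(2))
    from has_real_derivative_pos_inc_right[OF this] D(1) eps(1)
    obtain d where d: "d > 0" "\<And>h. h > 0 \<Longrightarrow> c + h \<in> {c..} \<Longrightarrow> h < d \<Longrightarrow> g c < g (c + h)" by auto
    define h where "h = min (d / 2) (b - c)"
    have h: "h > 0" "h < d" "c + h \<le> b" using d(1) cb by (auto simp: h_def)
    have "g (c + h) > 0" using d(2)[of h] h cb by auto
    then have "c + h \<in> A" using h cb by (simp add: A_def)
    from c(2)[OF this] h show False by simp
  qed
  then show "f a \<le> f b + e" using eps by (simp add: g_def)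
qed

text \<open>These indicators span the functions that depend on \<open>A\<close>. A cylinder function
  that varies in time thus becomes a finite combination of fixed functions with scalar coefficients,
  which is how \<open>dynkin\<close> reduces to the product rule.\<close>

definition pattern :: "int set \<Rightarrow> int set \<Rightarrow> config \<Rightarrow> real" where
  "pattern A Z \<eta> = of_bool ({x \<in> A. \<eta> x} = Z)"

definition depends_on :: "int set \<Rightarrow> (config \<Rightarrow> real) \<Rightarrow> bool" where
  "depends_on A f \<longleftrightarrow> (\<forall>\<eta> \<zeta>. (\<forall>x\<in>A. \<eta> x = \<zeta> x) \<longrightarrow> f \<eta> = f \<zeta>)"

lemma cylinder_iff: "cylinder f \<longleftrightarrow> (\<exists>A. finite A \<and> depends_on A f)"
  by (simp add: cylinder_def depends_on_def)

lemma depends_onD: "depends_on A f \<Longrightarrow> (\<And>x. x \<in> A \<Longrightarrow> \<eta> x = \<zeta> x) \<Longrightarrow> f \<eta> = f \<zeta>"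
  unfolding depends_on_def by blast

lemma depends_on_pattern: "depends_on A (pattern A Z)"
proof -
  have "{x \<in> A. \<eta> x} = {x \<in> A. \<zeta> x}" if "\<forall>x\<in>A. \<eta> x = \<zeta> x" for \<eta> \<zeta> :: config
    using that by auto
  then show ?thesis by (auto simp: depends_on_def pattern_def)
qed

lemma pattern_expansion:
  assumes "finite A" "depends_on A f"
  shows "f \<eta> = (\<Sum>Z\<in>Pow A. f (\<lambda>x. x \<in> Z) * pattern A Z \<eta>)"
proof -
  have "(\<Sum>Z\<in>Pow A. f (\<lambda>x. x \<in> Z) * pattern A Z \<eta>) = (\<Sum>Z\<in>{{x \<in> A. \<eta> x}}. f (\<lambda>x. x \<in> Z) * pattern A Z \<eta>)"
    using assms(1) by (intro sum.mono_neutral_right) (auto simp: pattern_def)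
  also have "\<dots> = f (\<lambda>x. x \<in> {x \<in> A. \<eta> x})" by (simp add: pattern_def)
  also have "\<dots> = f \<eta>" by (rule depends_onD[OF assms(2)]) auto
  finally show ?thesis ..
qed

lemma depends_on_bounded:
  assumes "finite A" "depends_on A f"
  obtains C where "\<And>\<eta>. \<bar>f \<eta>\<bar> \<le> C"
proof -
  have "\<bar>f \<eta>\<bar> \<le> (\<Sum>Z\<in>Pow A. \<bar>f (\<lambda>x. x \<in> Z)\<bar>)" for \<eta>
  proof -
    have "\<bar>f \<eta>\<bar> \<le> (\<Sum>Z\<in>Pow A. \<bar>f (\<lambda>x. x \<in> Z) * pattern A Z \<eta>\<bar>)"
      by (subst pattern_expansion[OF assms, of \<eta>]) (rule sum_abs)
    also have "\<dots> \<le> (\<Sum>Z\<in>Pow A. \<bar>f (\<lambda>x. x \<in> Z)\<bar>)"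
      by (intro sum_mono) (auto simp: pattern_def)
    finally show ?thesis .
  qed
  then show thesis using that by blast
qed

lemma depends_on_continuous:
  assumes "finite A" "depends_on A f"
  shows "continuous_on UNIV f"
proof -
  have "(f \<longlongrightarrow> f \<eta>) (at \<eta>)" for \<eta>
  proof -
    have "eventually (\<lambda>\<zeta>. \<forall>x\<in>A. \<zeta> x = \<eta> x) (at \<eta>)"
    proof (rule eventually_ball_finite[OF assms(1)], intro ballI)
      fix x
      have "continuous_on UNIV (\<lambda>\<zeta>::config. \<zeta> x)" by (rule continuous_on_product_coordinates)
      then have "((\<lambda>\<zeta>::config. \<zeta> x) \<longlongrightarrow> \<eta> x) (at \<eta>)"
        by (simp add: continuous_on_def)
      then show "eventually (\<lambda>\<zeta>. \<zeta> x = \<eta> x) (at \<eta>)" by (simp add: tendsto_discrete)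
    qed
    then have "eventually (\<lambda>\<zeta>. f \<zeta> = f \<eta>) (at \<eta>)"
      by eventually_elim (rule depends_onD[OF assms(2)], simp)
    then show ?thesis by (rule tendsto_eventually)
  qed
  then show ?thesis by (simp add: continuous_on_def)
qed

lemma depends_on_bcontfun:
  assumes "finite A" "depends_on A f"
  shows "f \<in> bcontfun"
proof -
  obtain C where "\<And>\<eta>. \<bar>f \<eta>\<bar> \<le> C" using depends_on_bounded[OF assms] by blast
  then show ?thesis
    using depends_on_continuous[OF assms] by (intro bcontfun_normI[of _ C]) auto
qed

lemma pattern_measurable:
  assumes "finite A"
  shows "pattern A Z \<in> borel_measurable config_space"
proof (cases "Z \<subseteq> A")
  case True
  have eq: "pattern A Z \<eta> = (\<Prod>x\<in>A. of_bool (\<eta> x = (x \<in> Z)))" for \<eta>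
  proof (cases "\<forall>x\<in>A. \<eta> x = (x \<in> Z)")
    case True
    then have "{x \<in> A. \<eta> x} = Z" using \<open>Z \<subseteq> A\<close> by auto
    with True show ?thesis by (simp add: pattern_def)
  next
    case False
    then have "{x \<in> A. \<eta> x} \<noteq> Z" using \<open>Z \<subseteq> A\<close> by auto
    moreover have "(\<Prod>x\<in>A. of_bool (\<eta> x = (x \<in> Z)) :: real) = 0"
      using False assms by (auto simp: prod_zero_iff)
    ultimately show ?thesis by (simp add: pattern_def)
  qed
  have "(\<lambda>\<eta>. \<Prod>x\<in>A. of_bool (\<eta> x = (x \<in> Z)) :: real) \<in> borel_measurable (Pi\<^sub>M UNIV (\<lambda>_::int. count_space (UNIV::bool set)))"
    by measurable
  then show ?thesis by (simp add: config_space_def eq[abs_def])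
next
  case False
  then have "pattern A Z = (\<lambda>_. 0)" by (auto simp: pattern_def fun_eq_iff)
  then show ?thesis by simp
qed

lemma depends_on_measurable:
  assumes "finite A" "depends_on A f"
  shows "f \<in> borel_measurable config_space"
proof -
  have "(\<lambda>\<eta>. \<Sum>Z\<in>Pow A. f (\<lambda>x. x \<in> Z) * pattern A Z \<eta>) \<in> borel_measurable config_space"
    using pattern_measurable[OF assms(1)] by measurable
  also have "(\<lambda>\<eta>. \<Sum>Z\<in>Pow A. f (\<lambda>x. x \<in> Z) * pattern A Z \<eta>) = f"
    by (rule ext) (rule pattern_expansion[OF assms, symmetric])
  finally show ?thesis .
qed

text \<open>Emptying all sites outside \<open>{- i..i}\<close> turns \<open>f\<close> into a
  cylinder function, and these approximations converge pointwise because the modified configurations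
  converge in the product topology.\<close>

lemma bcontfun_measurable: "apply_bcontfun (f :: config \<Rightarrow>\<^sub>C real) \<in> borel_measurable config_space"
proof (rule borel_measurable_LIMSEQ_real)
  fix i
  show "(\<lambda>\<eta>. apply_bcontfun f (\<lambda>x. \<bar>x\<bar> \<le> int i \<and> \<eta> x)) \<in> borel_measurable config_space"
    by (rule depends_on_measurable[of "{- int i..int i}"])
       (auto simp: depends_on_def abs_le_iff intro!: arg_cong[of _ _ "apply_bcontfun f"])
next
  fix \<eta> :: config
  have "limitin (product_topology (\<lambda>_. euclidean) UNIV) (\<lambda>i x. \<bar>x\<bar> \<le> int i \<and> \<eta> x) \<eta> sequentially"
    unfolding limitin_componentwise
  proof (intro conjI ballI)
    fix x
    have "eventually (\<lambda>i. (\<bar>x\<bar> \<le> int i \<and> \<eta> x) = \<eta> x) sequentially"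
      using eventually_ge_at_top[of "nat \<bar>x\<bar>"] by eventually_elim auto
    then show "limitin euclidean (\<lambda>i. \<bar>x\<bar> \<le> int i \<and> \<eta> x) (\<eta> x) sequentially"
      unfolding limitin_canonical_iff by (rule tendsto_eventually)
  qed auto
  then have "(\<lambda>i x. \<bar>x\<bar> \<le> int i \<and> \<eta> x) \<longlonglongrightarrow> \<eta>"
    by (simp add: euclidean_product_topology limitin_canonical_iff)
  then show "(\<lambda>i. apply_bcontfun f (\<lambda>x. \<bar>x\<bar> \<le> int i \<and> \<eta> x)) \<longlonglongrightarrow> apply_bcontfun f \<eta>"
    by (intro continuous_on_tendsto_compose[OF continuous_on_apply_bcontfun[of UNIV f]]) auto
qed


section \<open>The generator and Dynkin's formula\<close>

text \<open>A majorant for the terms of the generator on functions that depend on \<open>A\<close>: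
  an exchange has an effect only if it touches \<open>A\<close>.\<close>

definition pair_weight :: "int pmf \<Rightarrow> int set \<Rightarrow> int \<times> int \<Rightarrow> real" where
  "pair_weight p A = (\<lambda>(x, y). pmf p (y - x) * of_bool (x \<in> A) + pmf p (y - x) * of_bool (y \<in> A))"

definition gen_term :: "int pmf \<Rightarrow> (config \<Rightarrow> real) \<Rightarrow> config \<Rightarrow> int \<times> int \<Rightarrow> real" where
  "gen_term p f \<eta> = (\<lambda>(x, y). pmf p (y - x) * of_bool (\<eta> x) * (1 - of_bool (\<eta> y)) * (f (exchange \<eta> x y) - f \<eta>))"

lemma pair_has_sum_fst:
  fixes g :: "int \<Rightarrow> real"
  assumes "(g has_sum G) UNIV" "\<And>x. g x \<ge> 0"
  shows "((\<lambda>(x, y). pmf p (y - x) * g x) has_sum G) UNIV"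
proof -
  have inner: "((\<lambda>y. case (x, y) of (x, y) \<Rightarrow> pmf p (y - x) * g x) has_sum g x) UNIV" for x
    using has_sum_cmult_left[OF has_sum_shift_int[of "pmf p" x 1, THEN iffD2, OF pmf_has_sum_1], of "g x"] by simp
  have "(\<lambda>(x, y). pmf p (y - x) * g x) summable_on UNIV \<times> UNIV"
    by (rule summable_on_SigmaI[OF inner has_sum_imp_summable[OF assms(1)]]) (use assms(2) in auto)
  from has_sum_SigmaI[OF inner assms(1) this] show ?thesis by simp
qed

lemma summable_on_of_abs_le:
  fixes f g :: "'a \<Rightarrow> real"
  assumes "g summable_on A" "\<And>x. x \<in> A \<Longrightarrow> \<bar>f x\<bar> \<le> g x"
  shows "f summable_on A"
proof (rule abs_summable_summable)
  show "(\<lambda>x. norm (f x)) summable_on A"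
    by (rule summable_on_comparison_test[OF assms(1)]) (use assms(2) in auto)
qed

lemma depends_on_gen_term:
  assumes "depends_on A f"
  shows "depends_on (insert x (insert y A)) (\<lambda>\<eta>. gen_term p f \<eta> (x, y))"
  unfolding depends_on_def
proof (intro allI impI)
  fix \<eta> \<zeta> :: config assume eq: "\<forall>z\<in>insert x (insert y A). \<eta> z = \<zeta> z"
  have "f \<eta> = f \<zeta>" "f (exchange \<eta> x y) = f (exchange \<zeta> x y)"
    using eq by (auto intro!: depends_onD[OF assms] simp: exchange_def fun_upd_def)
  then show "gen_term p f \<eta> (x, y) = gen_term p f \<zeta> (x, y)"
    using eq by (simp add: gen_term_def)
qed

lemma gen_term_bound:
  assumes "depends_on A f" "\<And>\<eta>. \<bar>f \<eta>\<bar> \<le> C"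
  shows "\<bar>gen_term p f \<eta> z\<bar> \<le> 2 * C * pair_weight p A z"
proof -
  obtain x y where z: "z = (x, y)" by (cases z)
  have C: "C \<ge> 0" using assms(2)[of \<eta>] by linarith
  show ?thesis
  proof (cases "x \<in> A \<or> y \<in> A")
    case False
    then have "f (exchange \<eta> x y) = f \<eta>"
      by (intro depends_onD[OF assms(1)]) (auto simp: exchange_def)
    then show ?thesis using False by (simp add: z gen_term_def pair_weight_def)
  next
    case True
    have "\<bar>f (exchange \<eta> x y) - f \<eta>\<bar> \<le> 2 * C"
      using assms(2)[of "exchange \<eta> x y"] assms(2)[of \<eta>] by linarith
    then have "pmf p (y - x) * (of_bool (\<eta> x) * (1 - of_bool (\<eta> y))) * \<bar>f (exchange \<eta> x y) - f \<eta>\<bar> \<le> pmf p (y - x) * 1 * (2 * C)"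
      by (intro mult_mono) (auto simp: of_bool_def)
    also have "\<dots> \<le> 2 * C * (pmf p (y - x) * (of_bool (x \<in> A) + of_bool (y \<in> A)))"
      using True C by (auto simp: of_bool_def)
    also have "\<dots> = 2 * C * pair_weight p A z"
      by (simp add: z pair_weight_def ring_distribs)
    also have "pmf p (y - x) * (of_bool (\<eta> x) * (1 - of_bool (\<eta> y))) * \<bar>f (exchange \<eta> x y) - f \<eta>\<bar> = \<bar>gen_term p f \<eta> z\<bar>"
      by (cases "\<eta> x"; cases "\<eta> y") (simp_all add: z gen_term_def abs_mult)
    finally show ?thesis .
  qed
qed

lemma has_sum_finite_sum:
  fixes f :: "'k \<Rightarrow> 'a \<Rightarrow> real"
  assumes "finite K" "\<And>k. k \<in> K \<Longrightarrow> (f k has_sum S k) A"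
  shows "((\<lambda>x. \<Sum>k\<in>K. f k x) has_sum (\<Sum>k\<in>K. S k)) A"
  using assms by (induction K rule: finite_induct) (auto intro: has_sum_add)

context symmetric_jumps
begin

lemma pmf_diff_commute: "pmf p (x - y) = pmf p (y - x)"
  using pmf_sym[of "y - x"] by simp

lemma pair_has_sum_snd:
  fixes g :: "int \<Rightarrow> real"
  assumes "(g has_sum G) UNIV" "\<And>x. g x \<ge> 0"
  shows "((\<lambda>(x, y). pmf p (y - x) * g y) has_sum G) UNIV"
proof -
  have "((\<lambda>(x, y). pmf p (y - x) * g x) has_sum G) (UNIV \<times> UNIV)"
    using pair_has_sum_fst[OF assms] by simp
  then have "((\<lambda>(y, x). pmf p (y - x) * g x) has_sum G) (UNIV \<times> UNIV)"
    by (subst has_sum_swap) (simp add: case_prod_unfold)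
  then show ?thesis
    by (simp add: pmf_diff_commute case_prod_unfold)
qed

lemma pair_weight_summable:
  assumes "finite A"
  shows "pair_weight p A summable_on UNIV"
proof -
  have A: "((\<lambda>x. of_bool (x \<in> A) :: real) has_sum real (card A)) UNIV"
    by (rule has_sum_finite_neutralI[OF assms]) auto
  show ?thesis
    unfolding pair_weight_def case_prod_unfold
    using has_sum_add[OF pair_has_sum_fst[OF A] pair_has_sum_snd[OF A], of p]
    by (auto simp: case_prod_unfold intro: has_sum_imp_summable)
qed

lemma gen_term_has_sum:
  assumes "finite A" "depends_on A f"
  shows "(gen_term p f \<eta> has_sum exclusion_pregenerator p f \<eta>) UNIV"
proof -
  obtain C where C: "\<And>\<eta>. \<bar>f \<eta>\<bar> \<le> C" using depends_on_bounded[OF assms] by blast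
  have "gen_term p f \<eta> summable_on UNIV"
    by (rule summable_on_of_abs_le[OF summable_on_cmult_right[OF pair_weight_summable[OF assms(1)]]])
       (rule gen_term_bound[OF assms(2) C])
  then show ?thesis
    by (simp add: exclusion_pregenerator_def gen_term_def)
qed

lemma pregenerator_bcontfun:
  assumes "finite A" "depends_on A f"
  shows "exclusion_pregenerator p f \<in> bcontfun"
proof -
  obtain C where C: "\<And>\<eta>. \<bar>f \<eta>\<bar> \<le> C" using depends_on_bounded[OF assms] by blast
  have s: "(\<lambda>z. 2 * C * pair_weight p A z) summable_on UNIV"
    by (intro summable_on_cmult_right pair_weight_summable assms)
  have ul: "uniform_limit UNIV (\<lambda>X \<eta>. \<Sum>z\<in>X. gen_term p f \<eta> z) (exclusion_pregenerator p f) (finite_subsets_at_top UNIV)"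
    by (rule Weierstrass_m_test_general'[OF _ gen_term_has_sum[OF assms] s])
       (use gen_term_bound[OF assms(2) C] in auto)
  have "continuous_on UNIV (\<lambda>\<eta>. gen_term p f \<eta> z)" for z
    using depends_on_continuous[OF _ depends_on_gen_term[OF assms(2)], of "fst z" "snd z" p] assms(1) by simp
  then have "continuous_on UNIV (exclusion_pregenerator p f)"
    by (intro uniform_limit_theorem[OF _ ul] always_eventually allI continuous_on_sum) auto
  moreover have "norm (exclusion_pregenerator p f \<eta>) \<le> (\<Sum>\<^sub>\<infinity>z. 2 * C * pair_weight p A z)" for \<eta>
    by (rule norm_infsum_le[OF gen_term_has_sum[OF assms] has_sum_infsum[OF s]])
       (use gen_term_bound[OF assms(2) C] in auto)
  ultimately show ?thesis by (rule bcontfun_normI)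
qed

lemma pregenerator_pattern_expansion:
  assumes "finite A" "depends_on A f"
  shows "exclusion_pregenerator p f \<eta> = (\<Sum>Z\<in>Pow A. f (\<lambda>x. x \<in> Z) * exclusion_pregenerator p (pattern A Z) \<eta>)"
proof -
  have "((\<lambda>z. \<Sum>Z\<in>Pow A. f (\<lambda>x. x \<in> Z) * gen_term p (pattern A Z) \<eta> z) has_sum
      (\<Sum>Z\<in>Pow A. f (\<lambda>x. x \<in> Z) * exclusion_pregenerator p (pattern A Z) \<eta>)) UNIV"
    using assms(1) by (intro has_sum_finite_sum has_sum_cmult_right gen_term_has_sum[OF _ depends_on_pattern]) auto
  moreover have "(\<Sum>Z\<in>Pow A. f (\<lambda>x. x \<in> Z) * gen_term p (pattern A Z) \<eta> z) = gen_term p f \<eta> z" for z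
  proof -
    obtain x y where z: "z = (x, y)" by (cases z)
    have "(\<Sum>Z\<in>Pow A. f (\<lambda>x. x \<in> Z) * gen_term p (pattern A Z) \<eta> z)
        = pmf p (y - x) * of_bool (\<eta> x) * (1 - of_bool (\<eta> y)) *
          ((\<Sum>Z\<in>Pow A. f (\<lambda>x. x \<in> Z) * pattern A Z (exchange \<eta> x y)) - (\<Sum>Z\<in>Pow A. f (\<lambda>x. x \<in> Z) * pattern A Z \<eta>))"
      unfolding sum_subtractf[symmetric] sum_distrib_left z gen_term_def
      by (intro sum.cong) (auto simp: algebra_simps)
    also have "\<dots> = gen_term p f \<eta> z"
      by (simp only: pattern_expansion[OF assms, symmetric] z gen_term_def case_prod_conv)
    finally show ?thesis .
  qed
  ultimately have "(gen_term p f \<eta> has_sum (\<Sum>Z\<in>Pow A. f (\<lambda>x. x \<in> Z) * exclusion_pregenerator p (pattern A Z) \<eta>)) UNIV"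
    by simp
  with gen_term_has_sum[OF assms] show ?thesis by (rule has_sum_unique)
qed

end

section \<open>Expectations along the process and their evolution in time\<close>

locale exclusion_process = symmetric_jumps p for p +
  fixes S :: semigroup and M :: "'a measure" and \<eta> :: "real \<Rightarrow> 'a \<Rightarrow> config"
  assumes semigroup: "exclusion_semigroup p S" and process: "markov_process_with S M \<eta>"
begin

sublocale prob_space M
  using process by (simp add: markov_process_with_def)

lemma eta_measurable [measurable]: "t \<ge> 0 \<Longrightarrow> \<eta> t \<in> measurable M config_space"
  using process by (simp add: markov_process_with_def)

definition mean :: "real \<Rightarrow> (config \<Rightarrow> real) \<Rightarrow> real" where
  "mean t f = (\<integral>\<omega>. f (\<eta> t \<omega>) \<partial>M)"

lemma measurable_eta_comp:
  "t \<ge> 0 \<Longrightarrow> f \<in> borel_measurable config_space \<Longrightarrow> (\<lambda>\<omega>. f (\<eta> t \<omega>)) \<in> borel_measurable M"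
  by (rule measurable_compose[OF eta_measurable])

lemma integrable_bcontfun:
  fixes f :: "config \<Rightarrow>\<^sub>C real"
  assumes "t \<ge> 0"
  shows "integrable M (\<lambda>\<omega>. apply_bcontfun f (\<eta> t \<omega>))"
proof (rule integrable_const_bound)
  show "AE \<omega> in M. norm (apply_bcontfun f (\<eta> t \<omega>)) \<le> norm f"
    by (rule AE_I2) (rule norm_bounded)
  show "(\<lambda>\<omega>. apply_bcontfun f (\<eta> t \<omega>)) \<in> borel_measurable M"
    by (rule measurable_eta_comp[OF assms bcontfun_measurable])
qed

lemma mean_bcontfun_bound: "t \<ge> 0 \<Longrightarrow> \<bar>mean t (apply_bcontfun f)\<bar> \<le> norm f"
proof -
  assume t: "t \<ge> 0"
  have "\<bar>mean t (apply_bcontfun f)\<bar> \<le> (\<integral>\<omega>. norm (apply_bcontfun f (\<eta> t \<omega>)) \<partial>M)"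
    unfolding mean_def real_norm_def[symmetric] by (rule integral_norm_bound)
  also have "\<dots> \<le> (\<integral>\<omega>. norm f \<partial>M)"
    by (intro integral_mono integrable_norm integrable_bcontfun[OF t] norm_bounded) simp
  also have "\<dots> = norm f" by (simp add: prob_space)
  finally show ?thesis .
qed

lemma subalgebra_past: "subalgebra M (past M \<eta> s)"
proof -
  have "{\<eta> u -` A \<inter> space M |u A. 0 \<le> u \<and> u \<le> s \<and> A \<in> sets config_space} \<subseteq> sets M"
    using eta_measurable by (auto intro: measurable_sets)
  then show ?thesis
    unfolding subalgebra_def past_def
    by (auto simp: sets_measure_of_conv space_measure_of_conv intro: sets.sigma_sets_subset[THEN subsetD] dest: sets.sets_into_space)
qed

lemma mean_markov:
  assumes "s \<ge> 0" "t \<ge> 0"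
  shows "mean (s + t) (apply_bcontfun f) = mean s (apply_bcontfun (S t f))"
proof -
  interpret finite_measure_subalgebra M "past M \<eta> s"
    by unfold_locales (rule subalgebra_past)
  have "AE \<omega> in M. real_cond_exp M (past M \<eta> s) (\<lambda>\<omega>'. apply_bcontfun f (\<eta> (s + t) \<omega>')) \<omega> = apply_bcontfun (S t f) (\<eta> s \<omega>)"
    using process assms by (simp add: markov_process_with_def)
  then have "(\<integral>\<omega>. real_cond_exp M (past M \<eta> s) (\<lambda>\<omega>'. apply_bcontfun f (\<eta> (s + t) \<omega>')) \<omega> \<partial>M)
      = (\<integral>\<omega>. apply_bcontfun (S t f) (\<eta> s \<omega>) \<partial>M)"
    using assms by (intro integral_cong_AE) (auto intro: measurable_eta_comp bcontfun_measurable)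
  moreover have "(\<integral>\<omega>. real_cond_exp M (past M \<eta> s) (\<lambda>\<omega>'. apply_bcontfun f (\<eta> (s + t) \<omega>')) \<omega> \<partial>M)
      = (\<integral>\<omega>. apply_bcontfun f (\<eta> (s + t) \<omega>) \<partial>M)"
    using assms by (intro real_cond_exp_int(2) integrable_bcontfun) simp
  ultimately show ?thesis by (simp add: mean_def)
qed

lemma mean_bcontfun_diff:
  "t \<ge> 0 \<Longrightarrow> mean t (apply_bcontfun (f - g)) = mean t (apply_bcontfun f) - mean t (apply_bcontfun g)"
  by (simp add: mean_def integrable_bcontfun)

lemma mean_bcontfun_scale:
  "mean t (apply_bcontfun (c *\<^sub>R f)) = c * mean t (apply_bcontfun f)"
  by (simp add: mean_def)

lemma semigroup_0: "S 0 f = f"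
  using semigroup by (simp add: exclusion_semigroup_def markov_semigroup_def)

text \<open>Cylinder functions lie in the domain because the generator is the closure of the
  operator given on them. Its difference quotients converge in the supremum norm, a convergence that
  \<open>mean s\<close> respects, and the Markov property at time \<open>s\<close> turns this into a
  forward derivative.\<close>

lemma mean_right_derivative:
  assumes A: "finite A" "depends_on A f" and s: "s \<ge> 0"
  shows "((\<lambda>s. mean s f) has_real_derivative mean s (exclusion_pregenerator p f)) (at s within {s..})"
proof -
  define F where "F = Bcontfun f"
  define G where "G = Bcontfun (exclusion_pregenerator p f)"
  have F: "apply_bcontfun F = f" and G: "apply_bcontfun G = exclusion_pregenerator p f"
    using depends_on_bcontfun[OF A] pregenerator_bcontfun[OF A] by (simp_all add: F_def G_def Bcontfun_inverse)
  have "(F, G) \<in> generator_graph S"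
  proof -
    have "(F, G) \<in> {(f, g). cylinder (apply_bcontfun f) \<and> apply_bcontfun g = exclusion_pregenerator p (apply_bcontfun f)}"
      using A by (auto simp: F G cylinder_iff)
    then show ?thesis
      unfolding conjunct2[OF semigroup[unfolded exclusion_semigroup_def]]
      by (rule subsetD[OF closure_subset])
  qed
  then have lim: "((\<lambda>h. (S h F - F) /\<^sub>R h) \<longlongrightarrow> G) (at_right 0)"
    by (simp add: generator_graph_def)
  have "((\<lambda>h. (mean (s + h) f - mean s f) / h) \<longlongrightarrow> mean s (exclusion_pregenerator p f)) (at_right 0)"
  proof (rule LIM_zero_cancel, rule Lim_null_comparison)
    show "((\<lambda>h. norm ((S h F - F) /\<^sub>R h - G)) \<longlongrightarrow> 0) (at_right 0)"
      using tendsto_norm[OF LIM_zero[OF lim]] by simp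
    show "eventually (\<lambda>h. norm ((mean (s + h) f - mean s f) / h - mean s (exclusion_pregenerator p f)) \<le> norm ((S h F - F) /\<^sub>R h - G)) (at_right 0)"
      using eventually_at_right_less[of "0::real"]
    proof eventually_elim
      case (elim h)
      have "mean (s + h) f - mean s f = mean s (apply_bcontfun (S h F - F))"
        unfolding mean_bcontfun_diff[OF s] F using mean_markov[OF s, of h F] elim by (simp add: F)
      then have "(mean (s + h) f - mean s f) / h - mean s (exclusion_pregenerator p f) = mean s (apply_bcontfun ((S h F - F) /\<^sub>R h - G))"
        unfolding mean_bcontfun_diff[OF s, of "(S h F - F) /\<^sub>R h" G] mean_bcontfun_scale G by (simp add: divide_inverse)
      then show ?case
        using mean_bcontfun_bound[OF s, of "(S h F - F) /\<^sub>R h - G"] by (simp only: real_norm_def)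
    qed
  qed
  then have "((\<lambda>y. (mean y f - mean s f) / (y - s)) \<longlongrightarrow> mean s (exclusion_pregenerator p f)) (at_right s)"
    by (subst at_right_to_0) (simp add: filterlim_filtermap add.commute)
  then show ?thesis
    by (simp add: has_field_derivative_iff at_within_Ici_at_right)
qed

text \<open>An increment between times \<open>a < b\<close> is bounded by
  \<open>norm (S (b - a) F - F)\<close> whatever \<open>a\<close> is, so right continuity of the
  semigroup at 0 yields continuity from both sides.\<close>

lemma mean_continuous:
  assumes A: "finite A" "depends_on A f"
  shows "continuous_on {0..} (\<lambda>s. mean s f)"
proof -
  define F where "F = Bcontfun f"
  have F: "apply_bcontfun F = f"
    using depends_on_bcontfun[OF A] by (simp add: F_def Bcontfun_inverse)
  have "\<forall>f. \<forall>t\<ge>0. continuous (at_right t) (\<lambda>s. S s f)"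
    using semigroup unfolding exclusion_semigroup_def markov_semigroup_def by (elim conjE)
  then have "continuous (at_right 0) (\<lambda>h. S h F)" by simp
  then have lim: "((\<lambda>h. S h F) \<longlongrightarrow> F) (at_right 0)"
    unfolding continuous_within semigroup_0 .
  show ?thesis
    unfolding continuous_on_iff
  proof (intro ballI allI impI)
    fix s e :: real assume s: "s \<in> {0..}" and e: "e > 0"
    from tendstoD[OF lim e] obtain d where d: "d > 0" "\<And>h. 0 < h \<Longrightarrow> h < d \<Longrightarrow> dist (S h F) F < e"
      by (auto simp: eventually_at_right_field)
    have key: "\<bar>mean b f - mean a f\<bar> < e" if "0 \<le> a" "a < b" "b - a < d" for a b
    proof -
      have "mean b f - mean a f = mean a (apply_bcontfun (S (b - a) F - F))"
        unfolding mean_bcontfun_diff[OF that(1)] F using mean_markov[of a "b - a" F] that by (simp add: F)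
      also have "\<bar>\<dots>\<bar> \<le> norm (S (b - a) F - F)" by (rule mean_bcontfun_bound[OF that(1)])
      also have "\<dots> < e" using d(2)[of "b - a"] that by (simp add: dist_norm)
      finally show ?thesis .
    qed
    show "\<exists>d>0. \<forall>x'\<in>{0..}. dist x' s < d \<longrightarrow> dist (mean x' f) (mean s f) < e"
    proof (intro exI[of _ d] conjI ballI impI d(1))
      fix x' assume x': "x' \<in> {0..}" "dist x' s < d"
      consider "x' < s" | "x' = s" | "x' > s" by linarith
      then show "dist (mean x' f) (mean s f) < e"
        using key[of x' s] key[of s x'] s x' e by cases (auto simp: dist_real_def abs_minus_commute)
    qed
  qed
qed

lemma integrable_depends_on:
  assumes "finite A" "depends_on A f" "t \<ge> 0"
  shows "integrable M (\<lambda>\<omega>. f (\<eta> t \<omega>))"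
  using integrable_bcontfun[OF assms(3), of "Bcontfun f"] depends_on_bcontfun[OF assms(1,2)]
  by (simp add: Bcontfun_inverse)

lemma integrable_pregenerator:
  assumes "finite A" "depends_on A f" "t \<ge> 0"
  shows "integrable M (\<lambda>\<omega>. exclusion_pregenerator p f (\<eta> t \<omega>))"
  using integrable_bcontfun[OF assms(3), of "Bcontfun (exclusion_pregenerator p f)"] pregenerator_bcontfun[OF assms(1,2)]
  by (simp add: Bcontfun_inverse)

lemma mean_pattern_expansion:
  assumes "finite A" "depends_on A f" "t \<ge> 0"
  shows "mean t f = (\<Sum>Z\<in>Pow A. f (\<lambda>x. x \<in> Z) * mean t (pattern A Z))"
proof -
  have "mean t f = (\<integral>\<omega>. (\<Sum>Z\<in>Pow A. f (\<lambda>x. x \<in> Z) * pattern A Z (\<eta> t \<omega>)) \<partial>M)"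
    unfolding mean_def pattern_expansion[OF assms(1,2), symmetric] ..
  also have "\<dots> = (\<Sum>Z\<in>Pow A. f (\<lambda>x. x \<in> Z) * mean t (pattern A Z))"
    using assms by (simp add: mean_def integrable_depends_on[OF _ depends_on_pattern])
  finally show ?thesis .
qed

lemma mean_pregenerator_pattern_expansion:
  assumes "finite A" "depends_on A f" "t \<ge> 0"
  shows "mean t (exclusion_pregenerator p f) = (\<Sum>Z\<in>Pow A. f (\<lambda>x. x \<in> Z) * mean t (exclusion_pregenerator p (pattern A Z)))"
proof -
  have "mean t (exclusion_pregenerator p f)
      = (\<integral>\<omega>. (\<Sum>Z\<in>Pow A. f (\<lambda>x. x \<in> Z) * exclusion_pregenerator p (pattern A Z) (\<eta> t \<omega>)) \<partial>M)"
    unfolding mean_def pregenerator_pattern_expansion[OF assms(1,2), symmetric] ..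
  also have "\<dots> = (\<Sum>Z\<in>Pow A. f (\<lambda>x. x \<in> Z) * mean t (exclusion_pregenerator p (pattern A Z)))"
    using assms by (simp add: mean_def integrable_pregenerator[OF _ depends_on_pattern])
  finally show ?thesis .
qed

text \<open>The pattern expansion separates deterministic coefficients, which have two-sided
  derivatives, from expectations of fixed patterns, which have right derivatives. Inserting
  \<open>t - s\<close> reverses time, so that for \<open>F\<close> built from a solution of the
  backward equation the two terms almost cancel.\<close>

lemma dynkin:
  assumes A: "finite A" and F: "\<And>r. depends_on A (F r)" and F': "\<And>r. depends_on A (F' r)"
    and der: "\<And>r \<zeta>. 0 \<le> r \<Longrightarrow> r \<le> t \<Longrightarrow> ((\<lambda>r. F r \<zeta>) has_real_derivative F' r \<zeta>) (at r)"
  shows "continuous_on {0..t} (\<lambda>s. mean s (F (t - s)))"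
    and "0 \<le> s \<Longrightarrow> s \<le> t \<Longrightarrow> ((\<lambda>s. mean s (F (t - s))) has_real_derivative
       mean s (exclusion_pregenerator p (F (t - s))) - mean s (F' (t - s))) (at s within {s..})"
proof -
  let ?c = "\<lambda>Z x. x \<in> (Z :: int set)"
  have exp: "mean s (F (t - s)) = (\<Sum>Z\<in>Pow A. F (t - s) (?c Z) * mean s (pattern A Z))" if "s \<ge> 0" for s
    by (rule mean_pattern_expansion[OF A F that])
  have derF: "((\<lambda>s. F (t - s) \<zeta>) has_real_derivative - F' (t - s) \<zeta>) (at s)" if "0 \<le> s" "s \<le> t" for s \<zeta>
  proof -
    have "((\<lambda>s. t - s) has_real_derivative -1) (at s)" by (auto intro!: derivative_eq_intros)
    from DERIV_chain[OF der[of "t - s" \<zeta>] this] that show ?thesis by (simp add: o_def)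
  qed
  have "continuous_on {0..t} (\<lambda>s. \<Sum>Z\<in>Pow A. F (t - s) (?c Z) * mean s (pattern A Z))"
  proof (intro continuous_on_sum continuous_on_mult)
    fix Z
    show "continuous_on {0..t} (\<lambda>s. F (t - s) (?c Z))"
      using derF by (intro continuous_at_imp_continuous_on ballI) (auto dest: DERIV_isCont)
    show "continuous_on {0..t} (\<lambda>s. mean s (pattern A Z))"
      by (rule continuous_on_subset[OF mean_continuous[OF A depends_on_pattern]]) auto
  qed
  then show "continuous_on {0..t} (\<lambda>s. mean s (F (t - s)))"
    by (subst continuous_on_cong[OF refl exp]) auto
  assume s: "0 \<le> s" "s \<le> t"
  have "((\<lambda>s. \<Sum>Z\<in>Pow A. F (t - s) (?c Z) * mean s (pattern A Z)) has_real_derivative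
      (\<Sum>Z\<in>Pow A. - F' (t - s) (?c Z) * mean s (pattern A Z) + mean s (exclusion_pregenerator p (pattern A Z)) * F (t - s) (?c Z))) (at s within {s..})"
    by (intro DERIV_sum DERIV_mult mean_right_derivative[OF A depends_on_pattern s(1)]
        has_field_derivative_at_within[OF derF[OF s]])
  also have "(\<Sum>Z\<in>Pow A. - F' (t - s) (?c Z) * mean s (pattern A Z) + mean s (exclusion_pregenerator p (pattern A Z)) * F (t - s) (?c Z))
      = mean s (exclusion_pregenerator p (F (t - s))) - mean s (F' (t - s))"
    unfolding mean_pattern_expansion[OF A F' s(1)] mean_pregenerator_pattern_expansion[OF A F s(1)]
    by (simp add: sum_subtractf mult.commute)
  finally show "((\<lambda>s. mean s (F (t - s))) has_real_derivative
       mean s (exclusion_pregenerator p (F (t - s))) - mean s (F' (t - s))) (at s within {s..})"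
    by (rule has_field_derivative_transform_within[where d = 1]) (use s exp in auto)
qed

end


section \<open>Product and linear observables\<close>

lemma prod_of_bool_expectation:
  fixes f :: "int \<Rightarrow> bool \<Rightarrow> real"
  assumes "finite J"
  shows "(\<integral>\<eta>. (\<Prod>z\<in>J. f z (\<eta> z)) \<partial>bernoulli_product \<rho>) = (\<Prod>z\<in>J. \<integral>b. f z b \<partial>measure_pmf (bernoulli_pmf (\<rho> z)))"
proof -
  let ?M = "\<lambda>x. measure_pmf (bernoulli_pmf (\<rho> x))"
  interpret product_prob_space ?M UNIV
    by unfold_locales
  have "(\<integral>\<eta>. (\<Prod>z\<in>J. f z (\<eta> z)) \<partial>Pi\<^sub>M UNIV ?M) = (\<integral>\<eta>. (\<Prod>z\<in>J. f z (restrict \<eta> J z)) \<partial>Pi\<^sub>M UNIV ?M)"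
    by (intro Bochner_Integration.integral_cong prod.cong) auto
  also have "\<dots> = (\<integral>\<eta>. (\<Prod>z\<in>J. f z (\<eta> z)) \<partial>distr (Pi\<^sub>M UNIV ?M) (Pi\<^sub>M J ?M) (\<lambda>x. restrict x J))"
    by (subst integral_distr) (auto intro!: borel_measurable_prod measurable_restrict_subset)
  also have "\<dots> = (\<integral>\<eta>. (\<Prod>z\<in>J. f z (\<eta> z)) \<partial>Pi\<^sub>M J ?M)"
    using assms by (subst distr_PiM_restrict_finite) auto
  also have "\<dots> = (\<Prod>z\<in>J. \<integral>b. f z b \<partial>?M z)"
    by (rule product_integral_prod[OF assms]) (auto intro!: integrable_measure_pmf_finite)
  finally show ?thesis by (simp add: bernoulli_product_def)
qed

definition pair_tail :: "int pmf \<Rightarrow> (int \<Rightarrow> real) \<Rightarrow> int \<times> int \<Rightarrow> real" where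
  "pair_tail p \<gamma> = (\<lambda>(x, y). pmf p (y - x) * \<gamma> x + pmf p (y - x) * \<gamma> y)"

text \<open>The price of restricting an observable dominated by \<open>\<gamma>\<close> to the
  window \<open>I\<close>: the weight of all pairs with at least one site outside.\<close>

definition tail_err :: "int pmf \<Rightarrow> (int \<Rightarrow> real) \<Rightarrow> int set \<Rightarrow> real" where
  "tail_err p \<gamma> I = (\<Sum>\<^sub>\<infinity>z\<in>-(I \<times> I). pair_tail p \<gamma> z)"

definition lin_obs :: "int set \<Rightarrow> (int \<Rightarrow> real) \<Rightarrow> config \<Rightarrow> real" where
  "lin_obs I f \<eta> = (\<Sum>x\<in>I. f x * of_bool (\<eta> x))"

text \<open>For \<open>g = 1\<close> this is the indicator that \<open>I\<close> is vacant.\<close>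

definition prod_obs :: "int set \<Rightarrow> (int \<Rightarrow> real) \<Rightarrow> config \<Rightarrow> real" where
  "prod_obs I g \<eta> = (\<Prod>x\<in>I. 1 - g x * of_bool (\<eta> x))"

lemma depends_on_lin_obs: "depends_on I (lin_obs I f)"
  by (auto simp: depends_on_def lin_obs_def intro!: sum.cong)

lemma depends_on_prod_obs: "depends_on I (prod_obs J g)" if "J \<subseteq> I"
  using that by (auto simp: depends_on_def prod_obs_def intro!: prod.cong)

lemma prod_obs_extend:
  assumes "finite K" "I \<subseteq> K"
  shows "prod_obs I g \<eta> = prod_obs K (\<lambda>x. if x \<in> I then g x else 0) \<eta>"
  unfolding prod_obs_def using assms by (intro prod.mono_neutral_cong_left) auto

lemma lin_obs_extend:
  assumes "finite K" "I \<subseteq> K"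
  shows "lin_obs I g \<eta> = lin_obs K (\<lambda>x. if x \<in> I then g x else 0) \<eta>"
  unfolding lin_obs_def using assms by (intro sum.mono_neutral_cong_left) auto

lemma prod_obs_nonneg:
  assumes "\<And>x. x \<in> J \<Longrightarrow> g x \<le> 1"
  shows "prod_obs J g \<zeta> \<ge> 0"
  unfolding prod_obs_def using assms by (intro prod_nonneg) (auto simp: of_bool_def)

lemma prod_obs_le_1:
  assumes "\<And>x. 0 \<le> g x" "\<And>x. g x \<le> 1"
  shows "prod_obs J g \<zeta> \<le> 1"
  unfolding prod_obs_def using assms by (intro prod_le_1) (auto simp: of_bool_def)

lemma has_sum_swap_pair:
  "(f has_sum S) UNIV \<longleftrightarrow> ((\<lambda>z. f (prod.swap z)) has_sum S) UNIV"
  by (rule has_sum_reindex_bij_witness[of _ prod.swap prod.swap]) auto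

lemma filterlim_int_squares:
  "filterlim (\<lambda>n. {- int n..int n} \<times> {- int n..int n}) (finite_subsets_at_top UNIV) sequentially"
  unfolding filterlim_finite_subsets_at_top
proof (intro allI impI)
  fix X :: "(int \<times> int) set" assume X: "finite X \<and> X \<subseteq> UNIV"
  define K where "K = nat (Max (insert 0 ((\<lambda>z. max \<bar>fst z\<bar> \<bar>snd z\<bar>) ` X)))"
  have "max \<bar>fst z\<bar> \<bar>snd z\<bar> \<le> int K" if "z \<in> X" for z
  proof -
    have "max \<bar>fst z\<bar> \<bar>snd z\<bar> \<le> Max (insert 0 ((\<lambda>z. max \<bar>fst z\<bar> \<bar>snd z\<bar>) ` X))"
      using X that by (intro Max_ge) auto
    also have "\<dots> \<le> int K" by (simp add: K_def)
    finally show ?thesis .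
  qed
  then have "X \<subseteq> {- int n..int n} \<times> {- int n..int n}" if "n \<ge> K" for n
    using that by (fastforce simp: abs_le_iff)
  then show "eventually (\<lambda>n. finite ({- int n..int n} \<times> {- int n..int n}) \<and> X \<subseteq> {- int n..int n} \<times> {- int n..int n} \<and> {- int n..int n} \<times> {- int n..int n} \<subseteq> UNIV) sequentially"
    by (auto simp: eventually_sequentially)
qed

lemma filterlim_int_intervals:
  "filterlim (\<lambda>n. {- int n..int n}) (finite_subsets_at_top UNIV) sequentially"
  unfolding filterlim_finite_subsets_at_top
proof (intro allI impI)
  fix X :: "int set" assume X: "finite X \<and> X \<subseteq> UNIV"
  define K where "K = nat (Max (insert 0 (abs ` X)))"
  have "\<bar>z\<bar> \<le> int K" if "z \<in> X" for z
  proof -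
    have "\<bar>z\<bar> \<le> Max (insert 0 (abs ` X))"
      using X that by (intro Max_ge) auto
    also have "\<dots> \<le> int K" by (simp add: K_def)
    finally show ?thesis .
  qed
  then have "X \<subseteq> {- int n..int n}" if "n \<ge> K" for n
    using that by (fastforce simp: abs_le_iff)
  then show "eventually (\<lambda>n. finite {- int n..int n} \<and> X \<subseteq> {- int n..int n} \<and> {- int n..int n} \<subseteq> UNIV) sequentially"
    by (auto simp: eventually_sequentially)
qed

lemma has_sum_int_intervals:
  fixes f :: "int \<Rightarrow> real"
  assumes "(f has_sum S) UNIV"
  shows "(\<lambda>n. \<Sum>x\<in>{- int n..int n}. f x) \<longlonglongrightarrow> S"
  using assms unfolding has_sum_def by (rule filterlim_compose[OF _ filterlim_int_intervals])

context symmetric_jumps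
begin

lemma pair_tail_has_sum:
  assumes "(\<gamma> has_sum G) UNIV" "\<And>x. \<gamma> x \<ge> 0"
  shows "(pair_tail p \<gamma> has_sum (G + G)) UNIV"
  using has_sum_add[OF pair_has_sum_fst[OF assms, of p] pair_has_sum_snd[OF assms]]
  by (simp add: pair_tail_def case_prod_unfold)

lemma tail_err_has_sum:
  assumes "(\<gamma> has_sum G) UNIV" "\<And>x. \<gamma> x \<ge> 0"
  shows "(pair_tail p \<gamma> has_sum tail_err p \<gamma> I) (-(I \<times> I))"
  unfolding tail_err_def
  using summable_on_subset_banach[OF has_sum_imp_summable[OF pair_tail_has_sum[OF assms]], of "-(I \<times> I)"] by simp

lemma pair_tail_nonneg: "(\<And>x. \<gamma> x \<ge> 0) \<Longrightarrow> pair_tail p \<gamma> z \<ge> 0"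
  by (cases z) (simp add: pair_tail_def)

lemma tail_err_nonneg: "(\<And>x. \<gamma> x \<ge> 0) \<Longrightarrow> tail_err p \<gamma> I \<ge> 0"
  unfolding tail_err_def by (intro infsum_nonneg pair_tail_nonneg)

lemma tail_err_tendsto:
  assumes "(\<gamma> has_sum G) UNIV" "\<And>x. \<gamma> x \<ge> 0"
  shows "(\<lambda>n. tail_err p \<gamma> {- int n..int n}) \<longlonglongrightarrow> 0"
proof -
  let ?I = "\<lambda>n. {- int n..int n}"
  have total: "(pair_tail p \<gamma> has_sum (G + G)) UNIV" by (rule pair_tail_has_sum[OF assms])
  have eq: "tail_err p \<gamma> (?I n) = (G + G) - sum (pair_tail p \<gamma>) (?I n \<times> ?I n)" for n
  proof -
    have "(pair_tail p \<gamma> has_sum (sum (pair_tail p \<gamma>) (?I n \<times> ?I n) + tail_err p \<gamma> (?I n))) (?I n \<times> ?I n \<union> -(?I n \<times> ?I n))"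
      by (intro has_sum_Un_disjoint has_sum_finite tail_err_has_sum[OF assms]) auto
    then have "(pair_tail p \<gamma> has_sum (sum (pair_tail p \<gamma>) (?I n \<times> ?I n) + tail_err p \<gamma> (?I n))) UNIV" by simp
    from has_sum_unique[OF this total] show ?thesis by simp
  qed
  have "filterlim (\<lambda>n. ?I n \<times> ?I n) (finite_subsets_at_top UNIV) sequentially"
    by (rule filterlim_int_squares)
  with total have "(\<lambda>n. sum (pair_tail p \<gamma>) (?I n \<times> ?I n)) \<longlonglongrightarrow> G + G"
    unfolding has_sum_def by (rule filterlim_compose)
  from tendsto_diff[OF tendsto_const[of "G + G"] this] show ?thesis by (simp add: eq)
qed

text \<open>The part of \<open>a - b\<close> that is antisymmetric under exchanging the two sites sums to zero; only
  its symmetrisation \<open>- q / 2\<close> and the pairs leaving the window \<open>I\<close> survive.\<close>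

lemma pair_compare:
  fixes a b b' q :: "int \<times> int \<Rightarrow> real"
  assumes \<gamma>: "(\<gamma> has_sum G) UNIV" "\<And>x. \<gamma> x \<ge> 0"
    and a: "(a has_sum A) UNIV" and b: "(b has_sum B) UNIV"
    and b'_in: "\<And>z. z \<in> I \<times> I \<Longrightarrow> b' z = b z"
    and b'_out: "\<And>z. z \<notin> I \<times> I \<Longrightarrow> \<bar>b' z - b z\<bar> \<le> C * pair_tail p \<gamma> z"
    and sym: "\<And>z. (a z - b' z) + (a (prod.swap z) - b' (prod.swap z)) = - q z"
  obtains Q where "(q has_sum Q) UNIV" "\<bar>A - B + Q / 2\<bar> \<le> C * tail_err p \<gamma> I"
proof -
  have te: "((\<lambda>z. C * pair_tail p \<gamma> z) has_sum (C * tail_err p \<gamma> I)) (-(I \<times> I))"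
    by (intro has_sum_cmult_right tail_err_has_sum[OF \<gamma>])
  have "(\<lambda>z. b' z - b z) summable_on (-(I \<times> I))"
    by (rule summable_on_of_abs_le[OF has_sum_imp_summable[OF te]]) (use b'_out in auto)
  then obtain D where D: "((\<lambda>z. b' z - b z) has_sum D) (-(I \<times> I))" by (auto simp: summable_on_def)
  have D_bound: "\<bar>D\<bar> \<le> C * tail_err p \<gamma> I"
    using norm_infsum_le[OF D te] b'_out by simp
  have D': "((\<lambda>z. b' z - b z) has_sum D) UNIV"
  proof -
    have "((\<lambda>z. b' z - b z) has_sum D) (-(I \<times> I)) \<longleftrightarrow> ((\<lambda>z. b' z - b z) has_sum D) UNIV"
      by (rule has_sum_cong_neutral) (auto simp: b'_in)
    with D show ?thesis by simp
  qed
  have k: "((\<lambda>z. a z + (- b z + - (b' z - b z))) has_sum (A + (- B + - D))) UNIV"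
    by (intro has_sum_add has_sum_uminusI a b D')
  then have k1: "((\<lambda>z. a z - b' z) has_sum (A - B - D)) UNIV" by (simp add: algebra_simps)
  then have k2: "((\<lambda>z. a (prod.swap z) - b' (prod.swap z)) has_sum (A - B - D)) UNIV"
    by (subst (asm) has_sum_swap_pair)
  from has_sum_add[OF k1 k2] have "((\<lambda>z. - q z) has_sum (2 * (A - B - D))) UNIV"
    unfolding sym mult_2 .
  from has_sum_uminusI[OF this] have "(q has_sum (- (2 * (A - B - D)))) UNIV" by simp
  moreover have "\<bar>A - B + (- (2 * (A - B - D))) / 2\<bar> \<le> C * tail_err p \<gamma> I"
    using D_bound by (simp add: field_simps)
  ultimately show thesis using that by blast
qed

section \<open>The generator on linear and on product observables\<close>

lemma inner_sum_has_sum: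
  assumes I: "finite I" and g: "\<And>x. x \<in> I \<Longrightarrow> ((\<lambda>y. pmf p (y - x) * d x y) has_sum D x) UNIV"
    and bound: "\<And>x y. x \<in> I \<Longrightarrow> \<bar>d x y * c x\<bar> \<le> B"
  shows "((\<lambda>(x, y). of_bool (x \<in> I) * pmf p (y - x) * d x y * c x) has_sum (\<Sum>x\<in>I. D x * c x)) UNIV"
proof -
  have inner: "((\<lambda>y. case (x, y) of (x, y) \<Rightarrow> of_bool (x \<in> I) * pmf p (y - x) * d x y * c x) has_sum (of_bool (x \<in> I) * (D x * c x))) UNIV" for x
    using has_sum_cmult_left[OF g[of x], of "c x"] by (cases "x \<in> I") (auto simp: mult_ac)
  have outer: "((\<lambda>x. of_bool (x \<in> I) * (D x * c x)) has_sum (\<Sum>x\<in>I. D x * c x)) UNIV"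
    by (rule has_sum_finite_neutralI[OF I]) auto
  have w: "pair_weight p I summable_on UNIV" by (rule pair_weight_summable[OF I])
  have "(\<lambda>(x, y). of_bool (x \<in> I) * pmf p (y - x) * d x y * c x) summable_on UNIV"
  proof (rule summable_on_of_abs_le[OF summable_on_cmult_right[OF w, of "\<bar>B\<bar>"]])
    fix z :: "int \<times> int"
    obtain x y where z: "z = (x, y)" by (cases z)
    show "\<bar>case z of (x, y) \<Rightarrow> of_bool (x \<in> I) * pmf p (y - x) * d x y * c x\<bar> \<le> \<bar>B\<bar> * pair_weight p I z"
    proof (cases "x \<in> I")
      case True
      have "pmf p (y - x) * \<bar>d x y * c x\<bar> \<le> pmf p (y - x) * \<bar>B\<bar>"
        using bound[OF True, of y] by (intro mult_left_mono) auto
      also have "pmf p (y - x) * \<bar>B\<bar> \<le> pair_weight p I z * \<bar>B\<bar>"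
        using True by (intro mult_right_mono) (simp_all add: z pair_weight_def)
      finally show ?thesis using True by (simp add: z abs_mult mult_ac)
    qed (simp add: z pair_weight_def)
  qed
  then have "(\<lambda>(x, y). of_bool (x \<in> I) * pmf p (y - x) * d x y * c x) summable_on (UNIV \<times> UNIV)" by simp
  from has_sum_SigmaI[OF inner outer this] show ?thesis by simp
qed

text \<open>Exclusion is invisible to linear observables: the product
  \<open>\<eta> x * \<eta> y\<close> multiplies \<open>f y - f x\<close>, which is antisymmetric, so
  its contribution cancels when \<open>x\<close> and \<open>y\<close> are exchanged. What remains is
  the generator of a single walk, hence \<open>pair_compare\<close> applies with
  \<open>q = 0\<close>.\<close>

lemma lin_obs_generator:
  assumes I: "finite I" and \<gamma>: "(\<gamma> has_sum G) UNIV" and f: "\<And>x. \<bar>f x\<bar> \<le> \<gamma> x"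
    and f': "\<And>x. x \<in> I \<Longrightarrow> ((\<lambda>y. pmf p (y - x) * (f y - f x)) has_sum f' x) UNIV"
  shows "\<bar>exclusion_pregenerator p (lin_obs I f) \<eta> - lin_obs I f' \<eta>\<bar> \<le> tail_err p \<gamma> I"
proof -
  define ft where "ft = (\<lambda>x. if x \<in> I then f x else 0)"
  define e where "e = (\<lambda>x. of_bool (\<eta> x) :: real)"
  have g0: "\<gamma> x \<ge> 0" for x using f[of x] by linarith
  have e01: "0 \<le> e x" "e x \<le> 1" for x by (auto simp: e_def)
  have fb: "\<bar>f x\<bar> \<le> G" for x
    using f[of x] finite_sum_le_has_sum[OF \<gamma>, of "{x}"] g0 by force
  have a: "(gen_term p (lin_obs I f) \<eta> has_sum exclusion_pregenerator p (lin_obs I f) \<eta>) UNIV"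
    by (rule gen_term_has_sum[OF I depends_on_lin_obs])
  have b: "((\<lambda>(x, y). of_bool (x \<in> I) * pmf p (y - x) * (f y - f x) * e x) has_sum lin_obs I f' \<eta>) UNIV"
  proof -
    have "\<bar>(f y - f x) * e x\<bar> \<le> 2 * G" for x y
    proof -
      have "\<bar>f y - f x\<bar> \<le> 2 * G" using fb[of x] fb[of y] by linarith
      then have "\<bar>f y - f x\<bar> * \<bar>e x\<bar> \<le> 2 * G * 1" using e01[of x] by (intro mult_mono) auto
      then show ?thesis by (simp add: abs_mult)
    qed
    from inner_sum_has_sum[OF I f' this] show ?thesis by (simp add: lin_obs_def e_def)
  qed
  have a_eq: "gen_term p (lin_obs I f) \<eta> (x, y) = pmf p (y - x) * e x * (1 - e y) * (ft y - ft x)" for x y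
  proof (cases "\<eta> x \<and> \<not> \<eta> y")
    case True
    then have xy: "x \<noteq> y" by auto
    let ?K = "insert x (insert y I)"
    have ext: "lin_obs I f \<zeta> = ft x * of_bool (\<zeta> x) + ft y * of_bool (\<zeta> y) + (\<Sum>z\<in>I - {x, y}. ft z * of_bool (\<zeta> z))" for \<zeta>
    proof -
      have "lin_obs I f \<zeta> = (\<Sum>z\<in>?K. ft z * of_bool (\<zeta> z))"
        using lin_obs_extend[of ?K I f \<zeta>] I by (auto simp: lin_obs_def ft_def)
      also have "\<dots> = (\<Sum>z\<in>{x, y}. ft z * of_bool (\<zeta> z)) + (\<Sum>z\<in>?K - {x, y}. ft z * of_bool (\<zeta> z))"
        using I by (subst sum.subset_diff[of "{x, y}" ?K]) auto
      also have "?K - {x, y} = I - {x, y}" by auto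
      finally show ?thesis using xy by simp
    qed
    have "(\<Sum>z\<in>I - {x, y}. ft z * of_bool (exchange \<eta> x y z)) = (\<Sum>z\<in>I - {x, y}. ft z * of_bool (\<eta> z))"
      by (intro sum.cong) (auto simp: exchange_def)
    then show ?thesis
      using True xy by (simp add: gen_term_def e_def ext[of \<eta>] ext[of "exchange \<eta> x y"]) (simp add: exchange_def)
  next
    case False
    then show ?thesis by (auto simp: gen_term_def e_def)
  qed
  obtain Q where Q: "((\<lambda>_. 0) has_sum Q) (UNIV :: (int \<times> int) set)"
      "\<bar>exclusion_pregenerator p (lin_obs I f) \<eta> - lin_obs I f' \<eta> + Q / 2\<bar> \<le> 1 * tail_err p \<gamma> I"
  proof (rule pair_compare[OF \<gamma> g0 a b, where q = "\<lambda>_. 0" and C = 1 and I = I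
        and b' = "\<lambda>(x, y). pmf p (y - x) * e x * (ft y - ft x)"])
    fix z :: "int \<times> int"
    obtain x y where z: "z = (x, y)" by (cases z)
    show "(case z of (x, y) \<Rightarrow> pmf p (y - x) * e x * (ft y - ft x)) = (case z of (x, y) \<Rightarrow> of_bool (x \<in> I) * pmf p (y - x) * (f y - f x) * e x)"
      if "z \<in> I \<times> I" using that by (simp add: z ft_def)
    show "\<bar>(case z of (x, y) \<Rightarrow> pmf p (y - x) * e x * (ft y - ft x)) - (case z of (x, y) \<Rightarrow> of_bool (x \<in> I) * pmf p (y - x) * (f y - f x) * e x)\<bar> \<le> 1 * pair_tail p \<gamma> z"
      if "z \<notin> I \<times> I"
    proof -
      have "(case z of (x, y) \<Rightarrow> pmf p (y - x) * e x * (ft y - ft x)) - (case z of (x, y) \<Rightarrow> of_bool (x \<in> I) * pmf p (y - x) * (f y - f x) * e x)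
         = pmf p (y - x) * (e x * (if x \<in> I then - f y else ft y))"
        using that by (simp add: z ft_def algebra_simps)
      moreover have "\<bar>pmf p (y - x) * (e x * (if x \<in> I then - f y else ft y))\<bar> \<le> pmf p (y - x) * (1 * \<gamma> y)"
        unfolding abs_mult using e01[of x] f[of y] g0[of y] by (intro mult_mono) (auto simp: ft_def)
      moreover have "0 \<le> pmf p (y - x) * \<gamma> x" using g0 by simp
      ultimately show ?thesis by (simp add: z pair_tail_def)
    qed
    show "gen_term p (lin_obs I f) \<eta> z - (case z of (x, y) \<Rightarrow> pmf p (y - x) * e x * (ft y - ft x))
       + (gen_term p (lin_obs I f) \<eta> (prod.swap z) - (case prod.swap z of (x, y) \<Rightarrow> pmf p (y - x) * e x * (ft y - ft x))) = - 0"
      by (simp add: z a_eq pmf_diff_commute[of x y] algebra_simps)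
  qed
  have "Q = 0" using has_sum_unique[OF Q(1) has_sum_0] by auto
  with Q(2) show ?thesis by simp
qed

text \<open>When \<open>g\<close> solves the backward equation, the sum over \<open>g'\<close> is
  the time derivative of the product. The two-site expansion leaves the squared gradient on doubly
  occupied pairs, with a definite sign as long as the remaining product is nonnegative. Since
  \<open>Q\<close> runs over ordered pairs, it enters with the factor 1/2.\<close>

lemma prod_obs_generator:
  assumes I: "finite I" and \<gamma>: "(\<gamma> has_sum G) UNIV" and g: "\<And>x. \<bar>g x\<bar> \<le> \<gamma> x"
    and g': "\<And>x. x \<in> I \<Longrightarrow> ((\<lambda>y. pmf p (y - x) * (g y - g x)) has_sum g' x) UNIV"
    and C: "\<And>J. J \<subseteq> I \<Longrightarrow> \<bar>prod_obs J g \<eta>\<bar> \<le> C"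
  obtains Q where "((\<lambda>(x, y). pmf p (y - x) * of_bool (\<eta> x) * of_bool (\<eta> y)
        * ((if x \<in> I then g x else 0) - (if y \<in> I then g y else 0))\<^sup>2 * prod_obs (I - {x, y}) g \<eta>) has_sum Q) UNIV"
    "\<bar>exclusion_pregenerator p (prod_obs I g) \<eta> - (\<Sum>x\<in>I. - g' x * of_bool (\<eta> x) * prod_obs (I - {x}) g \<eta>) + Q / 2\<bar> \<le> C * tail_err p \<gamma> I"
proof -
  define gt where "gt = (\<lambda>x. if x \<in> I then g x else 0)"
  define e where "e = (\<lambda>x. of_bool (\<eta> x) :: real)"
  define R where "R = (\<lambda>J. prod_obs (I - J) g \<eta>)"
  have g0: "\<gamma> x \<ge> 0" for x using g[of x] by linarith
  have C0: "C \<ge> 0" using C[of "{}"] by (simp add: prod_obs_def)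
  have e01: "0 \<le> e x" "e x \<le> 1" "e x * e x = e x" for x by (auto simp: e_def)
  have gb: "\<bar>g x\<bar> \<le> G" for x
    using g[of x] finite_sum_le_has_sum[OF \<gamma>, of "{x}"] g0 by force
  have Rb: "\<bar>R J\<bar> \<le> C" for J unfolding R_def by (rule C) auto
  have a: "(gen_term p (prod_obs I g) \<eta> has_sum exclusion_pregenerator p (prod_obs I g) \<eta>) UNIV"
    by (rule gen_term_has_sum[OF I depends_on_prod_obs[OF order_refl]])
  have b: "((\<lambda>(x, y). of_bool (x \<in> I) * pmf p (y - x) * (g y - g x) * (- e x * R {x})) has_sum
      (\<Sum>x\<in>I. - g' x * of_bool (\<eta> x) * prod_obs (I - {x}) g \<eta>)) UNIV"
  proof -
    have "\<bar>(g y - g x) * (- e x * R {x})\<bar> \<le> 2 * G * (1 * C)" for x y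
    proof -
      have "\<bar>g y - g x\<bar> \<le> 2 * G" using gb[of x] gb[of y] by linarith
      then show ?thesis unfolding abs_mult using e01[of x] Rb[of "{x}"] by (intro mult_mono) auto
    qed
    from inner_sum_has_sum[OF I g' this] show ?thesis by (simp add: e_def R_def mult_ac)
  qed
  have R_split: "R {x} = R {x, y} * (1 - gt y * e y)" if "x \<noteq> y" for x y
  proof (cases "y \<in> I")
    case True
    have "I - {x} = insert y (I - {x, y})" using True that by auto
    then show ?thesis using I True by (simp add: R_def prod_obs_def gt_def e_def)
  next
    case False
    then have "I - {x} = I - {x, y}" by auto
    then show ?thesis using False by (simp add: R_def gt_def)
  qed
  have a_eq: "gen_term p (prod_obs I g) \<eta> (x, y) = pmf p (y - x) * e x * (1 - e y) * ((gt x - gt y) * R {x, y})" for x y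
  proof (cases "\<eta> x \<and> \<not> \<eta> y")
    case True
    then have xy: "x \<noteq> y" by auto
    let ?K = "insert x (insert y I)"
    have ext: "prod_obs I g \<zeta> = (1 - gt x * of_bool (\<zeta> x)) * (1 - gt y * of_bool (\<zeta> y)) * prod_obs (I - {x, y}) g \<zeta>" for \<zeta>
    proof -
      have "prod_obs I g \<zeta> = (\<Prod>z\<in>?K. 1 - gt z * of_bool (\<zeta> z))"
        using prod_obs_extend[of ?K I g \<zeta>] I by (auto simp: prod_obs_def gt_def)
      also have "\<dots> = (\<Prod>z\<in>?K - {x, y}. 1 - gt z * of_bool (\<zeta> z)) * (\<Prod>z\<in>{x, y}. 1 - gt z * of_bool (\<zeta> z))"
        using I by (subst prod.subset_diff[of "{x, y}" ?K]) auto
      also have "?K - {x, y} = I - {x, y}" by auto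
      also have "(\<Prod>z\<in>I - {x, y}. 1 - gt z * of_bool (\<zeta> z)) = prod_obs (I - {x, y}) g \<zeta>"
        unfolding prod_obs_def by (intro prod.cong) (auto simp: gt_def)
      finally show ?thesis using xy by simp
    qed
    have "prod_obs (I - {x, y}) g (exchange \<eta> x y) = prod_obs (I - {x, y}) g \<eta>"
      unfolding prod_obs_def by (intro prod.cong) (auto simp: exchange_def)
    then show ?thesis
      using True xy by (simp add: gen_term_def e_def ext[of \<eta>] ext[of "exchange \<eta> x y"] R_def) (simp add: exchange_def algebra_simps)
  next
    case False
    then show ?thesis by (auto simp: gen_term_def e_def)
  qed
  obtain Q where Q: "((\<lambda>(x, y). pmf p (y - x) * e x * e y * (gt x - gt y)\<^sup>2 * R {x, y}) has_sum Q) UNIV"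
      "\<bar>exclusion_pregenerator p (prod_obs I g) \<eta> - (\<Sum>x\<in>I. - g' x * of_bool (\<eta> x) * prod_obs (I - {x}) g \<eta>) + Q / 2\<bar> \<le> C * tail_err p \<gamma> I"
  proof (rule pair_compare[OF \<gamma> g0 a b, where q = "\<lambda>(x, y). pmf p (y - x) * e x * e y * (gt x - gt y)\<^sup>2 * R {x, y}" and C = C and I = I
        and b' = "\<lambda>(x, y). pmf p (y - x) * (gt y - gt x) * (- e x * R {x})"])
    fix z :: "int \<times> int"
    obtain x y where z: "z = (x, y)" by (cases z)
    show "(case z of (x, y) \<Rightarrow> pmf p (y - x) * (gt y - gt x) * (- e x * R {x})) = (case z of (x, y) \<Rightarrow> of_bool (x \<in> I) * pmf p (y - x) * (g y - g x) * (- e x * R {x}))"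
      if "z \<in> I \<times> I" using that by (simp add: z gt_def)
    show "\<bar>(case z of (x, y) \<Rightarrow> pmf p (y - x) * (gt y - gt x) * (- e x * R {x})) - (case z of (x, y) \<Rightarrow> of_bool (x \<in> I) * pmf p (y - x) * (g y - g x) * (- e x * R {x}))\<bar> \<le> C * pair_tail p \<gamma> z"
      if "z \<notin> I \<times> I"
    proof -
      have "(case z of (x, y) \<Rightarrow> pmf p (y - x) * (gt y - gt x) * (- e x * R {x})) - (case z of (x, y) \<Rightarrow> of_bool (x \<in> I) * pmf p (y - x) * (g y - g x) * (- e x * R {x}))
         = pmf p (y - x) * ((e x * R {x}) * (if x \<in> I then g y else - gt y))"
        using that by (simp add: z gt_def algebra_simps)
      moreover have "\<bar>pmf p (y - x) * ((e x * R {x}) * (if x \<in> I then g y else - gt y))\<bar> \<le> pmf p (y - x) * ((1 * C) * \<gamma> y)"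
        unfolding abs_mult using e01[of x] g[of y] g0[of y] Rb[of "{x}"] C0 by (intro mult_mono) (auto simp: gt_def)
      moreover have "0 \<le> C * (pmf p (y - x) * \<gamma> x)" using g0 C0 by simp
      ultimately show ?thesis by (simp add: z pair_tail_def ring_distribs mult_ac)
    qed
    show "gen_term p (prod_obs I g) \<eta> z - (case z of (x, y) \<Rightarrow> pmf p (y - x) * (gt y - gt x) * (- e x * R {x}))
       + (gen_term p (prod_obs I g) \<eta> (prod.swap z) - (case prod.swap z of (x, y) \<Rightarrow> pmf p (y - x) * (gt y - gt x) * (- e x * R {x})))
       = - (case z of (x, y) \<Rightarrow> pmf p (y - x) * e x * e y * (gt x - gt y)\<^sup>2 * R {x, y})"
    proof (cases "x = y")
      case True
      then show ?thesis by (simp add: z a_eq)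
    next
      case False
      have "R {y} = R {x, y} * (1 - gt x * e x)" using R_split[of y x] False by (simp add: insert_commute)
      \<comment> \<open>A polynomial identity modulo \<open>e x * e x = e x\<close>, verified on the
        four possible occupations of the two sites.\<close>
      have poly: "P * ex * (1 - ey) * ((gx - gy) * r) - P * (gy - gx) * (- ex * (r * (1 - gy * ey)))
          + (P * ey * (1 - ex) * ((gy - gx) * r) - P * (gx - gy) * (- ey * (r * (1 - gx * ex))))
          = - (P * ex * ey * (gx - gy)\<^sup>2 * r)"
        if "ex = 0 \<or> ex = 1" "ey = 0 \<or> ey = 1" for P ex ey gx gy r :: real
        using that by (elim disjE) (simp_all add: power2_eq_square algebra_simps)
      have "e x = 0 \<or> e x = 1" "e y = 0 \<or> e y = 1" by (auto simp: e_def)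
      from poly[OF this, of "pmf p (y - x)" "gt x" "gt y" "R {x, y}"] show ?thesis
        unfolding z prod.swap_def fst_conv snd_conv case_prod_conv a_eq R_split[OF False] \<open>R {y} = _\<close>
          pmf_diff_commute[of x y] insert_commute[of y x] .
    qed
  qed
  show thesis
    by (rule that[of Q]) (use Q in \<open>simp_all add: e_def gt_def R_def\<close>)
qed

end


section \<open>Duality inequalities\<close>

lemma growth_of_right_derivative:
  fixes f :: "real \<Rightarrow> real"
  assumes "0 \<le> t" "continuous_on {0..t} f"
    and "\<And>s. 0 \<le> s \<Longrightarrow> s < t \<Longrightarrow> \<exists>D. D \<le> c \<and> (f has_real_derivative D) (at s within {s..})"
  shows "f t \<le> f 0 + c * t"
proof -
  have "c * 0 - f 0 \<le> c * t - f t"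
  proof (rule mono_of_right_derivative[OF assms(1)])
    show "continuous_on {0..t} (\<lambda>s. c * s - f s)" by (intro continuous_intros assms(2))
    fix s assume "0 \<le> s" "s < t"
    from assms(3)[OF this] obtain D where D: "D \<le> c" "(f has_real_derivative D) (at s within {s..})" by blast
    have "((\<lambda>s. c * s - f s) has_real_derivative (c * 1 - D)) (at s within {s..})"
      by (intro DERIV_diff DERIV_cmult DERIV_ident D(2))
    then show "\<exists>D\<ge>0. ((\<lambda>s. c * s - f s) has_real_derivative D) (at s within {s..})"
      using D(1) by (intro exI[of _ "c * 1 - D"]) auto
  qed
  then show ?thesis by simp
qed

lemma prod_has_real_derivative:
  fixes f :: "'i \<Rightarrow> real \<Rightarrow> real"
  assumes "finite I" "\<And>i. i \<in> I \<Longrightarrow> (f i has_real_derivative f' i) (at x)"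
  shows "((\<lambda>x. \<Prod>i\<in>I. f i x) has_real_derivative (\<Sum>i\<in>I. f' i * (\<Prod>j\<in>I - {i}. f j x))) (at x)"
  using assms
proof (induction I rule: finite_induct)
  case (insert a I)
  have "(\<Sum>i\<in>I. f' i * (\<Prod>j\<in>insert a I - {i}. f j x)) = (\<Sum>i\<in>I. f' i * (\<Prod>j\<in>I - {i}. f j x)) * f a x"
    unfolding sum_distrib_right
  proof (rule sum.cong[OF refl])
    fix i assume "i \<in> I"
    then have "insert a I - {i} = insert a (I - {i})" using insert.hyps by auto
    then show "f' i * (\<Prod>j\<in>insert a I - {i}. f j x) = f' i * (\<Prod>j\<in>I - {i}. f j x) * f a x"
      using insert.hyps by simp
  qed
  moreover have "insert a I - {a} = I" using insert.hyps by auto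
  ultimately have "(\<Sum>i\<in>insert a I. f' i * (\<Prod>j\<in>insert a I - {i}. f j x))
      = f' a * (\<Prod>j\<in>I. f j x) + (\<Sum>i\<in>I. f' i * (\<Prod>j\<in>I - {i}. f j x)) * f a x"
    using insert.hyps by simp
  moreover have "((\<lambda>x. f a x * (\<Prod>i\<in>I. f i x)) has_real_derivative
      f' a * (\<Prod>j\<in>I. f j x) + (\<Sum>i\<in>I. f' i * (\<Prod>j\<in>I - {i}. f j x)) * f a x) (at x)"
    by (intro DERIV_mult insert.IH) (use insert.prems in auto)
  ultimately show ?case using insert.hyps by simp
qed simp

text \<open>From \<open>ln (1 - q) \<ge> - q - 2 * q\<^sup>2\<close> and
  \<open>q \<le> \<tau>\<close>. This is the origin of the factor \<open>1 + 2 * \<tau>\<close> in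
  the lower bounds.\<close>

lemma one_minus_ge_exp:
  fixes q \<tau> :: real
  assumes "0 \<le> q" "q \<le> \<tau>" "\<tau> \<le> 1 / 2"
  shows "exp (- ((1 + 2 * \<tau>) * q)) \<le> 1 - q"
proof -
  have "- q - 2 * q\<^sup>2 \<le> ln (1 - q)"
    using assms by (intro ln_one_minus_pos_lower_bound) auto
  moreover have "2 * q\<^sup>2 \<le> 2 * \<tau> * q"
    using assms by (simp add: power2_eq_square mult_right_mono)
  ultimately have "- ((1 + 2 * \<tau>) * q) \<le> ln (1 - q)" by (simp add: algebra_simps)
  then have "exp (- ((1 + 2 * \<tau>) * q)) \<le> exp (ln (1 - q))" by simp
  then show ?thesis using assms by simp
qed

text \<open>The expectation of \<open>h\<close>, set to 0 off \<open>A\<close>, at time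
  \<open>r\<close> for the walk started in \<open>x\<close>: the solution of the backward heat
  equation with this initial value. With \<open>h = 1\<close> and \<open>A\<close> a window beyond
  \<open>N\<close> it approximates the \<open>g\<close> of the overview.\<close>

definition walk_avg :: "int pmf \<Rightarrow> int set \<Rightarrow> (int \<Rightarrow> real) \<Rightarrow> real \<Rightarrow> int \<Rightarrow> real" where
  "walk_avg p A h r x = (\<Sum>a\<in>A. h a * walk_prob p r (a - x))"

definition walk_avg_deriv :: "int pmf \<Rightarrow> int set \<Rightarrow> (int \<Rightarrow> real) \<Rightarrow> real \<Rightarrow> int \<Rightarrow> real" where
  "walk_avg_deriv p A h r x = (\<Sum>a\<in>A. h a * (rw_jump p (walk_prob p r) (a - x) - walk_prob p r (a - x)))"

lemma walk_avg_has_derivative: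
  assumes "r \<ge> 0"
  shows "((\<lambda>r. walk_avg p A h r x) has_real_derivative walk_avg_deriv p A h r x) (at r)"
  unfolding walk_avg_def walk_avg_deriv_def
  by (intro DERIV_sum DERIV_cmult walk_prob_deriv assms)

lemma walk_avg_equation:
  assumes "finite A" "r \<ge> 0"
  shows "((\<lambda>y. pmf p (y - x) * (walk_avg p A h r y - walk_avg p A h r x)) has_sum walk_avg_deriv p A h r x) UNIV"
proof -
  have 1: "((\<lambda>y. pmf p (y - x) * walk_prob p r (a - y)) has_sum rw_jump p (walk_prob p r) (a - x)) UNIV" for a
    using has_sum_shift_int[of "\<lambda>k. pmf p k * walk_prob p r (a - x - k)" x]
      rw_jump_has_sum[of "walk_prob p r" 1 p "a - x"] assms(2)
    by (simp add: walk_prob_nonneg walk_prob_le_1)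
  have 2: "((\<lambda>y. pmf p (y - x) * walk_prob p r (a - x)) has_sum walk_prob p r (a - x)) UNIV" for a
    using has_sum_cmult_left[OF has_sum_shift_int[of "pmf p" x 1, THEN iffD2, OF pmf_has_sum_1], of "walk_prob p r (a - x)"] by simp
  have "((\<lambda>y. \<Sum>a\<in>A. h a * (pmf p (y - x) * walk_prob p r (a - y) + - (pmf p (y - x) * walk_prob p r (a - x))))
      has_sum (\<Sum>a\<in>A. h a * (rw_jump p (walk_prob p r) (a - x) + - walk_prob p r (a - x)))) UNIV"
    by (intro has_sum_finite_sum assms(1) has_sum_cmult_right has_sum_add has_sum_uminusI 1 2)
  moreover have "(\<Sum>a\<in>A. h a * (pmf p (y - x) * walk_prob p r (a - y) + - (pmf p (y - x) * walk_prob p r (a - x))))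
     = pmf p (y - x) * (walk_avg p A h r y - walk_avg p A h r x)" for y
    unfolding walk_avg_def sum_subtractf[symmetric] sum_distrib_left
    by (intro sum.cong) (auto simp: algebra_simps)
  ultimately show ?thesis by (simp add: walk_avg_deriv_def)
qed

lemma walk_avg_0: "finite A \<Longrightarrow> walk_avg p A h 0 x = (if x \<in> A then h x else 0)"
  by (simp add: walk_avg_def walk_prob_0 of_bool_def if_distrib sum.delta' cong: if_cong)

lemma walk_avg_bound:
  assumes "0 \<le> r" "r \<le> t"
  shows "\<bar>walk_avg p A h r x\<bar> \<le> exp t * walk_avg p A (\<lambda>a. \<bar>h a\<bar>) t x"
proof -
  have "\<bar>walk_avg p A h r x\<bar> \<le> (\<Sum>a\<in>A. \<bar>h a * walk_prob p r (a - x)\<bar>)"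
    unfolding walk_avg_def by (rule sum_abs)
  also have "\<dots> \<le> (\<Sum>a\<in>A. \<bar>h a\<bar> * (exp t * walk_prob p t (a - x)))"
    using assms walk_prob_mono_time[OF assms]
    by (intro sum_mono) (simp add: abs_mult walk_prob_nonneg mult_left_mono)
  finally show ?thesis by (simp add: walk_avg_def sum_distrib_left mult_ac)
qed

lemma walk_avg_has_sum:
  assumes "finite A" "t \<ge> 0"
  shows "(walk_avg p A h t has_sum (\<Sum>a\<in>A. h a)) UNIV"
proof -
  have "((\<lambda>x. h a * walk_prob p t (a - x)) has_sum h a * 1) UNIV" for a
    by (intro has_sum_cmult_right has_sum_reflect_int[THEN iffD2] walk_prob_has_sum_1 assms)
  then have "((\<lambda>x. \<Sum>a\<in>A. h a * walk_prob p t (a - x)) has_sum (\<Sum>a\<in>A. h a)) UNIV"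
    by (intro has_sum_finite_sum assms) simp
  then show ?thesis by (simp add: walk_avg_def[abs_def])
qed

lemma walk_avg_le_1:
  assumes "finite A" "r \<ge> 0" "\<And>a. a \<in> A \<Longrightarrow> h a \<le> 1"
  shows "walk_avg p A h r x \<le> 1"
proof -
  have "walk_avg p A h r x \<le> (\<Sum>a\<in>A. 1 * walk_prob p r (a - x))"
    unfolding walk_avg_def using assms by (intro sum_mono mult_right_mono walk_prob_nonneg) auto
  also have "\<dots> = (\<Sum>b\<in>(\<lambda>a. a - x) ` A. walk_prob p r b)"
    by (subst sum.reindex) (auto simp: inj_on_def)
  also have "\<dots> \<le> 1"
    using assms by (intro finite_sum_le_has_sum[OF walk_prob_has_sum_1]) (auto simp: walk_prob_nonneg)
  finally show ?thesis .
qed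

lemma walk_avg_nonneg: "r \<ge> 0 \<Longrightarrow> (\<And>a. a \<in> A \<Longrightarrow> h a \<ge> 0) \<Longrightarrow> walk_avg p A h r x \<ge> 0"
  unfolding walk_avg_def by (intro sum_nonneg mult_nonneg_nonneg walk_prob_nonneg)

locale exclusion_from_product = exclusion_process p S M \<eta>
  for p S and M :: "'a measure" and \<eta> +
  fixes \<rho> :: "int \<Rightarrow> real"
  assumes initial: "distr M config_space (\<eta> 0) = bernoulli_product \<rho>"
    and rho_range: "\<rho> x \<in> {0..1}"
begin

lemma rho01: "0 \<le> \<rho> x" "\<rho> x \<le> 1"
  using rho_range[of x] by auto

lemma mean_0_prod_obs:
  assumes "finite I"
  shows "mean 0 (prod_obs I g) = (\<Prod>x\<in>I. 1 - g x * \<rho> x)"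
proof -
  have "mean 0 (prod_obs I g) = (\<integral>\<zeta>. prod_obs I g \<zeta> \<partial>distr M config_space (\<eta> 0))"
    unfolding mean_def
    by (rule integral_distr[symmetric]) (auto intro: depends_on_measurable[OF assms] depends_on_prod_obs)
  also have "\<dots> = (\<integral>\<zeta>. (\<Prod>x\<in>I. (\<lambda>x b. 1 - g x * of_bool b) x (\<zeta> x)) \<partial>bernoulli_product \<rho>)"
    by (simp add: initial prod_obs_def)
  also have "\<dots> = (\<Prod>x\<in>I. \<integral>b. 1 - g x * of_bool b \<partial>measure_pmf (bernoulli_pmf (\<rho> x)))"
    by (rule prod_of_bool_expectation[OF assms])
  also have "\<dots> = (\<Prod>x\<in>I. 1 - g x * \<rho> x)"
    using rho01 by (intro prod.cong) (auto simp: algebra_simps)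
  finally show ?thesis .
qed

lemma mean_lin_obs:
  assumes "finite I" "t \<ge> 0"
  shows "mean t (lin_obs I f) = (\<Sum>x\<in>I. f x * mean t (\<lambda>\<zeta>. of_bool (\<zeta> x)))"
proof -
  have "integrable M (\<lambda>\<omega>. of_bool (\<eta> t \<omega> x) :: real)" for x
    by (rule integrable_depends_on[of "{x}" "\<lambda>\<zeta>. of_bool (\<zeta> x)"]) (auto simp: depends_on_def assms)
  then show ?thesis by (simp add: mean_def lin_obs_def)
qed

lemma mean_0_lin_obs:
  assumes "finite I"
  shows "mean 0 (lin_obs I f) = (\<Sum>x\<in>I. f x * \<rho> x)"
proof -
  have "mean 0 (\<lambda>\<zeta>. of_bool (\<zeta> x)) = \<rho> x" for x
  proof -
    have "mean 0 (\<lambda>\<zeta>. of_bool (\<zeta> x)) = (\<integral>\<zeta>. of_bool (\<zeta> x) \<partial>distr M config_space (\<eta> 0))"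
      unfolding mean_def
      by (rule integral_distr[symmetric]) (auto intro!: depends_on_measurable[of "{x}"] simp: depends_on_def)
    also have "\<dots> = \<rho> x"
      using prod_of_bool_expectation[where J = "{x}" and f = "\<lambda>_ b. of_bool b" and \<rho> = \<rho>] rho01 by (simp add: initial)
    finally show ?thesis .
  qed
  then show ?thesis using assms by (simp add: mean_lin_obs)
qed

lemma mean_le:
  assumes "finite I" "depends_on I f" "finite J" "depends_on J f'" "s \<ge> 0"
    and "\<And>\<zeta>. exclusion_pregenerator p f \<zeta> - f' \<zeta> \<le> c"
  shows "mean s (exclusion_pregenerator p f) - mean s f' \<le> c"
proof -
  have "mean s (exclusion_pregenerator p f) - mean s f' = (\<integral>\<omega>. exclusion_pregenerator p f (\<eta> s \<omega>) - f' (\<eta> s \<omega>) \<partial>M)"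
    unfolding mean_def using assms by (intro Bochner_Integration.integral_diff[symmetric] integrable_pregenerator integrable_depends_on)
  also have "\<dots> \<le> (\<integral>\<omega>. c \<partial>M)"
  proof (rule integral_mono)
    show "integrable M (\<lambda>\<omega>. exclusion_pregenerator p f (\<eta> s \<omega>) - f' (\<eta> s \<omega>))"
      using assms by (intro Bochner_Integration.integrable_diff integrable_pregenerator integrable_depends_on)
  qed (use assms in auto)
  finally show ?thesis by (simp add: prob_space)
qed

lemma mean_ge:
  assumes "finite I" "depends_on I f" "finite J" "depends_on J f'" "finite K" "depends_on K k" "s \<ge> 0"
    and "\<And>\<zeta>. exclusion_pregenerator p f \<zeta> - f' \<zeta> \<ge> k \<zeta>"
  shows "mean s (exclusion_pregenerator p f) - mean s f' \<ge> mean s k"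
proof -
  have "mean s (exclusion_pregenerator p f) - mean s f' = (\<integral>\<omega>. exclusion_pregenerator p f (\<eta> s \<omega>) - f' (\<eta> s \<omega>) \<partial>M)"
    unfolding mean_def using assms by (intro Bochner_Integration.integral_diff[symmetric] integrable_pregenerator integrable_depends_on)
  also have "\<dots> \<ge> (\<integral>\<omega>. k (\<eta> s \<omega>) \<partial>M)"
    using assms by (intro integral_mono Bochner_Integration.integrable_diff integrable_pregenerator integrable_depends_on) auto
  finally show ?thesis by (simp add: mean_def)
qed

text \<open>The expectation of \<open>lin_obs A h\<close> at time \<open>t\<close>, expressed
  through the initial densities by letting the walk carry \<open>h\<close> back to time 0.\<close>

definition intensity :: "int set \<Rightarrow> (int \<Rightarrow> real) \<Rightarrow> real \<Rightarrow> real" where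
  "intensity A h t = (\<Sum>\<^sub>\<infinity>z. walk_avg p A h t z * \<rho> z)"

lemma intensity_has_sum:
  assumes "finite A" "t \<ge> 0"
  shows "((\<lambda>z. walk_avg p A h t z * \<rho> z) has_sum intensity A h t) UNIV"
proof -
  have "(\<lambda>z. exp t * walk_avg p A (\<lambda>a. \<bar>h a\<bar>) t z) summable_on UNIV"
    by (intro summable_on_cmult_right has_sum_imp_summable[OF walk_avg_has_sum] assms)
  then have "(\<lambda>z. walk_avg p A h t z * \<rho> z) summable_on UNIV"
  proof (rule summable_on_of_abs_le)
    fix z
    have "\<bar>walk_avg p A h t z\<bar> * \<bar>\<rho> z\<bar> \<le> (exp t * walk_avg p A (\<lambda>a. \<bar>h a\<bar>) t z) * 1"
      using walk_avg_bound[of t t p A h z] assms rho01[of z] by (intro mult_mono) auto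
    then show "\<bar>walk_avg p A h t z * \<rho> z\<bar> \<le> exp t * walk_avg p A (\<lambda>a. \<bar>h a\<bar>) t z" by (simp add: abs_mult)
  qed
  then show ?thesis by (simp add: intensity_def)
qed

context
  fixes A :: "int set" and h :: "int \<Rightarrow> real" and t :: real
  assumes A: "finite A" and t: "t \<ge> 0"
begin

text \<open>Dominates \<open>walk_avg p A h r\<close> for all \<open>r\<close> up to
  \<open>t\<close> at once, which is where the factor \<open>exp t\<close> comes from. It is the
  summable weight \<open>\<gamma>\<close> in all truncation errors below.\<close>

definition envelope :: "int \<Rightarrow> real" where
  "envelope x = exp t * walk_avg p A (\<lambda>a. \<bar>h a\<bar>) t x"

lemma envelope_has_sum: "(envelope has_sum (exp t * (\<Sum>a\<in>A. \<bar>h a\<bar>))) UNIV"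
  unfolding envelope_def[abs_def] by (intro has_sum_cmult_right walk_avg_has_sum A t)

lemma envelope_nonneg: "envelope x \<ge> 0"
  unfolding envelope_def by (intro mult_nonneg_nonneg walk_avg_nonneg t) auto

lemma walk_avg_le_envelope: "0 \<le> r \<Longrightarrow> r \<le> t \<Longrightarrow> \<bar>walk_avg p A h r x\<bar> \<le> envelope x"
  unfolding envelope_def by (rule walk_avg_bound)

lemma eventually_A_subset: "eventually (\<lambda>n. A \<subseteq> {- int n..int n}) sequentially"
  using filterlim_int_intervals A unfolding filterlim_finite_subsets_at_top
  by (auto elim!: allE[of _ A] elim: eventually_mono)

text \<open>Along \<open>s\<close>, the generator acting on \<open>walk_avg p A h (t - s)\<close>
  and the time derivative of this function cancel up to \<open>tail_err\<close>, at each of the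
  times in between.\<close>

lemma lin_obs_step:
  assumes I: "finite I"
  shows "\<bar>mean t (lin_obs I (walk_avg p A h 0)) - mean 0 (lin_obs I (walk_avg p A h t))\<bar> \<le> tail_err p envelope I * t"
proof -
  let ?g = "walk_avg p A h" and ?g' = "walk_avg_deriv p A h"
  have der: "((\<lambda>r. lin_obs I (?g r) \<zeta>) has_real_derivative lin_obs I (?g' r) \<zeta>) (at r)" if "0 \<le> r" for r \<zeta>
    unfolding lin_obs_def by (intro DERIV_sum DERIV_cmult_right walk_avg_has_derivative that)
  note dyn = dynkin[OF I depends_on_lin_obs depends_on_lin_obs der]
  have gen: "\<bar>exclusion_pregenerator p (lin_obs I (?g r)) \<zeta> - lin_obs I (?g' r) \<zeta>\<bar> \<le> tail_err p envelope I" if "0 \<le> r" "r \<le> t" for r \<zeta>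
    by (rule lin_obs_generator[OF I envelope_has_sum walk_avg_le_envelope[OF that] walk_avg_equation[OF A that(1)]])
  have up: "mean s (exclusion_pregenerator p (lin_obs I (?g r))) - mean s (lin_obs I (?g' r)) \<le> tail_err p envelope I"
    if "0 \<le> r" "r \<le> t" "s \<ge> 0" for r s
    by (rule mean_le[OF I depends_on_lin_obs I depends_on_lin_obs that(3)]) (use gen[OF that(1,2)] in \<open>simp add: abs_le_iff\<close>)
  have lo: "mean s (exclusion_pregenerator p (lin_obs I (?g r))) - mean s (lin_obs I (?g' r)) \<ge> - tail_err p envelope I"
    if "0 \<le> r" "r \<le> t" "s \<ge> 0" for r s
  proof -
    have "mean s (exclusion_pregenerator p (lin_obs I (?g r))) - mean s (lin_obs I (?g' r)) \<ge> mean s (\<lambda>_. - tail_err p envelope I)"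
    proof (rule mean_ge[OF I depends_on_lin_obs I depends_on_lin_obs I _ that(3)])
      show "exclusion_pregenerator p (lin_obs I (?g r)) \<zeta> - lin_obs I (?g' r) \<zeta> \<ge> - tail_err p envelope I" for \<zeta>
        using gen[OF that(1,2), of \<zeta>] by linarith
    qed (simp add: depends_on_def)
    then show ?thesis by (simp add: mean_def prob_space)
  qed
  have 1: "mean t (lin_obs I (?g (t - t))) \<le> mean 0 (lin_obs I (?g (t - 0))) + tail_err p envelope I * t"
  proof (rule growth_of_right_derivative[OF t])
    show "continuous_on {0..t} (\<lambda>s. mean s (lin_obs I (?g (t - s))))" by (rule dyn(1))
    fix s assume s: "0 \<le> s" "s < t"
    show "\<exists>D\<le>tail_err p envelope I. ((\<lambda>s. mean s (lin_obs I (?g (t - s)))) has_real_derivative D) (at s within {s..})"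
      using dyn(2)[of t s] up[of "t - s" s] s by auto
  qed
  have 2: "- mean t (lin_obs I (?g (t - t))) \<le> - mean 0 (lin_obs I (?g (t - 0))) + tail_err p envelope I * t"
  proof (rule growth_of_right_derivative[OF t])
    show "continuous_on {0..t} (\<lambda>s. - mean s (lin_obs I (?g (t - s))))" by (intro continuous_on_minus dyn(1))
    fix s assume s: "0 \<le> s" "s < t"
    define D where "D = mean s (exclusion_pregenerator p (lin_obs I (?g (t - s)))) - mean s (lin_obs I (?g' (t - s)))"
    have "((\<lambda>s. mean s (lin_obs I (?g (t - s)))) has_real_derivative D) (at s within {s..})"
      unfolding D_def using s by (intro dyn(2)) auto
    moreover have "- D \<le> tail_err p envelope I" using lo[of "t - s" s] s by (simp add: D_def)
    ultimately show "\<exists>D\<le>tail_err p envelope I. ((\<lambda>s. - mean s (lin_obs I (?g (t - s)))) has_real_derivative D) (at s within {s..})"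
      by (intro exI[of _ "- D"] conjI DERIV_minus)
  qed
  from 1 2 show ?thesis by (simp add: abs_le_iff)
qed

theorem mean_lin_obs_eq_intensity: "mean t (lin_obs A h) = intensity A h t"
proof -
  let ?I = "\<lambda>n. {- int n..int n}"
  have "(\<lambda>n. tail_err p envelope (?I n) * t) \<longlonglongrightarrow> 0"
    by (intro tendsto_mult_left_zero tail_err_tendsto[OF envelope_has_sum] envelope_nonneg)
  then have lim0: "(\<lambda>n. mean t (lin_obs (?I n) (walk_avg p A h 0)) - mean 0 (lin_obs (?I n) (walk_avg p A h t))) \<longlonglongrightarrow> 0"
    by (rule Lim_null_comparison[rotated])
       (intro always_eventually allI, unfold real_norm_def, rule lin_obs_step, simp)
  have ev: "eventually (\<lambda>n. mean t (lin_obs (?I n) (walk_avg p A h 0)) = mean t (lin_obs A h)) sequentially"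
    using eventually_A_subset
  proof eventually_elim
    case (elim n)
    have "lin_obs (?I n) (walk_avg p A h 0) = lin_obs A h"
      using lin_obs_extend[OF _ elim, of h] by (auto simp: walk_avg_0[OF A] fun_eq_iff lin_obs_def)
    then show ?case by simp
  qed
  have "(\<lambda>n. mean t (lin_obs A h) - mean 0 (lin_obs (?I n) (walk_avg p A h t))) \<longlonglongrightarrow> 0"
    by (rule Lim_transform_eventually[OF lim0]) (use ev in eventually_elim, simp)
  moreover have "(\<lambda>n. mean t (lin_obs A h) - mean 0 (lin_obs (?I n) (walk_avg p A h t))) \<longlonglongrightarrow> mean t (lin_obs A h) - intensity A h t"
    unfolding mean_0_lin_obs[OF finite_atLeastAtMost_int]
    by (intro tendsto_diff tendsto_const has_sum_int_intervals intensity_has_sum A t)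
  ultimately have "mean t (lin_obs A h) - intensity A h t = 0" by (rule LIMSEQ_unique[symmetric])
  then show ?thesis by simp
qed

definition prod_obs_deriv :: "int set \<Rightarrow> real \<Rightarrow> config \<Rightarrow> real" where
  "prod_obs_deriv I r \<zeta> = (\<Sum>x\<in>I. - walk_avg_deriv p A h r x * of_bool (\<zeta> x) * prod_obs (I - {x}) (walk_avg p A h r) \<zeta>)"

lemma depends_on_prod_obs_deriv: "depends_on I (prod_obs_deriv I r)"
proof -
  have "prod_obs (I - {x}) (walk_avg p A h r) \<eta> = prod_obs (I - {x}) (walk_avg p A h r) \<zeta>" if "\<forall>x\<in>I. \<eta> x = \<zeta> x" for x \<eta> \<zeta>
    using depends_onD[OF depends_on_prod_obs[of "I - {x}" I "walk_avg p A h r"], of \<eta> \<zeta>] that by auto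
  then show ?thesis
    unfolding depends_on_def prod_obs_deriv_def by (auto intro!: sum.cong)
qed

lemma prod_obs_has_derivative:
  assumes "finite I" "r \<ge> 0"
  shows "((\<lambda>r. prod_obs I (walk_avg p A h r) \<zeta>) has_real_derivative prod_obs_deriv I r \<zeta>) (at r)"
proof -
  have "((\<lambda>r. \<Prod>x\<in>I. 1 - walk_avg p A h r x * of_bool (\<zeta> x)) has_real_derivative
      (\<Sum>x\<in>I. (0 - walk_avg_deriv p A h r x * of_bool (\<zeta> x)) * (\<Prod>y\<in>I - {x}. 1 - walk_avg p A h r y * of_bool (\<zeta> y)))) (at r)"
    by (intro prod_has_real_derivative assms DERIV_diff DERIV_const DERIV_cmult_right walk_avg_has_derivative)
  then show ?thesis by (simp add: prod_obs_def prod_obs_deriv_def)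
qed

text \<open>With negative values of \<open>h\<close> the factors may exceed 1. Summability of the
  envelope and \<open>1 + z \<le> exp z\<close> still bound every subproduct independently of the
  window.\<close>

lemma prod_obs_bound:
  assumes "finite J" "0 \<le> r" "r \<le> t"
  shows "\<bar>prod_obs J (walk_avg p A h r) \<zeta>\<bar> \<le> exp (exp t * (\<Sum>a\<in>A. \<bar>h a\<bar>))"
proof -
  have "\<bar>prod_obs J (walk_avg p A h r) \<zeta>\<bar> \<le> (\<Prod>x\<in>J. exp (envelope x))"
    unfolding prod_obs_def abs_prod
  proof (intro prod_mono conjI)
    fix x
    have "\<bar>1 - walk_avg p A h r x * of_bool (\<zeta> x)\<bar> \<le> 1 + envelope x"
      using walk_avg_le_envelope[OF assms(2,3), of x] envelope_nonneg[of x] by (cases "\<zeta> x") auto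
    also have "\<dots> \<le> exp (envelope x)" by (rule exp_ge_add_one_self)
    finally show "\<bar>1 - walk_avg p A h r x * of_bool (\<zeta> x)\<bar> \<le> exp (envelope x)" .
  qed auto
  also have "\<dots> = exp (\<Sum>x\<in>J. envelope x)" using assms(1) by (simp add: exp_sum)
  also have "\<dots> \<le> exp (exp t * (\<Sum>a\<in>A. \<bar>h a\<bar>))"
    using finite_sum_le_has_sum[OF envelope_has_sum assms(1)] envelope_nonneg by simp
  finally show ?thesis .
qed

theorem mean_prod_obs_le:
  assumes h1: "\<And>a. a \<in> A \<Longrightarrow> h a \<le> 1"
  shows "mean t (prod_obs A h) \<le> exp (- intensity A h t)"
proof -
  let ?I = "\<lambda>n. {- int n..int n}" and ?g = "walk_avg p A h"
  define C where "C = exp (exp t * (\<Sum>a\<in>A. \<bar>h a\<bar>))"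
  have step: "mean t (prod_obs I (?g 0)) \<le> mean 0 (prod_obs I (?g t)) + C * tail_err p envelope I * t" if I: "finite I" for I
  proof -
    note dyn = dynkin[OF I depends_on_prod_obs[OF order_refl] depends_on_prod_obs_deriv prod_obs_has_derivative[OF I]]
    have gen: "exclusion_pregenerator p (prod_obs I (?g r)) \<zeta> - prod_obs_deriv I r \<zeta> \<le> C * tail_err p envelope I" if r: "0 \<le> r" "r \<le> t" for r \<zeta>
    proof -
      have Cb: "\<And>J. J \<subseteq> I \<Longrightarrow> \<bar>prod_obs J (?g r) \<zeta>\<bar> \<le> C"
        unfolding C_def by (rule prod_obs_bound[OF finite_subset[OF _ I] r])
      obtain Q where Q: "((\<lambda>(x, y). pmf p (y - x) * of_bool (\<zeta> x) * of_bool (\<zeta> y)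
        * ((if x \<in> I then ?g r x else 0) - (if y \<in> I then ?g r y else 0))\<^sup>2 * prod_obs (I - {x, y}) (?g r) \<zeta>) has_sum Q) UNIV"
        "\<bar>exclusion_pregenerator p (prod_obs I (?g r)) \<zeta> - (\<Sum>x\<in>I. - walk_avg_deriv p A h r x * of_bool (\<zeta> x) * prod_obs (I - {x}) (?g r) \<zeta>) + Q / 2\<bar> \<le> C * tail_err p envelope I"
        by (rule prod_obs_generator[OF I envelope_has_sum walk_avg_le_envelope[OF r] walk_avg_equation[OF A r(1)] Cb])
      have "Q \<ge> 0"
        by (rule has_sum_nonneg[OF Q(1)])
           (auto intro!: mult_nonneg_nonneg prod_obs_nonneg walk_avg_le_1[OF A r(1) h1])
      with Q(2) show ?thesis unfolding prod_obs_deriv_def by linarith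
    qed
    have "mean t (prod_obs I (?g (t - t))) \<le> mean 0 (prod_obs I (?g (t - 0))) + C * tail_err p envelope I * t"
    proof (rule growth_of_right_derivative[OF t])
      show "continuous_on {0..t} (\<lambda>s. mean s (prod_obs I (?g (t - s))))" by (rule dyn(1))
      fix s assume s: "0 \<le> s" "s < t"
      have "mean s (exclusion_pregenerator p (prod_obs I (?g (t - s)))) - mean s (prod_obs_deriv I (t - s)) \<le> C * tail_err p envelope I"
        by (rule mean_le[OF I depends_on_prod_obs[OF order_refl] I depends_on_prod_obs_deriv s(1)]) (rule gen, use s in auto)
      with dyn(2)[of t s] s
      show "\<exists>D\<le>C * tail_err p envelope I. ((\<lambda>s. mean s (prod_obs I (?g (t - s)))) has_real_derivative D) (at s within {s..})"
        by auto
    qed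
    then show ?thesis by simp
  qed
  have bound: "mean t (prod_obs (?I n) (?g 0)) \<le> exp (- (\<Sum>x\<in>?I n. ?g t x * \<rho> x)) + C * tail_err p envelope (?I n) * t" for n
  proof -
    have "(\<Prod>x\<in>?I n. 1 - ?g t x * \<rho> x) \<le> (\<Prod>x\<in>?I n. exp (- (?g t x * \<rho> x)))"
    proof (intro prod_mono conjI)
      fix x
      show "0 \<le> 1 - ?g t x * \<rho> x"
      proof (cases "?g t x \<ge> 0")
        case True
        then have "?g t x * \<rho> x \<le> 1 * 1" using walk_avg_le_1[OF A t h1, where p = p and x = x] rho01[of x] by (intro mult_mono) auto
        then show ?thesis by simp
      next
        case False
        then have "?g t x * \<rho> x \<le> 0" using rho01[of x] by (simp add: mult_nonpos_nonneg)
        then show ?thesis by simp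
      qed
      show "1 - ?g t x * \<rho> x \<le> exp (- (?g t x * \<rho> x))" using exp_ge_add_one_self[of "- (?g t x * \<rho> x)"] by simp
    qed
    also have "\<dots> = exp (- (\<Sum>x\<in>?I n. ?g t x * \<rho> x))"
      by (simp add: exp_sum[symmetric] sum_negf)
    finally show ?thesis using step[of "?I n"] by (simp add: mean_0_prod_obs)
  qed
  have "(\<lambda>n. exp (- (\<Sum>x\<in>?I n. ?g t x * \<rho> x)) + C * tail_err p envelope (?I n) * t) \<longlonglongrightarrow> exp (- intensity A h t) + C * 0 * t"
    by (intro tendsto_intros has_sum_int_intervals intensity_has_sum A t tail_err_tendsto[OF envelope_has_sum] envelope_nonneg)
  moreover have "eventually (\<lambda>n. mean t (prod_obs A h) \<le> exp (- (\<Sum>x\<in>?I n. ?g t x * \<rho> x)) + C * tail_err p envelope (?I n) * t) sequentially"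
    using eventually_A_subset
  proof eventually_elim
    case (elim n)
    have "prod_obs (?I n) (?g 0) = prod_obs A h"
      using prod_obs_extend[OF _ elim, of h] by (auto simp: walk_avg_0[OF A] fun_eq_iff prod_obs_def)
    with bound[of n] show ?case by simp
  qed
  ultimately have "mean t (prod_obs A h) \<le> exp (- intensity A h t) + C * 0 * t"
    by (intro tendsto_lowerbound) auto
  then show ?thesis by simp
qed

end

end


section \<open>Lower bound for the emptiness probability\<close>

context exclusion_from_product
begin

section \<open>One-point and two-point functions\<close>

definition occ :: "real \<Rightarrow> int \<Rightarrow> real" where
  "occ s x = mean s (\<lambda>\<zeta>. of_bool (\<zeta> x))"

definition occ2 :: "real \<Rightarrow> int \<Rightarrow> int \<Rightarrow> real" where
  "occ2 s x y = mean s (\<lambda>\<zeta>. of_bool (\<zeta> x) * of_bool (\<zeta> y))"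

lemma depends_on_of_bool: "x \<in> I \<Longrightarrow> depends_on I (\<lambda>\<zeta>. of_bool (\<zeta> x))"
  by (simp add: depends_on_def)

lemma depends_on_of_bool2: "x \<in> I \<Longrightarrow> y \<in> I \<Longrightarrow> depends_on I (\<lambda>\<zeta>. of_bool (\<zeta> x) * of_bool (\<zeta> y))"
  by (simp add: depends_on_def)

lemma integrable_of_bool: "s \<ge> 0 \<Longrightarrow> integrable M (\<lambda>\<omega>. of_bool (\<eta> s \<omega> x) :: real)"
  by (rule integrable_depends_on[of "{x}" "\<lambda>\<zeta>. of_bool (\<zeta> x)"]) (auto intro: depends_on_of_bool)

lemma integrable_of_bool2: "s \<ge> 0 \<Longrightarrow> integrable M (\<lambda>\<omega>. of_bool (\<eta> s \<omega> x) * of_bool (\<eta> s \<omega> y) :: real)"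
  by (rule integrable_depends_on[of "{x, y}" "\<lambda>\<zeta>. of_bool (\<zeta> x) * of_bool (\<zeta> y)"]) (auto intro: depends_on_of_bool2)

lemma occ_nonneg: "occ s x \<ge> 0"
  unfolding occ_def mean_def by (rule Bochner_Integration.integral_nonneg) auto

lemma occ2_le_occ: "s \<ge> 0 \<Longrightarrow> occ2 s x y \<le> occ s x"
  unfolding occ_def occ2_def mean_def
  by (intro integral_mono integrable_of_bool integrable_of_bool2) auto

lemma occ2_commute: "occ2 s x y = occ2 s y x"
  by (simp add: occ2_def mult.commute)

lemma occ_le_1: "s \<ge> 0 \<Longrightarrow> occ s x \<le> 1"
proof -
  assume s: "s \<ge> 0"
  have "occ s x \<le> (\<integral>\<omega>. 1 \<partial>M)"
    unfolding occ_def mean_def by (intro integral_mono integrable_of_bool s) auto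
  then show ?thesis by (simp add: prob_space)
qed

lemma occ_eq_walk: "s \<ge> 0 \<Longrightarrow> occ s x = intensity {x} (\<lambda>_. 1) s"
proof -
  have "lin_obs {x} (\<lambda>_. 1) = (\<lambda>\<zeta>. of_bool (\<zeta> x))"
    unfolding lin_obs_def by (rule ext) (rename_tac \<zeta>, case_tac "\<zeta> x", simp_all)
  then show "s \<ge> 0 \<Longrightarrow> occ s x = intensity {x} (\<lambda>_. 1) s"
    using mean_lin_obs_eq_intensity[of "{x}" s "\<lambda>_. 1"] by (simp add: occ_def)
qed

lemma mean_lin_obs_occ: "finite I \<Longrightarrow> s \<ge> 0 \<Longrightarrow> mean s (lin_obs I f) = (\<Sum>x\<in>I. f x * occ s x)"
  by (simp add: mean_lin_obs occ_def)

text \<open>A weak form of negative correlation, read off from the product inequality with the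
  test function \<open>(1 + \<eta> x / occ s x) (1 + \<eta> y / occ s y)\<close>.\<close>

lemma occ2_le:
  assumes s: "s \<ge> 0" and xy: "x \<noteq> y"
  shows "occ2 s x y \<le> exp 2 * (occ s x * occ s y)"
proof (cases "occ s x = 0 \<or> occ s y = 0")
  case True
  then have "occ2 s x y \<le> 0"
    using occ2_le_occ[OF s, of x y] occ2_le_occ[OF s, of y x] by (auto simp: occ2_commute[of s y x])
  with True show ?thesis by auto
next
  case False
  then have pos: "occ s x > 0" "occ s y > 0" using occ_nonneg[of s x] occ_nonneg[of s y] by linarith+
  define h where "h = (\<lambda>z. if z = x then - (1 / occ s x) else - (1 / occ s y))"
  have "mean s (prod_obs {x, y} h) \<le> exp (- intensity {x, y} h s)"
    by (rule mean_prod_obs_le) (use s pos in \<open>auto simp: h_def intro: order_trans[of _ 0]\<close>)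
  also have "intensity {x, y} h s = -2"
    using mean_lin_obs_eq_intensity[of "{x, y}" s h] mean_lin_obs_occ[of "{x, y}" s h] s xy pos by (simp add: h_def)
  finally have 1: "mean s (prod_obs {x, y} h) \<le> exp 2" by simp
  have "occ2 s x y / (occ s x * occ s y) = (\<integral>\<omega>. of_bool (\<eta> s \<omega> x) * of_bool (\<eta> s \<omega> y) / (occ s x * occ s y) \<partial>M)"
    by (simp add: occ2_def mean_def)
  also have "\<dots> \<le> (\<integral>\<omega>. prod_obs {x, y} h (\<eta> s \<omega>) \<partial>M)"
  proof (rule integral_mono)
    show "integrable M (\<lambda>\<omega>. of_bool (\<eta> s \<omega> x) * of_bool (\<eta> s \<omega> y) / (occ s x * occ s y))"
      by (intro integrable_divide integrable_of_bool2 s)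
    show "integrable M (\<lambda>\<omega>. prod_obs {x, y} h (\<eta> s \<omega>))"
      by (rule integrable_depends_on[OF _ depends_on_prod_obs[OF order_refl] s]) simp
    show "of_bool (\<eta> s \<omega> x) * of_bool (\<eta> s \<omega> y) / (occ s x * occ s y) \<le> prod_obs {x, y} h (\<eta> s \<omega>)" for \<omega>
    proof -
      have "prod_obs {x, y} h (\<eta> s \<omega>) = (1 + of_bool (\<eta> s \<omega> x) / occ s x) * (1 + of_bool (\<eta> s \<omega> y) / occ s y)"
        using xy by (simp add: prod_obs_def h_def)
      also have "\<dots> = 1 + of_bool (\<eta> s \<omega> x) / occ s x + of_bool (\<eta> s \<omega> y) / occ s y
          + of_bool (\<eta> s \<omega> x) * of_bool (\<eta> s \<omega> y) / (occ s x * occ s y)"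
        by (simp add: algebra_simps)
      finally show ?thesis using pos by simp
    qed
  qed
  also have "\<dots> \<le> exp 2" using 1 by (simp add: mean_def)
  finally show ?thesis using pos by (simp add: field_simps)
qed

context
  fixes A :: "int set" and t :: real
  assumes A: "finite A" and t: "t \<ge> 0"
begin

abbreviation "g \<equiv> walk_avg p A (\<lambda>_. 1)"
abbreviation "env \<equiv> envelope A (\<lambda>_. 1) t"

lemma g01:
  assumes "r \<ge> 0"
  shows "0 \<le> g r x" "g r x \<le> 1"
  by (rule walk_avg_nonneg[OF assms], simp) (rule walk_avg_le_1[OF A assms], simp)

lemma g_le_env: "0 \<le> r \<Longrightarrow> r \<le> t \<Longrightarrow> g r x \<le> env x"
  using walk_avg_le_envelope[OF A t, of r "\<lambda>_. 1" x] by simp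

text \<open>The density of the Dirichlet form of \<open>g r\<close> on the pair \<open>x\<close>,
  \<open>y\<close>.\<close>

definition grad :: "real \<Rightarrow> int \<Rightarrow> int \<Rightarrow> real" where
  "grad r x y = pmf p (y - x) * (g r x - g r y)\<^sup>2"

lemma grad_nonneg: "grad r x y \<ge> 0"
  by (simp add: grad_def)

lemma grad_commute: "grad r x y = grad r y x"
  unfolding grad_def pmf_diff_commute[of x y] power2_commute[of "g r x"] ..

text \<open>The residual product over the other sites lies between 0 and 1 and is replaced by 1. The
  error \<open>2 * tail_err\<close> covers the truncated generator and half the weight of the pairs
  that leave \<open>I\<close>.\<close>

lemma prod_obs_drift:
  assumes I: "finite I" and r: "0 \<le> r" "r \<le> t"
  shows "exclusion_pregenerator p (prod_obs I (g r)) \<zeta> - prod_obs_deriv A (\<lambda>_. 1) I r \<zeta>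
    \<ge> - (\<Sum>x\<in>I. \<Sum>y\<in>I. grad r x y / 2 * (of_bool (\<zeta> x) * of_bool (\<zeta> y))) - 2 * tail_err p env I"
proof -
  note \<gamma> = envelope_has_sum[OF A t, of "\<lambda>_. 1"]
  have g0: "env x \<ge> 0" for x by (rule envelope_nonneg[OF A t])
  have R: "0 \<le> prod_obs J (g r) \<zeta>" "prod_obs J (g r) \<zeta> \<le> 1" for J
    using g01[OF r(1)] by (auto intro: prod_obs_nonneg prod_obs_le_1)
  define q where "q = (\<lambda>(x, y). pmf p (y - x) * of_bool (\<zeta> x) * of_bool (\<zeta> y)
        * ((if x \<in> I then g r x else 0) - (if y \<in> I then g r y else 0))\<^sup>2 * prod_obs (I - {x, y}) (g r) \<zeta>)"
  obtain Q where Q: "(q has_sum Q) UNIV"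
    "\<bar>exclusion_pregenerator p (prod_obs I (g r)) \<zeta> - (\<Sum>x\<in>I. - walk_avg_deriv p A (\<lambda>_. 1) r x * of_bool (\<zeta> x) * prod_obs (I - {x}) (g r) \<zeta>) + Q / 2\<bar> \<le> 1 * tail_err p env I"
    unfolding q_def
  proof (rule prod_obs_generator[OF I \<gamma> walk_avg_le_envelope[OF A t r] walk_avg_equation[OF A r(1)]])
    show "\<bar>prod_obs J (g r) \<zeta>\<bar> \<le> 1" for J using R[of J] by simp
  qed
  have q_in: "q (x, y) \<le> grad r x y * (of_bool (\<zeta> x) * of_bool (\<zeta> y))" if "x \<in> I" "y \<in> I" for x y
  proof -
    have "grad r x y * (of_bool (\<zeta> x) * of_bool (\<zeta> y)) * prod_obs (I - {x, y}) (g r) \<zeta>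
        \<le> grad r x y * (of_bool (\<zeta> x) * of_bool (\<zeta> y)) * 1"
      using R by (intro mult_left_mono) (auto simp: grad_nonneg)
    then show ?thesis using that by (simp add: q_def grad_def mult_ac)
  qed
  have q_out: "q z \<le> pair_tail p env z" if "z \<notin> I \<times> I" for z
  proof -
    obtain x y where z: "z = (x, y)" by (cases z)
    have sq: "(g r v)\<^sup>2 \<le> env v" for v
    proof -
      have "(g r v)\<^sup>2 \<le> g r v"
        using mult_left_mono[OF g01(2)[OF r(1), of v] g01(1)[OF r(1), of v]] by (simp add: power2_eq_square)
      with g_le_env[OF r, of v] show ?thesis by linarith
    qed
    have d: "((if x \<in> I then g r x else 0) - (if y \<in> I then g r y else 0))\<^sup>2 \<le> env x + env y"
      using that sq[of x] sq[of y] g0[of x] g0[of y] by (auto simp: z)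
    have "q z = pmf p (y - x) * (of_bool (\<zeta> x) * of_bool (\<zeta> y) * prod_obs (I - {x, y}) (g r) \<zeta>)
        * ((if x \<in> I then g r x else 0) - (if y \<in> I then g r y else 0))\<^sup>2"
      by (simp add: q_def z mult_ac)
    also have "\<dots> \<le> pmf p (y - x) * (1 * 1 * 1) * (env x + env y)"
      using R[of "I - {x, y}"] by (intro mult_mono d) auto
    finally show ?thesis by (simp add: z pair_tail_def ring_distribs)
  qed
  have sum_in: "(q has_sum (\<Sum>z\<in>I \<times> I. q z)) (I \<times> I)" using I by (intro has_sum_finite) auto
  have "q summable_on (-(I \<times> I))" using has_sum_imp_summable[OF Q(1)] by (rule summable_on_subset_banach) simp
  then obtain Q' where Q': "(q has_sum Q') (-(I \<times> I))" by (auto simp: summable_on_def)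
  have "(q has_sum ((\<Sum>z\<in>I \<times> I. q z) + Q')) (I \<times> I \<union> -(I \<times> I))"
    by (intro has_sum_Un_disjoint sum_in Q') auto
  then have QQ: "Q = (\<Sum>z\<in>I \<times> I. q z) + Q'" using Q(1) by (auto intro: has_sum_unique)
  have Q'_le: "Q' \<le> tail_err p env I"
    by (rule has_sum_mono[OF Q' tail_err_has_sum[OF \<gamma> g0]]) (use q_out in auto)
  have S_le: "(\<Sum>z\<in>I \<times> I. q z) \<le> (\<Sum>x\<in>I. \<Sum>y\<in>I. grad r x y * (of_bool (\<zeta> x) * of_bool (\<zeta> y)))"
  proof -
    have "(\<Sum>z\<in>I \<times> I. q z) = (\<Sum>x\<in>I. \<Sum>y\<in>I. q (x, y))"
      by (simp add: sum.cartesian_product)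
    also have "\<dots> \<le> (\<Sum>x\<in>I. \<Sum>y\<in>I. grad r x y * (of_bool (\<zeta> x) * of_bool (\<zeta> y)))"
      by (intro sum_mono q_in)
    finally show ?thesis .
  qed
  have W: "(\<Sum>x\<in>I. \<Sum>y\<in>I. grad r x y / 2 * (of_bool (\<zeta> x) * of_bool (\<zeta> y)))
     = (\<Sum>x\<in>I. \<Sum>y\<in>I. grad r x y * (of_bool (\<zeta> x) * of_bool (\<zeta> y))) / 2"
    by (simp add: sum_divide_distrib)
  have err: "tail_err p env I \<ge> 0" by (rule tail_err_nonneg[OF g0])
  have arith: "- W2 - 2 * e \<le> E - F"
    if "\<bar>E - F + (S + Q') / 2\<bar> \<le> 1 * e" "Q' \<le> e" "S \<le> W" "W2 = W / 2" "e \<ge> 0" for E F S Q' e W W2 :: real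
    using that unfolding abs_le_iff by (simp add: field_simps)
  show ?thesis
    unfolding prod_obs_deriv_def[OF A t] by (rule arith[OF Q(2)[unfolded QQ] Q'_le S_le W err])
qed

text \<open>The square of a solution of the heat equation is a subsolution: applying the walk
  generator to \<open>g\<^sup>2\<close> exceeds \<open>2 * g\<close> times its action on
  \<open>g\<close> by the sum of the squared gradients. This gain is what pays for the loss in
  \<open>prod_obs_drift\<close>.\<close>

lemma lin_obs_drift:
  assumes I: "finite I" and r: "0 \<le> r" "r \<le> t"
  shows "exclusion_pregenerator p (lin_obs I (\<lambda>x. (g r x)\<^sup>2)) \<zeta> - lin_obs I (\<lambda>x. 2 * g r x * walk_avg_deriv p A (\<lambda>_. 1) r x) \<zeta>
    \<ge> (\<Sum>x\<in>I. \<Sum>y\<in>I. grad r x y * of_bool (\<zeta> x)) - tail_err p env I"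
proof -
  note \<gamma> = envelope_has_sum[OF A t, of "\<lambda>_. 1"]
  define f' where "f' = (\<lambda>x. \<Sum>\<^sub>\<infinity>y. pmf p (y - x) * ((g r y)\<^sup>2 - (g r x)\<^sup>2))"
  have sq: "0 \<le> (g r v)\<^sup>2" "(g r v)\<^sup>2 \<le> 1" "(g r v)\<^sup>2 \<le> env v" for v
  proof -
    have "(g r v)\<^sup>2 \<le> g r v"
      using mult_left_mono[OF g01(2)[OF r(1), of v] g01(1)[OF r(1), of v]] by (simp add: power2_eq_square)
    with g_le_env[OF r, of v] g01(2)[OF r(1), of v] show "0 \<le> (g r v)\<^sup>2" "(g r v)\<^sup>2 \<le> 1" "(g r v)\<^sup>2 \<le> env v" by simp_all
  qed
  have f': "((\<lambda>y. pmf p (y - x) * ((g r y)\<^sup>2 - (g r x)\<^sup>2)) has_sum f' x) UNIV" for x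
  proof -
    have "(\<lambda>y. pmf p (y - x)) summable_on UNIV"
      using has_sum_shift_int[of "pmf p" x 1] pmf_has_sum_1[of p] by (auto intro: has_sum_imp_summable)
    then have "(\<lambda>y. pmf p (y - x) * ((g r y)\<^sup>2 - (g r x)\<^sup>2)) summable_on UNIV"
    proof (rule summable_on_of_abs_le)
      fix y
      have "\<bar>(g r y)\<^sup>2 - (g r x)\<^sup>2\<bar> \<le> 1" using sq(1,2)[of x] sq(1,2)[of y] by linarith
      from mult_left_mono[OF this, of "pmf p (y - x)"]
      show "\<bar>pmf p (y - x) * ((g r y)\<^sup>2 - (g r x)\<^sup>2)\<bar> \<le> pmf p (y - x)" by (simp add: abs_mult)
    qed
    then show ?thesis by (simp add: f'_def)
  qed
  have 1: "\<bar>exclusion_pregenerator p (lin_obs I (\<lambda>x. (g r x)\<^sup>2)) \<zeta> - lin_obs I f' \<zeta>\<bar> \<le> tail_err p env I"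
    by (rule lin_obs_generator[OF I \<gamma> _ f']) (use sq in simp)
  have 2: "(\<Sum>y\<in>I. grad r x y) \<le> f' x - 2 * g r x * walk_avg_deriv p A (\<lambda>_. 1) r x" for x
  proof -
    have "((\<lambda>y. pmf p (y - x) * ((g r y)\<^sup>2 - (g r x)\<^sup>2) + - (2 * g r x * (pmf p (y - x) * (g r y - g r x))))
       has_sum (f' x + - (2 * g r x * walk_avg_deriv p A (\<lambda>_. 1) r x))) UNIV"
      by (intro has_sum_add has_sum_uminusI has_sum_cmult_right f' walk_avg_equation A r)
    moreover have "pmf p (y - x) * ((g r y)\<^sup>2 - (g r x)\<^sup>2) + - (2 * g r x * (pmf p (y - x) * (g r y - g r x))) = grad r x y" for y
      by (simp add: grad_def power2_eq_square algebra_simps)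
    ultimately have "((\<lambda>y. grad r x y) has_sum (f' x - 2 * g r x * walk_avg_deriv p A (\<lambda>_. 1) r x)) UNIV" by simp
    from finite_sum_le_has_sum[OF this I] show ?thesis by (simp add: grad_nonneg)
  qed
  have "(\<Sum>x\<in>I. \<Sum>y\<in>I. grad r x y * of_bool (\<zeta> x)) \<le> lin_obs I f' \<zeta> - lin_obs I (\<lambda>x. 2 * g r x * walk_avg_deriv p A (\<lambda>_. 1) r x) \<zeta>"
    unfolding lin_obs_def sum_subtractf[symmetric] sum_distrib_right[symmetric] left_diff_distrib[symmetric]
    by (intro sum_mono mult_right_mono 2) auto
  with 1 show ?thesis by linarith
qed

lemma mean_double_sum:
  assumes I: "finite I" and s: "s \<ge> 0"
  shows "mean s (\<lambda>\<zeta>. - (\<Sum>x\<in>I. \<Sum>y\<in>I. c x y * (of_bool (\<zeta> x) * of_bool (\<zeta> y))) - d) = - (\<Sum>x\<in>I. \<Sum>y\<in>I. c x y * occ2 s x y) - d"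
    and "mean s (\<lambda>\<zeta>. (\<Sum>x\<in>I. \<Sum>y\<in>I. c x y * of_bool (\<zeta> x)) - d) = (\<Sum>x\<in>I. \<Sum>y\<in>I. c x y * occ s x) - d"
  using integrable_of_bool2[OF s] integrable_of_bool[OF s]
  by (simp_all add: mean_def occ2_def occ_def prob_space)

text \<open>On pairs inside \<open>B\<close> the two-point function is bounded by 1. For any other
  pair one site has density at most \<open>k\<close>, and \<open>occ2_le\<close> leaves
  \<open>exp 2 * k\<close> times a one-point function. Symmetrising this over the two sites doubles
  the sum, which offsets the factor 1/2.\<close>

lemma occupation_gradient_bound:
  assumes I: "finite I" and s: "0 \<le> s" and k: "k \<ge> 0"
    and outside: "\<And>x. x \<notin> B \<Longrightarrow> occ s x \<le> k"
  shows "(\<Sum>x\<in>I. \<Sum>y\<in>I. grad r x y / 2 * occ2 s x y)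
    \<le> (\<Sum>x\<in>I \<inter> B. \<Sum>y\<in>I \<inter> B. grad r x y) / 2 + exp 2 * k * (\<Sum>x\<in>I. \<Sum>y\<in>I. grad r x y * occ s x)"
proof -
  have termwise: "grad r x y * occ2 s x y \<le> grad r x y * of_bool (x \<in> B \<and> y \<in> B) + (exp 2 * k * (grad r x y * occ s x) + exp 2 * k * (grad r y x * occ s y))" for x y
  proof (cases "x = y")
    case True
    then show ?thesis by (simp add: grad_def)
  next
    case False
    have "occ2 s x y \<le> of_bool (x \<in> B \<and> y \<in> B) + exp 2 * k * (occ s x + occ s y)"
    proof (cases "x \<in> B \<and> y \<in> B")
      case True
      have "0 \<le> exp 2 * k * (occ s x + occ s y)" using k occ_nonneg by (intro mult_nonneg_nonneg add_nonneg_nonneg) auto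
      then show ?thesis using occ2_le_occ[OF s, of x y] occ_le_1[OF s, of x] True by simp
    next
      case nB: False
      have "occ s x * occ s y \<le> k * (occ s x + occ s y)"
      proof (cases "x \<in> B")
        case True
        then have "occ s x * occ s y \<le> occ s x * k" using nB outside occ_nonneg by (intro mult_left_mono) auto
        moreover have "0 \<le> k * occ s y" using k occ_nonneg by simp
        ultimately show ?thesis by (simp add: algebra_simps)
      next
        case False
        then have "occ s x * occ s y \<le> k * occ s y" using outside occ_nonneg by (intro mult_right_mono) auto
        moreover have "0 \<le> k * occ s x" using k occ_nonneg by simp
        ultimately show ?thesis by (simp add: algebra_simps)
      qed
      then have "exp 2 * (occ s x * occ s y) \<le> exp 2 * (k * (occ s x + occ s y))" by (intro mult_left_mono) auto
      then have "occ2 s x y \<le> exp 2 * (k * (occ s x + occ s y))"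
        using occ2_le[OF s False] by linarith
      moreover have "of_bool (x \<in> B \<and> y \<in> B) = (0 :: real)" using nB by simp
      ultimately show ?thesis by (simp only: mult.assoc add_0)
    qed
    from mult_left_mono[OF this grad_nonneg[of r x y]] show ?thesis
      by (simp add: grad_commute[of r y x] algebra_simps)
  qed
  have "(\<Sum>x\<in>I. \<Sum>y\<in>I. grad r x y * occ2 s x y) \<le> (\<Sum>x\<in>I. \<Sum>y\<in>I. grad r x y * of_bool (x \<in> B \<and> y \<in> B) + (exp 2 * k * (grad r x y * occ s x) + exp 2 * k * (grad r y x * occ s y)))"
    by (intro sum_mono termwise)
  also have "\<dots> = (\<Sum>x\<in>I. \<Sum>y\<in>I. grad r x y * of_bool (x \<in> B \<and> y \<in> B))
      + (exp 2 * k * (\<Sum>x\<in>I. \<Sum>y\<in>I. grad r x y * occ s x) + exp 2 * k * (\<Sum>x\<in>I. \<Sum>y\<in>I. grad r y x * occ s y))"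
    by (simp add: sum.distrib sum_distrib_left)
  also have "(\<Sum>x\<in>I. \<Sum>y\<in>I. grad r y x * occ s y) = (\<Sum>x\<in>I. \<Sum>y\<in>I. grad r x y * occ s x)"
    by (rule sum.swap)
  also have "(\<Sum>x\<in>I. \<Sum>y\<in>I. grad r x y * of_bool (x \<in> B \<and> y \<in> B)) = (\<Sum>x\<in>I \<inter> B. \<Sum>y\<in>I \<inter> B. grad r x y)"
  proof -
    have "(\<Sum>y\<in>I. grad r x y * of_bool (x \<in> B \<and> y \<in> B)) = of_bool (x \<in> B) * (\<Sum>y\<in>I \<inter> B. grad r x y)" for x
      unfolding sum.inter_restrict[OF I] by (cases "x \<in> B") (auto intro!: sum.cong)
    then show ?thesis
      unfolding sum.inter_restrict[OF I, of "\<lambda>x. \<Sum>y\<in>I \<inter> B. grad r x y"] by (auto intro!: sum.cong)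
  qed
  finally have "(\<Sum>x\<in>I. \<Sum>y\<in>I. grad r x y * occ2 s x y)
      \<le> (\<Sum>x\<in>I \<inter> B. \<Sum>y\<in>I \<inter> B. grad r x y) + 2 * (exp 2 * k * (\<Sum>x\<in>I. \<Sum>y\<in>I. grad r x y * occ s x))"
    by (simp only: mult_2)
  moreover have "(\<Sum>x\<in>I. \<Sum>y\<in>I. grad r x y / 2 * occ2 s x y) = (\<Sum>x\<in>I. \<Sum>y\<in>I. grad r x y * occ2 s x y) / 2"
    by (simp add: sum_divide_distrib)
  ultimately show ?thesis by linarith
qed

text \<open>The product observable is corrected by \<open>exp 2 * k\<close> times
  \<open>lin_obs\<close> of \<open>g\<^sup>2\<close>, whose gain compensates the pairs outside
  \<open>B\<close>. At the final time \<open>g\<close> is an indicator, so the correction is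
  \<open>exp 2 * k\<close> times the intensity; at time 0 it is nonnegative and can be
  discarded.\<close>

theorem mean_prod_obs_ge:
  fixes B :: "int set" and k c \<tau> :: real
  assumes k: "k \<ge> 0" and outside: "\<And>s x. 0 \<le> s \<Longrightarrow> s \<le> t \<Longrightarrow> x \<notin> B \<Longrightarrow> occ s x \<le> k"
    and inside: "\<And>r I. 0 < r \<Longrightarrow> r \<le> t \<Longrightarrow> finite I \<Longrightarrow> (\<Sum>x\<in>I \<inter> B. \<Sum>y\<in>I \<inter> B. grad r x y) \<le> 2 * c / sqrt r"
    and small: "\<And>z. g t z * \<rho> z \<le> \<tau>" and tau: "\<tau> \<le> 1 / 2"
  shows "exp (- ((1 + 2 * \<tau>) * intensity A (\<lambda>_. 1) t)) - exp 2 * k * intensity A (\<lambda>_. 1) t - 2 * c * sqrt t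
    \<le> mean t (prod_obs A (\<lambda>_. 1))"
proof -
  let ?I = "\<lambda>n. {- int n..int n}" and ?g' = "walk_avg_deriv p A (\<lambda>_. 1)" and ?\<Lambda> = "intensity A (\<lambda>_. 1) t"
  define \<kappa> where "\<kappa> = exp 2 * k"
  have \<kappa>: "\<kappa> \<ge> 0" using k by (simp add: \<kappa>_def)
  have gr0: "g t z * \<rho> z \<ge> 0" for z using g01[OF t] rho01 by simp
  have tau0: "\<tau> \<ge> 0" using gr0[of 0] small[of 0] by linarith
  have step: "(\<Prod>x\<in>I. 1 - g t x * \<rho> x) - 2 * c * sqrt t
      \<le> mean t (prod_obs I (g 0)) + \<kappa> * mean t (lin_obs I (\<lambda>x. (g 0 x)\<^sup>2)) + (2 + \<kappa>) * tail_err p env I * t" if I: "finite I" for I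
  proof -
    \<comment> \<open>The derivative of \<open>- 2 * c * sqrt (t - s)\<close> is
      \<open>c / sqrt (t - s)\<close>, which matches the loss on pairs inside \<open>B\<close>. In
      the last term, 2 stands for the truncation error of the product observable and
      \<open>\<kappa>\<close> for that of the quadratic one.\<close>
    define \<Phi> where "\<Phi> = (\<lambda>s. mean s (prod_obs I (g (t - s))) + \<kappa> * mean s (lin_obs I (\<lambda>x. (g (t - s) x)\<^sup>2))
        - 2 * c * sqrt (t - s) + (2 + \<kappa>) * tail_err p env I * s)"
    note dyn1 = dynkin[OF I depends_on_prod_obs[OF order_refl] depends_on_prod_obs_deriv[OF A t] prod_obs_has_derivative[OF A t I]]
    have der2: "((\<lambda>r. lin_obs I (\<lambda>x. (g r x)\<^sup>2) \<zeta>) has_real_derivative lin_obs I (\<lambda>x. 2 * g r x * ?g' r x) \<zeta>) (at r)" if "0 \<le> r" for r \<zeta>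
    proof -
      have "((\<lambda>r. (g r x)\<^sup>2) has_real_derivative 2 * g r x * ?g' r x) (at r)" for x
        using DERIV_power[OF walk_avg_has_derivative[OF that, of p A "\<lambda>_. 1" x], of 2] by (simp add: mult_ac)
      then show ?thesis unfolding lin_obs_def by (intro DERIV_sum DERIV_cmult_right)
    qed
    note dyn2 = dynkin[OF I depends_on_lin_obs depends_on_lin_obs der2]
    have "\<Phi> 0 \<le> \<Phi> t"
    proof (rule mono_of_right_derivative[OF t])
      show "continuous_on {0..t} \<Phi>"
        unfolding \<Phi>_def by (intro continuous_intros dyn1(1) dyn2(1))
      fix s assume s: "0 \<le> s" "s < t"
      define D1 where "D1 = mean s (exclusion_pregenerator p (prod_obs I (g (t - s)))) - mean s (prod_obs_deriv A (\<lambda>_. 1) I (t - s))"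
      define D2 where "D2 = mean s (exclusion_pregenerator p (lin_obs I (\<lambda>x. (g (t - s) x)\<^sup>2))) - mean s (lin_obs I (\<lambda>x. 2 * g (t - s) x * ?g' (t - s) x))"
      have d1: "((\<lambda>s. mean s (prod_obs I (g (t - s)))) has_real_derivative D1) (at s within {s..})"
        unfolding D1_def using s by (intro dyn1(2)) auto
      have d2: "((\<lambda>s. mean s (lin_obs I (\<lambda>x. (g (t - s) x)\<^sup>2))) has_real_derivative D2) (at s within {s..})"
        unfolding D2_def using s by (intro dyn2(2)) auto
      have d3: "((\<lambda>s. 2 * c * sqrt (t - s)) has_real_derivative - (c / sqrt (t - s))) (at s within {s..})"
        using s by (auto intro!: derivative_eq_intros simp: field_simps)
      have d: "(\<Phi> has_real_derivative (D1 + \<kappa> * D2 - (- (c / sqrt (t - s))) + (2 + \<kappa>) * tail_err p env I * 1)) (at s within {s..})"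
        unfolding \<Phi>_def by (intro DERIV_add DERIV_diff DERIV_cmult d1 d2 d3 DERIV_ident)
      let ?W = "\<Sum>x\<in>I. \<Sum>y\<in>I. grad (t - s) x y * occ s x"
      have "D1 \<ge> mean s (\<lambda>\<zeta>. - (\<Sum>x\<in>I. \<Sum>y\<in>I. grad (t - s) x y / 2 * (of_bool (\<zeta> x) * of_bool (\<zeta> y))) - 2 * tail_err p env I)"
        unfolding D1_def
      proof (rule mean_ge[OF I depends_on_prod_obs[OF order_refl] I depends_on_prod_obs_deriv[OF A t] I _ s(1)])
        show "depends_on I (\<lambda>\<zeta>. - (\<Sum>x\<in>I. \<Sum>y\<in>I. grad (t - s) x y / 2 * (of_bool (\<zeta> x) * of_bool (\<zeta> y))) - 2 * tail_err p env I)"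
          by (auto simp: depends_on_def intro!: sum.cong)
      qed (rule prod_obs_drift[OF I], use s in auto)
      then have D1: "D1 \<ge> - (\<Sum>x\<in>I. \<Sum>y\<in>I. grad (t - s) x y / 2 * occ2 s x y) - 2 * tail_err p env I"
        by (simp only: mean_double_sum(1)[OF I s(1)])
      have "D2 \<ge> mean s (\<lambda>\<zeta>. (\<Sum>x\<in>I. \<Sum>y\<in>I. grad (t - s) x y * of_bool (\<zeta> x)) - tail_err p env I)"
        unfolding D2_def
      proof (rule mean_ge[OF I depends_on_lin_obs I depends_on_lin_obs I _ s(1)])
        show "depends_on I (\<lambda>\<zeta>. (\<Sum>x\<in>I. \<Sum>y\<in>I. grad (t - s) x y * of_bool (\<zeta> x)) - tail_err p env I)"
          by (auto simp: depends_on_def intro!: sum.cong)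
      qed (rule lin_obs_drift[OF I], use s in auto)
      then have "D2 \<ge> ?W - tail_err p env I"
        by (simp only: mean_double_sum(2)[OF I s(1)])
      from mult_left_mono[OF this \<kappa>] have D2: "\<kappa> * D2 \<ge> \<kappa> * ?W - \<kappa> * tail_err p env I" by (simp add: right_diff_distrib)
      have "(\<Sum>x\<in>I. \<Sum>y\<in>I. grad (t - s) x y / 2 * occ2 s x y) \<le> (\<Sum>x\<in>I \<inter> B. \<Sum>y\<in>I \<inter> B. grad (t - s) x y) / 2 + \<kappa> * ?W"
        unfolding \<kappa>_def by (rule occupation_gradient_bound[OF I s(1) k]) (use outside s in auto)
      also have "(\<Sum>x\<in>I \<inter> B. \<Sum>y\<in>I \<inter> B. grad (t - s) x y) / 2 \<le> c / sqrt (t - s)"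
        using inside[of "t - s" I] s I by (simp add: field_simps)
      finally have "D1 + \<kappa> * D2 - (- (c / sqrt (t - s))) + (2 + \<kappa>) * tail_err p env I * 1 \<ge> 0"
        using D1 D2 by (simp add: algebra_simps)
      with d show "\<exists>D\<ge>0. (\<Phi> has_real_derivative D) (at s within {s..})" by blast
    qed
    moreover have "mean 0 (lin_obs I (\<lambda>x. (g t x)\<^sup>2)) \<ge> 0"
      unfolding mean_0_lin_obs[OF I] using rho01 by (intro sum_nonneg mult_nonneg_nonneg) auto
    then have "\<kappa> * mean 0 (lin_obs I (\<lambda>x. (g t x)\<^sup>2)) \<ge> 0" using \<kappa> by simp
    ultimately show ?thesis by (simp add: \<Phi>_def mean_0_prod_obs[OF I])
  qed
  have prod_ge: "exp (- ((1 + 2 * \<tau>) * ?\<Lambda>)) \<le> (\<Prod>x\<in>I. 1 - g t x * \<rho> x)" if I: "finite I" for I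
  proof -
    have "(\<Sum>x\<in>I. g t x * \<rho> x) \<le> ?\<Lambda>"
      by (rule finite_sum_le_has_sum[OF intensity_has_sum[OF A t] I]) (use gr0 in auto)
    then have "exp (- ((1 + 2 * \<tau>) * ?\<Lambda>)) \<le> exp (- ((1 + 2 * \<tau>) * (\<Sum>x\<in>I. g t x * \<rho> x)))"
      using tau0 by (simp add: mult_left_mono)
    also have "\<dots> = (\<Prod>x\<in>I. exp (- ((1 + 2 * \<tau>) * (g t x * \<rho> x))))"
      using I by (simp add: exp_sum[symmetric] sum_negf sum_distrib_left)
    also have "\<dots> \<le> (\<Prod>x\<in>I. 1 - g t x * \<rho> x)"
      using one_minus_ge_exp[OF gr0 small tau] by (intro prod_mono conjI) auto
    finally show ?thesis .
  qed
  have lim: "(\<lambda>n. mean t (prod_obs A (\<lambda>_. 1)) + \<kappa> * ?\<Lambda> + (2 + \<kappa>) * tail_err p env (?I n) * t)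
      \<longlonglongrightarrow> mean t (prod_obs A (\<lambda>_. 1)) + \<kappa> * ?\<Lambda> + (2 + \<kappa>) * 0 * t"
    by (intro tendsto_intros tail_err_tendsto[OF envelope_has_sum[OF A t]] envelope_nonneg[OF A t])
  have "eventually (\<lambda>n. exp (- ((1 + 2 * \<tau>) * ?\<Lambda>)) - 2 * c * sqrt t
      \<le> mean t (prod_obs A (\<lambda>_. 1)) + \<kappa> * ?\<Lambda> + (2 + \<kappa>) * tail_err p env (?I n) * t) sequentially"
    using eventually_A_subset[OF A t]
  proof eventually_elim
    case (elim n)
    have 1: "prod_obs (?I n) (g 0) = prod_obs A (\<lambda>_. 1)"
      using prod_obs_extend[OF _ elim, of "\<lambda>_. 1"] by (auto simp: walk_avg_0[OF A] fun_eq_iff prod_obs_def)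
    have "lin_obs (?I n) (\<lambda>x. (g 0 x)\<^sup>2) = lin_obs A (\<lambda>_. 1)"
      using lin_obs_extend[OF _ elim, of "\<lambda>_. 1"] by (auto simp: walk_avg_0[OF A] fun_eq_iff lin_obs_def intro!: sum.cong)
    then have 2: "mean t (lin_obs (?I n) (\<lambda>x. (g 0 x)\<^sup>2)) = ?\<Lambda>"
      by (simp add: mean_lin_obs_eq_intensity[OF A t])
    show ?case using step[of "?I n"] prod_ge[of "?I n"] unfolding 1 2 by simp
  qed
  with lim have "exp (- ((1 + 2 * \<tau>) * ?\<Lambda>)) - 2 * c * sqrt t \<le> mean t (prod_obs A (\<lambda>_. 1)) + \<kappa> * ?\<Lambda> + (2 + \<kappa>) * 0 * t"
    by (rule tendsto_lowerbound) simp
  then show ?thesis by (simp add: \<kappa>_def)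
qed

end

end


section \<open>Particles to the right of a level\<close>

locale exclusion_step = symmetric_walk p \<theta>\<^sub>0 \<sigma> + exclusion_from_product p S M \<eta> \<rho>
  for p \<theta>\<^sub>0 \<sigma> S and M :: "'a measure" and \<eta> \<rho> +
  assumes rho_right: "x > 0 \<Longrightarrow> \<rho> x = 0"
begin

section \<open>The expected number of particles beyond a level\<close>

definition rho_sum :: "nat \<Rightarrow> real" where
  "rho_sum k = (\<Sum>j<k. \<rho> (- int j))"

text \<open>A displacement by \<open>N + k\<close> carries exactly the initial sites above
  \<open>- k\<close> beyond \<open>N\<close>, and those that may be occupied are
  \<open>0, -1, ..., 1 - k\<close>. Hence \<open>rho_sum k\<close> is the expected number of
  particles carried across, and \<open>rate\<close> averages it over the displacement of the
  walk.\<close>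

definition rate :: "real \<Rightarrow> int \<Rightarrow> real" where
  "rate t N = (\<Sum>\<^sub>\<infinity>k. walk_prob p t (N + int k) * rho_sum k)"

text \<open>A finite stand-in for the half-line beyond \<open>N\<close>, so that the vacancy
  observable is a cylinder function.\<close>

definition window :: "int \<Rightarrow> nat \<Rightarrow> int set" where
  "window N n = {N<..N + int n}"

lemma finite_window [simp]: "finite (window N n)"
  by (simp add: window_def)

lemma window_image: "window N n = (\<lambda>i. N + 1 + int i) ` {..<n}"
proof (intro set_eqI iffI)
  fix x assume "x \<in> window N n"
  then have "x = N + 1 + int (nat (x - N - 1))" "nat (x - N - 1) < n" by (auto simp: window_def)
  then show "x \<in> (\<lambda>i. N + 1 + int i) ` {..<n}" by blast
qed (auto simp: window_def)

lemma rho_sum_bound: "\<bar>rho_sum k\<bar> \<le> real k"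
proof -
  have "\<bar>rho_sum k\<bar> \<le> (\<Sum>j<k. \<bar>\<rho> (- int j)\<bar>)" unfolding rho_sum_def by (rule sum_abs)
  also have "\<dots> \<le> (\<Sum>j<k. 1)" using rho01 by (intro sum_mono) auto
  finally show ?thesis by simp
qed

lemma rate_has_sum: "t \<ge> 0 \<Longrightarrow> ((\<lambda>k. walk_prob p t (N + int k) * rho_sum k) has_sum rate t N) UNIV"
  unfolding rate_def by (rule walk_series_inversion(1)[OF rho_sum_bound exponent_pos order_refl])

lemma occ_has_sum:
  assumes t: "t \<ge> 0"
  shows "((\<lambda>k. walk_prob p t (N + int k) * \<rho> (1 + int i - int k)) has_sum occ t (N + 1 + int i)) UNIV"
proof -
  let ?f = "\<lambda>z. walk_prob p t (N + 1 + int i - z) * \<rho> z"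
  have "(?f has_sum occ t (N + 1 + int i)) UNIV"
    using intensity_has_sum[of "{N + 1 + int i}" t "\<lambda>_. 1"] t by (simp add: occ_eq_walk walk_avg_def)
  \<comment> \<open>The index \<open>k\<close> reaches only the sites \<open>z \<le> 1 + i\<close>;
    all others are positive and have density 0.\<close>
  moreover have "(?f has_sum occ t (N + 1 + int i)) UNIV \<longleftrightarrow> (?f has_sum occ t (N + 1 + int i)) (range (\<lambda>k. 1 + int i - int k))"
  proof (rule has_sum_cong_neutral)
    fix z assume "z \<in> UNIV - range (\<lambda>k. 1 + int i - int k)"
    then have "z \<noteq> 1 + int i - int (nat (1 + int i - z))" by blast
    then have "z > 0" by (cases "z \<le> 1 + int i") auto
    then show "?f z = 0" by (simp add: rho_right)
  qed auto
  ultimately have "((?f \<circ> (\<lambda>k. 1 + int i - int k)) has_sum occ t (N + 1 + int i)) UNIV"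
    by (subst has_sum_reindex[symmetric]) (auto simp: inj_on_def)
  then show ?thesis by (simp add: o_def)
qed

lemma intensity_window_has_sum:
  assumes t: "t \<ge> 0"
  shows "((\<lambda>k. walk_prob p t (N + int k) * (\<Sum>i<n. \<rho> (1 + int i - int k))) has_sum intensity (window N n) (\<lambda>_. 1) t) UNIV"
proof -
  have "intensity (window N n) (\<lambda>_. 1) t = (\<Sum>x\<in>window N n. occ t x)"
    using mean_lin_obs_eq_intensity[of "window N n" t "\<lambda>_. 1"] mean_lin_obs_occ[of "window N n" t "\<lambda>_. 1"] t by simp
  also have "\<dots> = (\<Sum>i<n. occ t (N + 1 + int i))"
    unfolding window_image by (subst sum.reindex) (auto simp: inj_on_def)
  finally have eq: "intensity (window N n) (\<lambda>_. 1) t = (\<Sum>i<n. occ t (N + 1 + int i))" .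
  show ?thesis
    unfolding eq sum_distrib_left by (intro has_sum_finite_sum occ_has_sum t) auto
qed

text \<open>Seen from the displacement \<open>N + k\<close>, the window of length \<open>n\<close>
  receives the initial sites from \<open>1 - k\<close> to \<open>n - k\<close>. Those above 0 carry
  no mass, so the sum is complete as soon as \<open>k \<le> n\<close>.\<close>

lemma rho_partial_sum_le: "(\<Sum>i<n. \<rho> (1 + int i - int k)) \<le> rho_sum k"
  and rho_partial_sum_eq: "k \<le> n \<Longrightarrow> (\<Sum>i<n. \<rho> (1 + int i - int k)) = rho_sum k"
proof -
  have full: "(\<Sum>i<k. \<rho> (1 + int i - int k)) = rho_sum k"
  proof -
    have "(\<Sum>i<k. \<rho> (1 + int i - int k)) = (\<Sum>i<k. \<rho> (1 + int (k - Suc i) - int k))"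
      by (rule sum.nat_diff_reindex[symmetric])
    also have "\<dots> = rho_sum k"
      unfolding rho_sum_def by (intro sum.cong) (auto simp: of_nat_diff)
    finally show ?thesis .
  qed
  show eq: "(\<Sum>i<n. \<rho> (1 + int i - int k)) = rho_sum k" if "k \<le> n"
  proof -
    have "(\<Sum>i<n. \<rho> (1 + int i - int k)) = (\<Sum>i<k. \<rho> (1 + int i - int k))"
      using that by (intro sum.mono_neutral_right) (auto intro: rho_right)
    with full show ?thesis by simp
  qed
  show "(\<Sum>i<n. \<rho> (1 + int i - int k)) \<le> rho_sum k"
  proof (cases "k \<le> n")
    case True
    then show ?thesis using eq by simp
  next
    case False
    have "(\<Sum>i<n. \<rho> (1 + int i - int k)) \<le> (\<Sum>i<k. \<rho> (1 + int i - int k))"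
      using False rho01 by (intro sum_mono2) auto
    with full show ?thesis by simp
  qed
qed

lemma intensity_window_le: "t \<ge> 0 \<Longrightarrow> intensity (window N n) (\<lambda>_. 1) t \<le> rate t N"
  by (rule has_sum_mono[OF intensity_window_has_sum rate_has_sum])
     (auto intro!: mult_left_mono rho_partial_sum_le walk_prob_nonneg)

lemma intensity_window_nonneg: "t \<ge> 0 \<Longrightarrow> intensity (window N n) (\<lambda>_. 1) t \<ge> 0"
  by (rule has_sum_nonneg[OF intensity_window_has_sum])
     (auto intro!: mult_nonneg_nonneg sum_nonneg rho01 walk_prob_nonneg)

lemma rate_nonneg: "t \<ge> 0 \<Longrightarrow> rate t N \<ge> 0"
  using intensity_window_le intensity_window_nonneg order_trans by blast

text \<open>The terms with \<open>k < n\<close> agree in both series, so the intensity is squeezed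
  between the partial sums of the series for \<open>rate\<close> and its limit.\<close>

lemma intensity_window_tendsto:
  assumes t: "t \<ge> 0"
  shows "(\<lambda>n. intensity (window N n) (\<lambda>_. 1) t) \<longlonglongrightarrow> rate t N"
proof (rule tendsto_sandwich[where h = "\<lambda>_. rate t N"])
  show "(\<lambda>n. \<Sum>k<n. walk_prob p t (N + int k) * rho_sum k) \<longlonglongrightarrow> rate t N"
    using has_sum_imp_sums[OF rate_has_sum[OF t]] by (simp add: sums_def)
  show "eventually (\<lambda>n. (\<Sum>k<n. walk_prob p t (N + int k) * rho_sum k) \<le> intensity (window N n) (\<lambda>_. 1) t) sequentially"
  proof (intro always_eventually allI)
    fix n
    have "(\<Sum>k<n. walk_prob p t (N + int k) * rho_sum k) = (\<Sum>k<n. walk_prob p t (N + int k) * (\<Sum>i<n. \<rho> (1 + int i - int k)))"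
      by (intro sum.cong) (auto simp: rho_partial_sum_eq)
    also have "\<dots> \<le> intensity (window N n) (\<lambda>_. 1) t"
      using t by (intro finite_sum_le_has_sum[OF intensity_window_has_sum])
        (auto intro!: mult_nonneg_nonneg sum_nonneg rho01 walk_prob_nonneg)
    finally show "(\<Sum>k<n. walk_prob p t (N + int k) * rho_sum k) \<le> intensity (window N n) (\<lambda>_. 1) t" .
  qed
qed (use t in \<open>auto intro!: always_eventually intensity_window_le\<close>)

section \<open>The emptiness event as a limit over windows\<close>

definition empty_beyond :: "real \<Rightarrow> int \<Rightarrow> 'a set" where
  "empty_beyond t N = {\<omega> \<in> space M. \<forall>x>N. \<not> \<eta> t \<omega> x}"

lemma site_event [measurable]: "t \<ge> 0 \<Longrightarrow> {\<omega> \<in> space M. \<eta> t \<omega> x} \<in> events"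
proof -
  assume t: "t \<ge> 0"
  have "(\<lambda>\<omega>. of_bool (\<eta> t \<omega> x) :: real) \<in> borel_measurable M"
    using integrable_of_bool[OF t] by (rule borel_measurable_integrable)
  then have "(\<lambda>\<omega>. of_bool (\<eta> t \<omega> x) :: real) -` {1} \<inter> space M \<in> events" by measurable
  moreover have "(\<lambda>\<omega>. of_bool (\<eta> t \<omega> x) :: real) -` {1} \<inter> space M = {\<omega> \<in> space M. \<eta> t \<omega> x}" by auto
  ultimately show ?thesis by simp
qed

lemma empty_window_event: "t \<ge> 0 \<Longrightarrow> {\<omega> \<in> space M. \<forall>x\<in>window N n. \<not> \<eta> t \<omega> x} \<in> events"
proof -
  assume t: "t \<ge> 0"
  have "{\<omega> \<in> space M. \<forall>x\<in>window N n. \<not> \<eta> t \<omega> x} = space M - (\<Union>x\<in>window N n. {\<omega> \<in> space M. \<eta> t \<omega> x})" by auto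
  then show ?thesis using site_event[OF t] by auto
qed

lemma empty_beyond_eq: "empty_beyond t N = (\<Inter>n. {\<omega> \<in> space M. \<forall>x\<in>window N n. \<not> \<eta> t \<omega> x})"
proof -
  have "\<exists>n. x \<in> window N n" if "x > N" for x
    using that by (intro exI[of _ "nat (x - N)"]) (auto simp: window_def)
  then show ?thesis by (fastforce simp: empty_beyond_def window_def)
qed

lemma empty_beyond_event: "t \<ge> 0 \<Longrightarrow> empty_beyond t N \<in> events"
  unfolding empty_beyond_eq using empty_window_event by auto

lemma mean_empty_window:
  assumes "t \<ge> 0"
  shows "mean t (prod_obs (window N n) (\<lambda>_. 1)) = prob {\<omega> \<in> space M. \<forall>x\<in>window N n. \<not> \<eta> t \<omega> x}"
proof -
  have "prod_obs (window N n) (\<lambda>_. 1) \<zeta> = of_bool (\<forall>x\<in>window N n. \<not> \<zeta> x)" for \<zeta>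
    by (auto simp: prod_obs_def prod_zero_iff)
  then have "mean t (prod_obs (window N n) (\<lambda>_. 1)) = (\<integral>\<omega>. indicator {\<omega> \<in> space M. \<forall>x\<in>window N n. \<not> \<eta> t \<omega> x} \<omega> \<partial>M)"
    unfolding mean_def by (intro Bochner_Integration.integral_cong) (auto simp: indicator_def)
  also have "\<dots> = prob {\<omega> \<in> space M. \<forall>x\<in>window N n. \<not> \<eta> t \<omega> x}"
    using empty_window_event[OF assms] by simp
  finally show ?thesis .
qed

lemma prob_empty_tendsto:
  assumes t: "t \<ge> 0"
  shows "(\<lambda>n. mean t (prod_obs (window N n) (\<lambda>_. 1))) \<longlonglongrightarrow> prob (empty_beyond t N)"
  unfolding mean_empty_window[OF t] empty_beyond_eq
proof (rule finite_Lim_measure_decseq)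
  show "range (\<lambda>n. {\<omega> \<in> space M. \<forall>x\<in>window N n. \<not> \<eta> t \<omega> x}) \<subseteq> events" using empty_window_event[OF t] by auto
  show "decseq (\<lambda>n. {\<omega> \<in> space M. \<forall>x\<in>window N n. \<not> \<eta> t \<omega> x})"
    unfolding decseq_def window_def by auto
qed

lemma prob_empty_le:
  assumes t: "t \<ge> 0"
  shows "prob (empty_beyond t N) \<le> exp (- rate t N)"
proof (rule LIMSEQ_le[OF prob_empty_tendsto[OF t]])
  show "(\<lambda>n. exp (- intensity (window N n) (\<lambda>_. 1) t)) \<longlonglongrightarrow> exp (- rate t N)"
    by (intro tendsto_intros intensity_window_tendsto t)
  show "\<exists>n0. \<forall>n\<ge>n0. mean t (prod_obs (window N n) (\<lambda>_. 1)) \<le> exp (- intensity (window N n) (\<lambda>_. 1) t)"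
    by (intro exI allI impI mean_prod_obs_le) (use t in auto)
qed

lemma rmgf_ge_1: "\<bar>\<theta>\<bar> \<le> \<theta>\<^sub>0 \<Longrightarrow> rmgf p \<theta> \<ge> 1"
proof -
  assume th: "\<bar>\<theta>\<bar> \<le> \<theta>\<^sub>0"
  have "Re (mgf p (Complex \<theta> 0)) \<le> rmgf p \<theta> - gap 0" by (rule Re_mgf_gap[OF th])
  have 2: "((\<lambda>k. pmf p k * cosh (\<theta> * of_int k)) has_sum rmgf p \<theta>) UNIV"
    using has_sum_Re[OF mgf_has_sum_cosh[of "of_real \<theta>"]] th
    by (simp add: mgf_of_real Re_exp cosh_def algebra_simps add_divide_distrib)
  show ?thesis
  proof (rule has_sum_mono[OF pmf_has_sum_1[of p] 2])
    fix k :: int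
    show "pmf p k \<le> pmf p k * cosh (\<theta> * of_int k)"
      using mult_left_mono[OF cosh_real_ge_1[of "\<theta> * of_int k"], of "pmf p k"] by simp
  qed
qed

text \<open>A Chernoff bound for reaching \<open>x\<close> from the left half-line: at sites
  \<open>z \<le> 0\<close> the density is at most \<open>1 \<le> exp (- \<theta> * z)\<close>, which
  completes the sum to a moment generating function. As \<open>rmgf p \<theta> \<ge> 1\<close>, the
  result increases with time, so \<open>t\<close> may replace \<open>s\<close>.\<close>

lemma occ_exp_bound:
  assumes "0 \<le> \<theta>" "\<theta> \<le> \<theta>\<^sub>0" "0 \<le> s" "s \<le> t"
  shows "occ s x \<le> exp (t * (rmgf p \<theta> - 1) - \<theta> * of_int x)"
proof -
  have th: "\<bar>\<theta>\<bar> \<le> \<theta>\<^sub>0" using assms by simp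
  let ?q = "\<lambda>w. walk_prob p s w * exp (\<theta> * of_int w) * exp (- (\<theta> * of_int x))"
  have w: "(?q has_sum exp (s * (rmgf p \<theta> - 1)) * exp (- (\<theta> * of_int x))) UNIV"
    by (intro has_sum_cmult_left walk_prob_rmgf th assms)
  then have w': "((\<lambda>z. ?q (x - z)) has_sum exp (s * (rmgf p \<theta> - 1)) * exp (- (\<theta> * of_int x))) UNIV"
    using has_sum_reflect_int[of ?q x] by simp
  have o: "((\<lambda>z. walk_prob p s (x - z) * \<rho> z) has_sum occ s x) UNIV"
    using intensity_has_sum[of "{x}" s "\<lambda>_. 1"] assms by (simp add: occ_eq_walk walk_avg_def)
  have "occ s x \<le> exp (s * (rmgf p \<theta> - 1)) * exp (- (\<theta> * of_int x))"
  proof (rule has_sum_mono[OF o w'])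
    fix z :: int
    show "walk_prob p s (x - z) * \<rho> z \<le> ?q (x - z)"
    proof (cases "z > 0")
      case True
      then show ?thesis using walk_prob_nonneg[OF assms(3)] by (simp add: rho_right)
    next
      case False
      then have "\<theta> * of_int z \<le> 0" using assms by (simp add: mult_nonneg_nonpos)
      then have "1 \<le> exp (\<theta> * of_int (x - z)) * exp (- (\<theta> * of_int x))"
        by (simp add: algebra_simps flip: exp_add)
      with rho01[of z] have "\<rho> z \<le> exp (\<theta> * of_int (x - z)) * exp (- (\<theta> * of_int x))" by linarith
      from mult_left_mono[OF this walk_prob_nonneg[OF assms(3), of p "x - z"]]
      show ?thesis by (simp only: mult.assoc)
    qed
  qed
  also have "\<dots> = exp (s * (rmgf p \<theta> - 1) - \<theta> * of_int x)" by (simp add: exp_diff exp_minus divide_inverse)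
  also have "\<dots> \<le> exp (t * (rmgf p \<theta> - 1) - \<theta> * of_int x)"
    using mult_right_mono[OF assms(4), of "rmgf p \<theta> - 1"] rmgf_ge_1[OF th] by simp
  finally show ?thesis .
qed

text \<open>The increments of \<open>g r\<close> telescope: \<open>g r (x + 1) - g r x\<close> is the difference of two
  transition probabilities, so the squared gradient is at most \<open>h\<^sup>2\<close> times the largest
  transition probability times the tail.\<close>

lemma window_grad_bound:
  assumes r: "0 \<le> r" and J: "finite J" "\<And>x. x \<in> J \<Longrightarrow> x \<le> K"
    and P: "\<And>w. w > N - K \<Longrightarrow> walk_prob p r w \<le> P"
    and T: "(\<Sum>\<^sub>\<infinity>w\<in>{N - K + 1..}. walk_prob p r w) \<le> T"
  shows "(\<Sum>x\<in>J. \<Sum>y\<in>J. grad (window N n) r x y) \<le> 8 * \<sigma>\<^sup>2 * P * T"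
proof -
  let ?g = "walk_avg p (window N n) (\<lambda>_. 1) r"
  \<comment> \<open>One boundary term for each end of the window: all interior terms of the
    increment telescope.\<close>
  define d where "d = (\<lambda>x. walk_prob p r (N - x) + walk_prob p r (N + int n - x))"
  have d0: "d x \<ge> 0" for x using walk_prob_nonneg[OF r] by (simp add: d_def)
  have step: "\<bar>?g (x + 1) - ?g x\<bar> \<le> d x" for x
  proof -
    have gi: "?g x = (\<Sum>i<n. walk_prob p r (N + 1 + int i - x))" for x
      unfolding walk_avg_def window_image by (subst sum.reindex) (auto simp: inj_on_def)
    have tele: "(\<Sum>i<n. walk_prob p r (N + int i - x) - walk_prob p r (N + 1 + int i - x))
        = walk_prob p r (N - x) - walk_prob p r (N + int n - x)"
      using sum_lessThan_telescope'[of "\<lambda>i. walk_prob p r (N + int i - x)" n] by (simp add: ac_simps)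
    have "?g (x + 1) - ?g x = walk_prob p r (N - x) - walk_prob p r (N + int n - x)"
    proof -
      have shift: "N + 1 + int i - (x + 1) = N + int i - x" for i by simp
      show ?thesis unfolding gi[of x] gi[of "x + 1"] tele[symmetric] sum_subtractf shift ..
    qed
    then show ?thesis using walk_prob_nonneg[OF r, of p] by (simp add: d_def abs_le_iff add_nonneg_nonneg add_increasing add_increasing2)
  qed
  have incr: "\<bar>?g (x + int h) - ?g x\<bar> \<le> (\<Sum>i<h. d (x + int i))" for x h
  proof (induction h)
    case (Suc h)
    have "?g (x + int (Suc h)) - ?g x = (?g (x + int h + 1) - ?g (x + int h)) + (?g (x + int h) - ?g x)" by (simp add: ac_simps)
    also have "\<bar>\<dots>\<bar> \<le> d (x + int h) + (\<Sum>i<h. d (x + int i))"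
      by (intro order_trans[OF abs_triangle_ineq] add_mono step Suc.IH)
    finally show ?case by simp
  qed simp
  have dP: "d x \<le> 2 * P" if "x < K" for x
    using P[of "N - x"] P[of "N + int n - x"] that by (simp add: d_def)
  have P0: "P \<ge> 0" using P[of "N - K + 1"] walk_prob_nonneg[OF r, of p "N - K + 1"] by simp
  have sm: "walk_prob p r summable_on {N - K + 1..}"
    by (rule walk_tail_bound(1)[OF order_refl _ r]) (use exponent_pos in simp)
  have T0: "T \<ge> 0" using T infsum_nonneg[of "{N - K + 1..}" "walk_prob p r"] walk_prob_nonneg[OF r] by fastforce
  have part: "(\<Sum>v\<in>V. walk_prob p r (c - v)) \<le> T" if "finite V" "\<And>v. v \<in> V \<Longrightarrow> v < K" "c \<ge> N" for V c
  proof -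
    have "(\<Sum>v\<in>V. walk_prob p r (c - v)) = (\<Sum>w\<in>(\<lambda>v. c - v) ` V. walk_prob p r w)"
      by (subst sum.reindex) (auto simp: inj_on_def)
    also have "\<dots> \<le> (\<Sum>\<^sub>\<infinity>w\<in>{N - K + 1..}. walk_prob p r w)"
      using that by (intro finite_sum_le_infsum sm) (auto simp: walk_prob_nonneg[OF r] dest: that(2))
    finally show ?thesis using T by linarith
  qed
  have dT: "(\<Sum>v\<in>V. d v) \<le> 2 * T" if "finite V" "\<And>v. v \<in> V \<Longrightarrow> v < K" for V
    unfolding d_def sum.distrib using part[OF that, of N] part[OF that, of "N + int n"] by simp
  define Q where "Q = {z \<in> J \<times> J. fst z < snd z}"
  have Qfin: "finite Q" unfolding Q_def using J(1) by auto
  let ?f = "\<lambda>z. grad (window N n) r (fst z) (snd z)"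
  let ?df = "\<lambda>z. snd z - fst z"
  \<comment> \<open>For a fixed jump length \<open>h\<close>, one factor of the squared increment is
    bounded pointwise by \<open>2 * h * P\<close>; the other, summed over the starting points, is at
    most \<open>2 * h * T\<close>.\<close>
  have inner: "(\<Sum>z\<in>{z \<in> Q. ?df z = h}. ?f z) \<le> 4 * P * T * (pmf p h * (real_of_int h)\<^sup>2)" if h: "h \<in> ?df ` Q" for h
  proof -
    have hpos: "h > 0" using h by (auto simp: Q_def)
    define Qh where "Qh = {z \<in> Q. ?df z = h}"
    have Qh: "finite Qh" using Qfin by (simp add: Qh_def)
    have fz: "?f z \<le> pmf p h * (2 * real_of_int h * P) * (\<Sum>i<nat h. d (fst z + int i))" if z: "z \<in> Qh" for z
    proof -
      obtain x where z_eq: "z = (x, x + h)" using z by (cases z) (auto simp: Qh_def)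
      have xK: "x + h \<le> K" using z J(2) by (auto simp: z_eq Qh_def Q_def)
      have a: "\<bar>?g x - ?g (x + h)\<bar> \<le> (\<Sum>i<nat h. d (x + int i))"
        using incr[of x "nat h"] hpos by (simp add: abs_minus_commute)
      also have "\<dots> \<le> (\<Sum>i<nat h. 2 * P)" using xK by (intro sum_mono dP) auto
      also have "\<dots> = 2 * real_of_int h * P" using hpos by simp
      finally have b: "\<bar>?g x - ?g (x + h)\<bar> \<le> 2 * real_of_int h * P" .
      have "(?g x - ?g (x + h))\<^sup>2 = \<bar>?g x - ?g (x + h)\<bar> * \<bar>?g x - ?g (x + h)\<bar>" by (simp add: power2_eq_square)
      also have "\<dots> \<le> (2 * real_of_int h * P) * (\<Sum>i<nat h. d (x + int i))"
        using hpos P0 by (intro mult_mono a b) auto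
      finally have "(?g x - ?g (x + h))\<^sup>2 \<le> (2 * real_of_int h * P) * (\<Sum>i<nat h. d (x + int i))" .
      from mult_left_mono[OF this pmf_nonneg[of p h]] show ?thesis
        using finite_window by (simp add: z_eq grad_def[OF finite_window r] mult.assoc)
    qed
    have inj: "inj_on (\<lambda>z. fst z + int i) Qh" for i
      by (auto simp: inj_on_def Qh_def)
    have "(\<Sum>z\<in>Qh. ?f z) \<le> (\<Sum>z\<in>Qh. pmf p h * (2 * real_of_int h * P) * (\<Sum>i<nat h. d (fst z + int i)))"
      by (intro sum_mono fz)
    also have "\<dots> = pmf p h * (2 * real_of_int h * P) * (\<Sum>i<nat h. \<Sum>z\<in>Qh. d (fst z + int i))"
      unfolding sum_distrib_left[symmetric] by (subst sum.swap) simp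
    also have "\<dots> \<le> pmf p h * (2 * real_of_int h * P) * (\<Sum>i<nat h. 2 * T)"
    proof (intro mult_left_mono sum_mono)
      fix i assume i: "i \<in> {..<nat h}"
      have "(\<Sum>z\<in>Qh. d (fst z + int i)) = (\<Sum>v\<in>(\<lambda>z. fst z + int i) ` Qh. d v)"
        using inj by (subst sum.reindex) auto
      also have "\<dots> \<le> 2 * T"
      proof (rule dT)
        fix v assume "v \<in> (\<lambda>z. fst z + int i) ` Qh"
        then obtain x where "x + h \<in> J" "v = x + int i" by (auto simp: Qh_def Q_def)
        then show "v < K" using J(2)[of "x + h"] i by auto
      qed (use Qh in auto)
      finally show "(\<Sum>z\<in>Qh. d (fst z + int i)) \<le> 2 * T" .
    qed (use hpos P0 in auto)
    also have "\<dots> = 4 * P * T * (pmf p h * (real_of_int h)\<^sup>2)"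
      using hpos by (simp add: power2_eq_square mult_ac)
    finally show ?thesis by (simp add: Qh_def)
  qed
  have Qsum: "(\<Sum>z\<in>Q. ?f z) \<le> 4 * \<sigma>\<^sup>2 * P * T"
  proof -
    have "(\<Sum>z\<in>Q. ?f z) = (\<Sum>h\<in>?df ` Q. \<Sum>z\<in>{z \<in> Q. ?df z = h}. ?f z)"
      using Qfin by (intro sum.group[symmetric]) auto
    also have "\<dots> \<le> (\<Sum>h\<in>?df ` Q. 4 * P * T * (pmf p h * (real_of_int h)\<^sup>2))" by (intro sum_mono inner)
    also have "\<dots> = 4 * P * T * (\<Sum>h\<in>?df ` Q. pmf p h * (real_of_int h)\<^sup>2)" by (simp add: sum_distrib_left)
    also have "\<dots> \<le> 4 * P * T * \<sigma>\<^sup>2"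
      using Qfin P0 T0 by (intro mult_left_mono finite_sum_le_has_sum[OF variance_has_sum]) auto
    finally show ?thesis by (simp add: mult_ac)
  qed
  \<comment> \<open>The diagonal vanishes and both orders of a pair contribute equally, which turns
    the constant 4 into 8.\<close>
  have "(\<Sum>x\<in>J. \<Sum>y\<in>J. grad (window N n) r x y) = (\<Sum>z\<in>J \<times> J. ?f z)"
    by (simp add: sum.cartesian_product case_prod_unfold)
  also have "\<dots> = (\<Sum>z\<in>Q \<union> prod.swap ` Q. ?f z)"
  proof (rule sum.mono_neutral_right)
    show "\<forall>z\<in>J \<times> J - (Q \<union> prod.swap ` Q). ?f z = 0"
    proof
      fix z assume z: "z \<in> J \<times> J - (Q \<union> prod.swap ` Q)"
      obtain x y where xy: "z = (x, y)" by (cases z)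
      have "\<not> x < y" using z by (auto simp: xy Q_def)
      moreover have "\<not> y < x" using z by (force simp: xy Q_def)
      ultimately have "x = y" by simp
      then show "?f z = 0" by (simp add: xy grad_def[OF finite_window r])
    qed
  qed (use J(1) in \<open>auto simp: Q_def\<close>)
  also have "\<dots> = (\<Sum>z\<in>Q. ?f z) + (\<Sum>z\<in>prod.swap ` Q. ?f z)"
    using Qfin by (intro sum.union_disjoint) (auto simp: Q_def)
  also have "(\<Sum>z\<in>prod.swap ` Q. ?f z) = (\<Sum>z\<in>Q. ?f z)"
    by (subst sum.reindex) (auto simp: inj_on_def grad_commute[OF finite_window r] intro!: sum.cong)
  finally show ?thesis using Qsum by (simp add: mult_ac)
qed

end


section \<open>Scaling limits\<close>

text \<open>\<open>Y\<close> is the level before rounding, of order \<open>sqrt (t * ln t)\<close>,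
  and \<open>Y t / (\<sigma>\<^sup>2 * t)\<close> the corresponding tilt. The fourth limit controls
  the quartic Taylor error and the fifth the gradient error of the lower bound. The sixth is the one
  that dictates the centring \<open>a_norm\<close>.\<close>

lemma scale_limits:
  fixes \<sigma> x :: real
  defines "Y \<equiv> \<lambda>t. \<sigma> * b_norm t * (a_norm t + x)"
  assumes s: "\<sigma> > 0"
  shows "filterlim Y at_top at_top"
    and "((\<lambda>t. Y t / t) \<longlongrightarrow> 0) at_top"
    and "filterlim (\<lambda>t. (Y t - 1) / (\<sigma>\<^sup>2 * sqrt t)) at_top at_top"
    and "((\<lambda>t. sqrt t * (Y t / (\<sigma>\<^sup>2 * t))\<^sup>2) \<longlongrightarrow> 0) at_top"
    and "\<kappa> > 0 \<Longrightarrow> ((\<lambda>t. (Y t / (\<sigma>\<^sup>2 * sqrt t)) ^ 4 / sqrt t * exp (2 * \<kappa> * (Y t / (\<sigma>\<^sup>2 * sqrt t)) + 2)) \<longlongrightarrow> 0) at_top"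
    and "((\<lambda>t. sqrt t * (Y t / (\<sigma>\<^sup>2 * t))\<^sup>2 * exp ((Y t)\<^sup>2 / (2 * \<sigma>\<^sup>2 * t))) \<longlongrightarrow> exp x / (\<sigma>\<^sup>2 * sqrt (2 * pi))) at_top"
proof -
  show "filterlim Y at_top at_top" "((\<lambda>t. Y t / t) \<longlongrightarrow> 0) at_top"
    "filterlim (\<lambda>t. (Y t - 1) / (\<sigma>\<^sup>2 * sqrt t)) at_top at_top"
    "((\<lambda>t. sqrt t * (Y t / (\<sigma>\<^sup>2 * t))\<^sup>2) \<longlongrightarrow> 0) at_top"
    using s unfolding Y_def b_norm_def a_norm_def by real_asymp+
  show "((\<lambda>t. (Y t / (\<sigma>\<^sup>2 * sqrt t)) ^ 4 / sqrt t * exp (2 * \<kappa> * (Y t / (\<sigma>\<^sup>2 * sqrt t)) + 2)) \<longlongrightarrow> 0) at_top" if "\<kappa> > 0"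
    using s that unfolding Y_def b_norm_def a_norm_def by real_asymp
  \<comment> \<open>Chosen such that \<open>a_norm t + x = ln t - ln (ln t) + d\<close>.\<close>
  define d where "d = x - ln (sqrt (2 * pi))"
  have "((\<lambda>t. ((ln t - ln (ln t) + d) / ln t)\<^sup>2 * exp (d + (ln (ln t) - d)\<^sup>2 / (2 * ln t)) / \<sigma>\<^sup>2) \<longlongrightarrow> exp d / \<sigma>\<^sup>2) at_top"
    using s by real_asymp (simp only: divide_inverse)
  moreover have "eventually (\<lambda>t. ((ln t - ln (ln t) + d) / ln t)\<^sup>2 * exp (d + (ln (ln t) - d)\<^sup>2 / (2 * ln t)) / \<sigma>\<^sup>2
      = sqrt t * (Y t / (\<sigma>\<^sup>2 * t))\<^sup>2 * exp ((Y t)\<^sup>2 / (2 * \<sigma>\<^sup>2 * t))) at_top"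
    using eventually_gt_at_top[of 1]
  proof eventually_elim
    case (elim t)
    define L where "L = ln t"
    define w where "w = L - ln L + d"
    have L: "L > 0" and t: "t > 0" using elim by (auto simp: L_def)
    have expL: "exp (L / 2) = sqrt t"
    proof -
      have "L / 2 = ln (sqrt t)" using t by (simp add: L_def ln_sqrt)
      then show ?thesis using t by simp
    qed
    have expl: "exp (- ln L) = 1 / L" using L by (simp add: exp_minus inverse_eq_divide)
    have "a_norm t + x = w"
      using L t by (simp add: a_norm_def w_def d_def L_def ln_div ln_mult ln_sqrt)
    then have Y2: "(Y t)\<^sup>2 = \<sigma>\<^sup>2 * (t / L) * w\<^sup>2"
      using L t by (simp add: Y_def b_norm_def L_def power_mult_distrib)
    have "(Y t)\<^sup>2 / (2 * \<sigma>\<^sup>2 * t) = w\<^sup>2 / (2 * L)"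
      unfolding Y2 using s t L by (simp add: field_simps)
    \<comment> \<open>Expanding the square of \<open>L + (d - ln L)\<close>: the exponential of
      \<open>L / 2 - ln L\<close> is \<open>sqrt t / ln t\<close>, and the quotient by
      \<open>2 * L\<close> tends to 0.\<close>
    also have "\<dots> = L / 2 + - ln L + (d + (ln L - d)\<^sup>2 / (2 * L))"
      using L by (simp add: w_def field_simps power2_eq_square)
    finally have "exp ((Y t)\<^sup>2 / (2 * \<sigma>\<^sup>2 * t)) = sqrt t * (1 / L) * exp (d + (ln L - d)\<^sup>2 / (2 * L))"
      by (simp only: exp_add expL expl)
    moreover have "(Y t / (\<sigma>\<^sup>2 * t))\<^sup>2 = w\<^sup>2 / (\<sigma>\<^sup>2 * t * L)"
      unfolding power_divide Y2 using s t L by (simp add: field_simps power2_eq_square)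
    ultimately have "sqrt t * (Y t / (\<sigma>\<^sup>2 * t))\<^sup>2 * exp ((Y t)\<^sup>2 / (2 * \<sigma>\<^sup>2 * t))
       = (sqrt t * sqrt t) * w\<^sup>2 / (\<sigma>\<^sup>2 * t * L * L) * exp (d + (ln L - d)\<^sup>2 / (2 * L))"
      by (simp add: field_simps)
    also have "\<dots> = (w / L)\<^sup>2 * exp (d + (ln L - d)\<^sup>2 / (2 * L)) / \<sigma>\<^sup>2"
      using t by (simp add: power2_eq_square field_simps)
    finally show ?case by (simp add: w_def L_def)
  qed
  ultimately have "((\<lambda>t. sqrt t * (Y t / (\<sigma>\<^sup>2 * t))\<^sup>2 * exp ((Y t)\<^sup>2 / (2 * \<sigma>\<^sup>2 * t))) \<longlongrightarrow> exp d / \<sigma>\<^sup>2) at_top"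
    by (rule Lim_transform_eventually)
  moreover have "exp d / \<sigma>\<^sup>2 = exp x / (\<sigma>\<^sup>2 * sqrt (2 * pi))"
    by (simp add: d_def exp_diff)
  ultimately show "((\<lambda>t. sqrt t * (Y t / (\<sigma>\<^sup>2 * t))\<^sup>2 * exp ((Y t)\<^sup>2 / (2 * \<sigma>\<^sup>2 * t))) \<longlongrightarrow> exp x / (\<sigma>\<^sup>2 * sqrt (2 * pi))) at_top"
    by simp
qed

lemma sqrt_times_divide:
  fixes A c t :: real
  assumes "t > 0"
  shows "sqrt t * (A / (c * t)) = A / (c * sqrt t)"
proof -
  have "A / (c * sqrt t) = (sqrt t * A) / (sqrt t * (c * sqrt t))" using assms by simp
  also have "sqrt t * (c * sqrt t) = c * (sqrt t * sqrt t)" by (simp only: mult_ac)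
  also have "sqrt t * sqrt t = t" using assms by simp
  finally show ?thesis by simp
qed

text \<open>Rounding changes \<open>Y\<^sup>2 / (2 * \<sigma>\<^sup>2 * t)\<close> by at most
  \<open>Y / (\<sigma>\<^sup>2 * t)\<close>, which tends to 0; hence even the exponential factor
  keeps its limit.\<close>

lemma floor_scale_limits:
  fixes \<sigma> x :: real
  defines "N \<equiv> \<lambda>t. \<lfloor>\<sigma> * b_norm t * (a_norm t + x)\<rfloor>"
  defines "\<theta> \<equiv> \<lambda>t. real_of_int (N t) / (\<sigma>\<^sup>2 * t)"
  assumes s: "\<sigma> > 0"
  shows "real_of_int (N t) = \<sigma>\<^sup>2 * t * \<theta> t"
    and "(\<theta> \<longlongrightarrow> 0) at_top"
    and "filterlim (\<lambda>t. sqrt t * \<theta> t) at_top at_top"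
    and "((\<lambda>t. sqrt t * (\<theta> t)\<^sup>2) \<longlongrightarrow> 0) at_top"
    and "((\<lambda>t. sqrt t * (\<theta> t)\<^sup>2 * exp (\<sigma>\<^sup>2 * t * (\<theta> t)\<^sup>2 / 2)) \<longlongrightarrow> exp x / (\<sigma>\<^sup>2 * sqrt (2 * pi))) at_top"
    and "\<kappa> > 0 \<Longrightarrow> ((\<lambda>t. (sqrt t * \<theta> t) ^ 4 / sqrt t * exp (2 * \<kappa> * (sqrt t * \<theta> t) + 2)) \<longlongrightarrow> 0) at_top"
proof -
  define Y where "Y t = \<sigma> * b_norm t * (a_norm t + x)" for t
  note Y = scale_limits[OF s, where x = x, folded Y_def]
  have NY: "real_of_int (N t) \<le> Y t" "Y t - 1 \<le> real_of_int (N t)" for t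
    unfolding N_def Y_def by linarith+
  \<comment> \<open>At \<open>t = 0\<close> division by zero makes the tilt 0, and the level is 0 as
    well because \<open>b_norm 0 = 0\<close>.\<close>
  show N: "real_of_int (N t) = \<sigma>\<^sup>2 * t * \<theta> t" for t
    by (cases "t = 0") (use s in \<open>auto simp: \<theta>_def N_def b_norm_def\<close>)
  have "eventually (\<lambda>t. Y t > 1) at_top" using Y(1) by (auto simp: filterlim_at_top_dense)
  then have ev: "eventually (\<lambda>t. Y t > 1 \<and> t > 1) at_top"
    using eventually_gt_at_top[of 1] by eventually_elim simp
  have th: "eventually (\<lambda>t. 0 \<le> \<theta> t \<and> (Y t - 1) / (\<sigma>\<^sup>2 * t) \<le> \<theta> t \<and> \<theta> t \<le> Y t / (\<sigma>\<^sup>2 * t)) at_top"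
    using ev
  proof eventually_elim
    case (elim t)
    then show ?case using NY[of t] s by (auto simp: \<theta>_def intro!: divide_right_mono divide_nonneg_nonneg)
  qed
  have "((\<lambda>t. Y t / t / \<sigma>\<^sup>2) \<longlongrightarrow> 0 / \<sigma>\<^sup>2) at_top" by (rule tendsto_divide[OF Y(2) tendsto_const]) (use s in simp)
  then have lim: "((\<lambda>t. Y t / (\<sigma>\<^sup>2 * t)) \<longlongrightarrow> 0) at_top"
    by (simp only: divide_divide_eq_left mult.commute[of _ "\<sigma>\<^sup>2"] div_0)
  show "(\<theta> \<longlongrightarrow> 0) at_top"
  proof (rule tendsto_sandwich[OF _ _ tendsto_const lim])
    show "eventually (\<lambda>t. 0 \<le> \<theta> t) at_top" using th by eventually_elim (elim conjE)
    show "eventually (\<lambda>t. \<theta> t \<le> Y t / (\<sigma>\<^sup>2 * t)) at_top" using th by eventually_elim (elim conjE)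
  qed
  show "filterlim (\<lambda>t. sqrt t * \<theta> t) at_top at_top"
  proof (rule filterlim_at_top_mono[OF Y(3)])
    show "eventually (\<lambda>t. (Y t - 1) / (\<sigma>\<^sup>2 * sqrt t) \<le> sqrt t * \<theta> t) at_top"
      using th ev
    proof eventually_elim
      case (elim t)
      have "(Y t - 1) / (\<sigma>\<^sup>2 * sqrt t) = sqrt t * ((Y t - 1) / (\<sigma>\<^sup>2 * t))"
        using elim by (intro sqrt_times_divide[symmetric]) simp
      also have "\<dots> \<le> sqrt t * \<theta> t" using elim by (intro mult_left_mono) auto
      finally show ?case .
    qed
  qed
  show "((\<lambda>t. sqrt t * (\<theta> t)\<^sup>2) \<longlongrightarrow> 0) at_top"
  proof (rule tendsto_sandwich[OF _ _ tendsto_const Y(4)])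
    show "eventually (\<lambda>t. 0 \<le> sqrt t * (\<theta> t)\<^sup>2) at_top" using ev by eventually_elim auto
    show "eventually (\<lambda>t. sqrt t * (\<theta> t)\<^sup>2 \<le> sqrt t * (Y t / (\<sigma>\<^sup>2 * t))\<^sup>2) at_top"
      using ev th by eventually_elim (auto intro!: mult_left_mono power_mono)
  qed
  show "((\<lambda>t. (sqrt t * \<theta> t) ^ 4 / sqrt t * exp (2 * \<kappa> * (sqrt t * \<theta> t) + 2)) \<longlongrightarrow> 0) at_top" if k: "\<kappa> > 0"
  proof (rule tendsto_sandwich[OF _ _ tendsto_const Y(5)[OF k]])
    show "eventually (\<lambda>t. 0 \<le> (sqrt t * \<theta> t) ^ 4 / sqrt t * exp (2 * \<kappa> * (sqrt t * \<theta> t) + 2)) at_top"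
      using ev by eventually_elim auto
    show "eventually (\<lambda>t. (sqrt t * \<theta> t) ^ 4 / sqrt t * exp (2 * \<kappa> * (sqrt t * \<theta> t) + 2)
       \<le> (Y t / (\<sigma>\<^sup>2 * sqrt t)) ^ 4 / sqrt t * exp (2 * \<kappa> * (Y t / (\<sigma>\<^sup>2 * sqrt t)) + 2)) at_top"
      using ev th
    proof eventually_elim
      case (elim t)
      have "sqrt t * \<theta> t \<le> sqrt t * (Y t / (\<sigma>\<^sup>2 * t))" using elim by (intro mult_left_mono) auto
      also have "\<dots> = Y t / (\<sigma>\<^sup>2 * sqrt t)" using elim by (intro sqrt_times_divide) simp
      finally have le: "sqrt t * \<theta> t \<le> Y t / (\<sigma>\<^sup>2 * sqrt t)" .
      have nn: "0 \<le> sqrt t * \<theta> t" using elim by simp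
      have "2 * \<kappa> * (sqrt t * \<theta> t) \<le> 2 * \<kappa> * (Y t / (\<sigma>\<^sup>2 * sqrt t))"
        using le k by (intro mult_left_mono) auto
      then have "exp (2 * \<kappa> * (sqrt t * \<theta> t) + 2) \<le> exp (2 * \<kappa> * (Y t / (\<sigma>\<^sup>2 * sqrt t)) + 2)"
        by (simp only: exp_le_cancel_iff add_le_cancel_right)
      then show ?case
        using le nn elim by (intro mult_mono divide_right_mono power_mono) auto
    qed
  qed
  have r1: "((\<lambda>t. real_of_int (N t) / Y t) \<longlongrightarrow> 1) at_top"
  proof (rule tendsto_sandwich)
    have "((\<lambda>t. 1 - 1 / Y t) \<longlongrightarrow> 1 - 0) at_top"
      by (intro tendsto_intros tendsto_divide_0[OF tendsto_const] filterlim_at_top_imp_at_infinity Y(1))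
    then show "((\<lambda>t. 1 - 1 / Y t) \<longlongrightarrow> 1) at_top" by simp
    show "eventually (\<lambda>t. 1 - 1 / Y t \<le> real_of_int (N t) / Y t) at_top"
      using ev
    proof eventually_elim
      case (elim t)
      have "1 - 1 / Y t = (Y t - 1) / Y t" using elim by (simp add: diff_divide_distrib)
      also have "\<dots> \<le> real_of_int (N t) / Y t" using elim NY[of t] by (intro divide_right_mono) auto
      finally show ?case .
    qed
    show "eventually (\<lambda>t. real_of_int (N t) / Y t \<le> 1) at_top"
      using ev by eventually_elim (use NY in \<open>auto simp: field_simps\<close>)
  qed auto
  have r2: "((\<lambda>t. (real_of_int (N t))\<^sup>2 / (2 * \<sigma>\<^sup>2 * t) - (Y t)\<^sup>2 / (2 * \<sigma>\<^sup>2 * t)) \<longlongrightarrow> 0) at_top"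
  proof (rule Lim_null_comparison)
    have "((\<lambda>t. Y t / t / \<sigma>\<^sup>2) \<longlongrightarrow> 0 / \<sigma>\<^sup>2) at_top" by (rule tendsto_divide[OF Y(2) tendsto_const]) (use s in simp)
    then show "((\<lambda>t. Y t / t / \<sigma>\<^sup>2) \<longlongrightarrow> 0) at_top" by simp
    show "eventually (\<lambda>t. norm ((real_of_int (N t))\<^sup>2 / (2 * \<sigma>\<^sup>2 * t) - (Y t)\<^sup>2 / (2 * \<sigma>\<^sup>2 * t)) \<le> Y t / t / \<sigma>\<^sup>2) at_top"
      using ev
    proof eventually_elim
      case (elim t)
      have n0: "0 \<le> real_of_int (N t)" using NY[of t] elim by linarith
      have "(Y t)\<^sup>2 - (real_of_int (N t))\<^sup>2 = (Y t - real_of_int (N t)) * (Y t + real_of_int (N t))"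
        by (simp add: power2_eq_square algebra_simps)
      also have "\<dots> \<le> 1 * (2 * Y t)" using NY[of t] n0 elim by (intro mult_mono) auto
      finally have u: "(Y t)\<^sup>2 - (real_of_int (N t))\<^sup>2 \<le> 2 * Y t" by simp
      have l: "(real_of_int (N t))\<^sup>2 \<le> (Y t)\<^sup>2" using NY[of t] n0 by (intro power_mono) auto
      have nn: "0 \<le> ((Y t)\<^sup>2 - (real_of_int (N t))\<^sup>2) / (2 * \<sigma>\<^sup>2 * t)"
        using l elim by (intro divide_nonneg_nonneg) auto
      have "(real_of_int (N t))\<^sup>2 / (2 * \<sigma>\<^sup>2 * t) - (Y t)\<^sup>2 / (2 * \<sigma>\<^sup>2 * t) = - (((Y t)\<^sup>2 - (real_of_int (N t))\<^sup>2) / (2 * \<sigma>\<^sup>2 * t))"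
        by (simp only: diff_divide_distrib minus_diff_eq)
      then have "norm ((real_of_int (N t))\<^sup>2 / (2 * \<sigma>\<^sup>2 * t) - (Y t)\<^sup>2 / (2 * \<sigma>\<^sup>2 * t)) = ((Y t)\<^sup>2 - (real_of_int (N t))\<^sup>2) / (2 * \<sigma>\<^sup>2 * t)"
        using nn by (simp only: real_norm_def abs_minus_cancel abs_of_nonneg)
      also have "\<dots> \<le> 2 * Y t / (2 * \<sigma>\<^sup>2 * t)" using u elim by (intro divide_right_mono) auto
      also have "\<dots> = Y t / t / \<sigma>\<^sup>2" using s elim by (simp add: field_simps)
      finally show ?case .
    qed
  qed
  have "((\<lambda>t. sqrt t * (Y t / (\<sigma>\<^sup>2 * t))\<^sup>2 * exp ((Y t)\<^sup>2 / (2 * \<sigma>\<^sup>2 * t)) * (real_of_int (N t) / Y t)\<^sup>2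
       * exp ((real_of_int (N t))\<^sup>2 / (2 * \<sigma>\<^sup>2 * t) - (Y t)\<^sup>2 / (2 * \<sigma>\<^sup>2 * t)))
     \<longlongrightarrow> exp x / (\<sigma>\<^sup>2 * sqrt (2 * pi)) * 1\<^sup>2 * exp 0) at_top"
    by (intro tendsto_mult tendsto_power tendsto_exp Y(6) r1 r2)
  then have "((\<lambda>t. sqrt t * (Y t / (\<sigma>\<^sup>2 * t))\<^sup>2 * exp ((Y t)\<^sup>2 / (2 * \<sigma>\<^sup>2 * t)) * (real_of_int (N t) / Y t)\<^sup>2
       * exp ((real_of_int (N t))\<^sup>2 / (2 * \<sigma>\<^sup>2 * t) - (Y t)\<^sup>2 / (2 * \<sigma>\<^sup>2 * t)))
     \<longlongrightarrow> exp x / (\<sigma>\<^sup>2 * sqrt (2 * pi))) at_top" by simp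
  then show "((\<lambda>t. sqrt t * (\<theta> t)\<^sup>2 * exp (\<sigma>\<^sup>2 * t * (\<theta> t)\<^sup>2 / 2)) \<longlongrightarrow> exp x / (\<sigma>\<^sup>2 * sqrt (2 * pi))) at_top"
  proof (rule Lim_transform_eventually)
    show "eventually (\<lambda>t. sqrt t * (Y t / (\<sigma>\<^sup>2 * t))\<^sup>2 * exp ((Y t)\<^sup>2 / (2 * \<sigma>\<^sup>2 * t)) * (real_of_int (N t) / Y t)\<^sup>2
       * exp ((real_of_int (N t))\<^sup>2 / (2 * \<sigma>\<^sup>2 * t) - (Y t)\<^sup>2 / (2 * \<sigma>\<^sup>2 * t))
       = sqrt t * (\<theta> t)\<^sup>2 * exp (\<sigma>\<^sup>2 * t * (\<theta> t)\<^sup>2 / 2)) at_top"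
      using ev
    proof eventually_elim
      case (elim t)
      have 1: "(Y t / (\<sigma>\<^sup>2 * t))\<^sup>2 * (real_of_int (N t) / Y t)\<^sup>2 = (\<theta> t)\<^sup>2"
        using elim s by (simp add: \<theta>_def flip: power_mult_distrib)
      have 2: "(real_of_int (N t))\<^sup>2 / (2 * \<sigma>\<^sup>2 * t) = \<sigma>\<^sup>2 * t * (\<theta> t)\<^sup>2 / 2"
        unfolding N using elim s by (simp add: field_simps power2_eq_square)
      have 3: "exp ((Y t)\<^sup>2 / (2 * \<sigma>\<^sup>2 * t)) * exp ((real_of_int (N t))\<^sup>2 / (2 * \<sigma>\<^sup>2 * t) - (Y t)\<^sup>2 / (2 * \<sigma>\<^sup>2 * t)) = exp (\<sigma>\<^sup>2 * t * (\<theta> t)\<^sup>2 / 2)"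
        unfolding 2 exp_add[symmetric] by simp
      have "sqrt t * a * b * c * d = sqrt t * (a * c) * (b * d)" for a b c d :: real
        by (simp only: mult_ac)
      from this[of "(Y t / (\<sigma>\<^sup>2 * t))\<^sup>2" "exp ((Y t)\<^sup>2 / (2 * \<sigma>\<^sup>2 * t))" "(real_of_int (N t) / Y t)\<^sup>2"
          "exp ((real_of_int (N t))\<^sup>2 / (2 * \<sigma>\<^sup>2 * t) - (Y t)\<^sup>2 / (2 * \<sigma>\<^sup>2 * t))"]
      show ?case unfolding 1 3 .
    qed
  qed
qed

context exclusion_step
begin

text \<open>This is \<open>mean_prod_obs_ge\<close> with \<open>B = {..K}\<close> in the limit of
  growing windows. The tilt \<open>\<theta>\<close> estimates the walk over the distances
  \<open>N\<close> and \<open>N - K\<close>, while \<open>\<theta>'\<close> estimates the particle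
  density beyond \<open>K\<close>; the two live on different scales and are chosen
  separately.\<close>

lemma prob_empty_ge:
  obtains C where "C > 0"
    "\<And>t N K \<theta> \<theta>'. t > 0 \<Longrightarrow> 0 \<le> \<theta> \<Longrightarrow> \<theta> \<le> \<theta>\<^sub>0 \<Longrightarrow> 0 \<le> \<theta>' \<Longrightarrow> \<theta>' \<le> \<theta>\<^sub>0 \<Longrightarrow>
       exp (t * (rmgf p \<theta> - 1) - \<theta> * of_int N) \<le> 1 / 2 \<Longrightarrow>
       exp (- ((1 + 2 * exp (t * (rmgf p \<theta> - 1) - \<theta> * of_int N)) * rate t N))
         - exp 2 * exp (t * (rmgf p \<theta>' - 1) - \<theta>' * of_int K) * rate t N
         - C * sqrt t * (exp (t * (rmgf p \<theta> - 1) - \<theta> * of_int (N - K)))\<^sup>2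
       \<le> prob (empty_beyond t N)"
proof -
  obtain C where C: "C > 0" "\<And>r \<theta> x. r > 0 \<Longrightarrow> \<bar>\<theta>\<bar> \<le> \<theta>\<^sub>0 \<Longrightarrow> walk_prob p r x \<le> C / sqrt r * exp (r * (rmgf p \<theta> - 1) - \<theta> * of_int x)"
    using walk_prob_local_bound by blast
  have "exp (- ((1 + 2 * exp (t * (rmgf p \<theta> - 1) - \<theta> * of_int N)) * rate t N))
         - exp 2 * exp (t * (rmgf p \<theta>' - 1) - \<theta>' * of_int K) * rate t N
         - (8 * \<sigma>\<^sup>2 * C) * sqrt t * (exp (t * (rmgf p \<theta> - 1) - \<theta> * of_int (N - K)))\<^sup>2
       \<le> prob (empty_beyond t N)"
    if t: "t > 0" and th: "0 \<le> \<theta>" "\<theta> \<le> \<theta>\<^sub>0" and th': "0 \<le> \<theta>'" "\<theta>' \<le> \<theta>\<^sub>0"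
      and half: "exp (t * (rmgf p \<theta> - 1) - \<theta> * of_int N) \<le> 1 / 2" for t N K \<theta> \<theta>'
  proof -
    define \<tau> where "\<tau> = exp (t * (rmgf p \<theta> - 1) - \<theta> * of_int N)"
    define k where "k = exp (t * (rmgf p \<theta>' - 1) - \<theta>' * of_int K)"
    define m where "m = exp (t * (rmgf p \<theta> - 1) - \<theta> * of_int (N - K))"
    \<comment> \<open>With \<open>P = C / sqrt r * m\<close> and \<open>T = m\<close>, the bound of
      \<open>window_grad_bound\<close> becomes \<open>2 * c / sqrt r\<close>.\<close>
    define c where "c = 4 * \<sigma>\<^sup>2 * C * m\<^sup>2"
    have t0: "t \<ge> 0" and ath: "\<bar>\<theta>\<bar> \<le> \<theta>\<^sub>0" using t th by auto
    have mono: "exp (r * (rmgf p \<theta> - 1) - \<theta> * of_int w) \<le> exp (t * (rmgf p \<theta> - 1) - \<theta> * of_int v)"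
      if "r \<le> t" "v \<le> w" for r v w
    proof -
      have "r * (rmgf p \<theta> - 1) \<le> t * (rmgf p \<theta> - 1)"
        using that rmgf_ge_1[OF ath] by (intro mult_right_mono) auto
      moreover have "\<theta> * of_int v \<le> \<theta> * of_int w" using that th by (intro mult_left_mono) auto
      ultimately show ?thesis by simp
    qed
    have bound: "exp (- ((1 + 2 * \<tau>) * intensity (window N n) (\<lambda>_. 1) t)) - exp 2 * k * intensity (window N n) (\<lambda>_. 1) t - 2 * c * sqrt t
        \<le> mean t (prod_obs (window N n) (\<lambda>_. 1))" for n
    proof (rule mean_prod_obs_ge[OF finite_window t0, where B = "{..K}"])
      show "k \<ge> 0" by (simp add: k_def)
      show "\<tau> \<le> 1 / 2" using half by (simp add: \<tau>_def)
      show "occ s x \<le> k" if "0 \<le> s" "s \<le> t" "x \<notin> {..K}" for s x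
      proof -
        have "occ s x \<le> exp (t * (rmgf p \<theta>' - 1) - \<theta>' * of_int x)" by (rule occ_exp_bound[OF th' that(1,2)])
        also have "\<theta>' * of_int K \<le> \<theta>' * of_int x" using that th' by (intro mult_left_mono) auto
        then have "exp (t * (rmgf p \<theta>' - 1) - \<theta>' * of_int x) \<le> k" by (simp add: k_def)
        finally show ?thesis .
      qed
      show "walk_avg p (window N n) (\<lambda>_. 1) t z * \<rho> z \<le> \<tau>" for z
      proof (cases "z > 0")
        case True
        then show ?thesis by (simp add: rho_right \<tau>_def)
      next
        case False
        have "walk_avg p (window N n) (\<lambda>_. 1) t z = (\<Sum>a\<in>window N n. walk_prob p t (a - z))" by (simp add: walk_avg_def)
        also have "\<dots> = (\<Sum>w\<in>(\<lambda>a. a - z) ` window N n. walk_prob p t w)"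
          by (subst sum.reindex) (auto simp: inj_on_def)
        also have "\<dots> \<le> (\<Sum>\<^sub>\<infinity>w\<in>{N..}. walk_prob p t w)"
          using False by (intro finite_sum_le_infsum walk_tail_bound(1)[OF th t0]) (auto simp: window_def walk_prob_nonneg[OF t0])
        also have "\<dots> \<le> \<tau>" unfolding \<tau>_def by (rule walk_tail_bound(2)[OF th t0])
        finally have a: "walk_avg p (window N n) (\<lambda>_. 1) t z \<le> \<tau>" .
        have "walk_avg p (window N n) (\<lambda>_. 1) t z * \<rho> z \<le> \<tau> * 1"
          using a rho01[of z] by (intro mult_mono) (auto simp: \<tau>_def)
        then show ?thesis by simp
      qed
      fix r I assume r: "0 < r" "r \<le> t" and I: "finite (I :: int set)"
      have "(\<Sum>x\<in>I \<inter> {..K}. \<Sum>y\<in>I \<inter> {..K}. grad (window N n) r x y) \<le> 8 * \<sigma>\<^sup>2 * (C / sqrt r * m) * m"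
      proof (rule window_grad_bound)
        show "walk_prob p r w \<le> C / sqrt r * m" if "w > N - K" for w
        proof -
          have "walk_prob p r w \<le> C / sqrt r * exp (r * (rmgf p \<theta> - 1) - \<theta> * of_int w)" by (rule C(2)[OF r(1) ath])
          also have "\<dots> \<le> C / sqrt r * m"
            unfolding m_def using C(1) r that by (intro mult_left_mono mono) auto
          finally show ?thesis .
        qed
        have "(\<Sum>\<^sub>\<infinity>w\<in>{N - K + 1..}. walk_prob p r w) \<le> exp (r * (rmgf p \<theta> - 1) - \<theta> * of_int (N - K + 1))"
          using r by (intro walk_tail_bound(2) th) auto
        also have "\<dots> \<le> m" unfolding m_def using r by (intro mono) auto
        finally show "(\<Sum>\<^sub>\<infinity>w\<in>{N - K + 1..}. walk_prob p r w) \<le> m" .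
      qed (use r I in auto)
      also have "\<dots> = 2 * c / sqrt r" by (simp add: c_def power2_eq_square)
      finally show "(\<Sum>x\<in>I \<inter> {..K}. \<Sum>y\<in>I \<inter> {..K}. grad (window N n) r x y) \<le> 2 * c / sqrt r" .
    qed
    have "(\<lambda>n. exp (- ((1 + 2 * \<tau>) * intensity (window N n) (\<lambda>_. 1) t)) - exp 2 * k * intensity (window N n) (\<lambda>_. 1) t - 2 * c * sqrt t)
        \<longlonglongrightarrow> exp (- ((1 + 2 * \<tau>) * rate t N)) - exp 2 * k * rate t N - 2 * c * sqrt t"
      by (intro tendsto_intros intensity_window_tendsto t0)
    from LIMSEQ_le[OF this prob_empty_tendsto[OF t0]] bound
    have "exp (- ((1 + 2 * \<tau>) * rate t N)) - exp 2 * k * rate t N - 2 * c * sqrt t \<le> prob (empty_beyond t N)" by blast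
    then show ?thesis by (simp add: \<tau>_def k_def c_def m_def mult_ac)
  qed
  moreover have "8 * \<sigma>\<^sup>2 * C > 0" using C(1) std_pos by simp
  ultimately show thesis using that by blast
qed

end


section \<open>The right-most particle\<close>

lemma rightmost_eq:
  assumes "\<zeta> k" "\<And>y. \<zeta> y \<Longrightarrow> y \<le> k"
  shows "rightmost \<zeta> = k"
  unfolding rightmost_def by (rule Greatest_equality) (use assms in auto)

lemma rightmost_attained:
  assumes "\<zeta> z" "\<And>y. \<zeta> y \<Longrightarrow> y \<le> N"
  shows "\<zeta> (rightmost \<zeta>)" "\<And>y. \<zeta> y \<Longrightarrow> y \<le> rightmost \<zeta>"
proof -
  define F where "F = {y. \<zeta> y \<and> z \<le> y}"
  have "F \<subseteq> {z..N}" using assms by (auto simp: F_def)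
  then have fin: "finite F" by (rule finite_subset) simp
  have zF: "z \<in> F" using assms by (simp add: F_def)
  have M: "Max F \<in> F" using fin zF by (intro Max_in) auto
  have le: "y \<le> Max F" if "\<zeta> y" for y
  proof (cases "z \<le> y")
    case True
    then show ?thesis using that fin by (intro Max_ge) (auto simp: F_def)
  next
    case False
    then show ?thesis using Max_ge[OF fin zF] by simp
  qed
  have eq: "rightmost \<zeta> = Max F" using M le by (intro rightmost_eq) (auto simp: F_def)
  show "\<zeta> (rightmost \<zeta>)" using M by (simp add: eq F_def)
  show "\<And>y. \<zeta> y \<Longrightarrow> y \<le> rightmost \<zeta>" using le by (simp add: eq)
qed

context exclusion_step
begin

text \<open>Borel-Cantelli: by \<open>occ_exp_bound\<close> the occupation probabilities of the
  sites \<open>n\<close> decay geometrically. It excludes configurations without an upper bound, on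
  which \<open>rightmost\<close> is unspecified.\<close>

lemma AE_bounded_above:
  assumes t: "t \<ge> 0"
  shows "AE \<omega> in M. \<exists>N. \<forall>y. \<eta> t \<omega> y \<longrightarrow> y \<le> N"
proof -
  let ?A = "\<lambda>n. {\<omega> \<in> space M. \<eta> t \<omega> (int n)}"
  have occ_prob: "occ t x = prob {\<omega> \<in> space M. \<eta> t \<omega> x}" for x
  proof -
    have "occ t x = (\<integral>\<omega>. indicator {\<omega> \<in> space M. \<eta> t \<omega> x} \<omega> \<partial>M)"
      unfolding occ_def mean_def by (intro Bochner_Integration.integral_cong) (auto simp: indicator_def)
    then show ?thesis using site_event[OF t] by simp
  qed
  have "summable (\<lambda>n. prob (?A n))"
  proof (rule summable_comparison_test')
    have "summable (\<lambda>n. exp (t * (rmgf p \<theta>\<^sub>0 - 1)) * exp (- \<theta>\<^sub>0) ^ n)"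
      using exponent_pos by (intro summable_mult summable_geometric) simp
    then show "summable (\<lambda>n. exp (t * (rmgf p \<theta>\<^sub>0 - 1) - \<theta>\<^sub>0 * of_int (int n)))"
      by (simp add: exp_diff exp_minus exp_of_nat_mult mult.commute[of \<theta>\<^sub>0] divide_inverse power_inverse)
    show "norm (prob (?A n)) \<le> exp (t * (rmgf p \<theta>\<^sub>0 - 1) - \<theta>\<^sub>0 * of_int (int n))" for n
      using occ_exp_bound[of \<theta>\<^sub>0 t t "int n"] exponent_pos t by (simp add: occ_prob)
  qed
  then have "AE \<omega> in M. eventually (\<lambda>n. \<omega> \<in> space M - ?A n) sequentially"
    using site_event[OF t] by (intro borel_cantelli_AE1) (auto simp: emeasure_eq_measure)
  then show ?thesis
  proof eventually_elim
    case (elim \<omega>)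
    then obtain n0 where n0: "\<And>n. n \<ge> n0 \<Longrightarrow> \<not> \<eta> t \<omega> (int n)"
      by (auto simp: eventually_sequentially)
    have "y \<le> int n0" if "\<eta> t \<omega> y" for y
    proof (rule ccontr)
      assume "\<not> y \<le> int n0"
      with n0[of "nat y"] that show False by (auto simp: le_nat_iff)
    qed
    then show ?case by blast
  qed
qed

text \<open>On this event nothing lies beyond any level, yet \<open>rightmost\<close> is
  unspecified; it has to be subtracted when the two descriptions are compared.\<close>

definition vacant :: "real \<Rightarrow> 'a set" where
  "vacant t = {\<omega> \<in> space M. \<forall>y. \<not> \<eta> t \<omega> y}"

lemma vacant_event: "t \<ge> 0 \<Longrightarrow> vacant t \<in> events"
proof -
  assume t: "t \<ge> 0"
  have "vacant t = space M - (\<Union>y. {\<omega> \<in> space M. \<eta> t \<omega> y})" by (auto simp: vacant_def)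
  then show ?thesis using site_event[OF t] by auto
qed

lemma rightmost_event:
  assumes t: "t \<ge> 0"
  shows "{\<omega> \<in> space M. rightmost (\<eta> t \<omega>) \<le> N} \<in> events"
proof -
  define Mx where "Mx = (\<lambda>k. {\<omega> \<in> space M. \<eta> t \<omega> k} \<inter> empty_beyond t k)"
  \<comment> \<open>The value of \<open>rightmost\<close> on every configuration without a
    right-most particle: there the predicate inside the description operator is identically false,
    so all these configurations share one unspecified integer.\<close>
  define c where "c = (THE x :: int. False)"
  have Mx: "Mx k \<in> events" for k
    unfolding Mx_def using site_event[OF t] empty_beyond_event[OF t] by auto
  have in_Mx: "rightmost (\<eta> t \<omega>) = k" if "\<omega> \<in> Mx k" for \<omega> k
    using that by (intro rightmost_eq) (auto simp: Mx_def empty_beyond_def not_le[symmetric])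
  have out: "rightmost (\<eta> t \<omega>) = c" if "\<omega> \<in> space M" "\<And>k. \<omega> \<notin> Mx k" for \<omega>
  proof -
    have nk: "\<not> (\<eta> t \<omega> k \<and> (\<forall>y. \<eta> t \<omega> y \<longrightarrow> y \<le> k))" for k
      using that by (auto simp: Mx_def empty_beyond_def not_le)
    show ?thesis unfolding rightmost_def Greatest_def c_def by (simp only: nk)
  qed
  have "{\<omega> \<in> space M. rightmost (\<eta> t \<omega>) \<le> N} = (\<Union>k\<in>{..N}. Mx k) \<union> (if c \<le> N then space M - (\<Union>k. Mx k) else {})"
  proof (intro set_eqI iffI)
    fix \<omega> assume \<omega>: "\<omega> \<in> {\<omega> \<in> space M. rightmost (\<eta> t \<omega>) \<le> N}"
    show "\<omega> \<in> (\<Union>k\<in>{..N}. Mx k) \<union> (if c \<le> N then space M - (\<Union>k. Mx k) else {})"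
    proof (cases "\<exists>k. \<omega> \<in> Mx k")
      case True
      then show ?thesis using in_Mx \<omega> by auto
    next
      case False
      then show ?thesis using out[of \<omega>] \<omega> by auto
    qed
  next
    fix \<omega> assume \<omega>: "\<omega> \<in> (\<Union>k\<in>{..N}. Mx k) \<union> (if c \<le> N then space M - (\<Union>k. Mx k) else {})"
    have "Mx k \<subseteq> space M" for k by (auto simp: Mx_def)
    then show "\<omega> \<in> {\<omega> \<in> space M. rightmost (\<eta> t \<omega>) \<le> N}"
      using \<omega> in_Mx out[of \<omega>] by (auto split: if_splits)
  qed
  moreover have "(\<Union>k\<in>{..N}. Mx k) \<in> events" "(\<Union>k. Mx k) \<in> events" using Mx by auto
  ultimately show ?thesis by auto
qed

end

section \<open>Periodic initial densities and the limit law\<close>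

locale exclusion_periodic = exclusion_step p \<theta>\<^sub>0 \<sigma> S M \<eta> \<rho>
  for p \<theta>\<^sub>0 \<sigma> S and M :: "'a measure" and \<eta> \<rho> +
  fixes m :: nat
  assumes period_pos: "m \<ge> 1"
    and periodic: "i \<le> - 1 \<Longrightarrow> \<rho> i = \<rho> (i - int m)"
    and nonzero: "\<exists>j\<in>{1..m}. \<rho> (- int j) \<noteq> 0"
begin

definition density :: real where
  "density = (1 / real m) * (\<Sum>j=1..m. \<rho> (- int j))"

lemma density_pos: "density > 0"
proof -
  obtain j where j: "j \<in> {1..m}" "\<rho> (- int j) \<noteq> 0" using nonzero by blast
  have "(\<Sum>j=1..m. \<rho> (- int j)) > 0"
  proof (rule sum_pos2[OF _ j(1)])
    show "\<rho> (- int j) > 0" using j(2) rho01(1)[of "- int j"] by linarith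
  qed (use rho01 in auto)
  then show ?thesis using period_pos by (simp add: density_def)
qed

lemma rho_period_sum:
  assumes "k \<ge> 1"
  shows "(\<Sum>j=k..<k + m. \<rho> (- int j)) = real m * density"
  using assms
proof (induction k rule: dec_induct)
  case base
  have "{1..<1 + m} = {1..m}" by auto
  then show ?case using period_pos by (simp add: density_def)
next
  case (step k)
  have "(\<Sum>j=Suc k..<Suc k + m. \<rho> (- int j)) = (\<Sum>j=k..<k + m. \<rho> (- int j)) - \<rho> (- int k) + \<rho> (- int (k + m))"
  proof -
    have "(\<Sum>j=k..<Suc (k + m). \<rho> (- int j)) = \<rho> (- int k) + (\<Sum>j=Suc k..<Suc (k + m). \<rho> (- int j))"
      by (rule sum.atLeast_Suc_lessThan) simp
    then show ?thesis by simp
  qed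
  moreover have "\<rho> (- int k) = \<rho> (- int (k + m))"
    using periodic[of "- int k"] step.hyps by (simp add: algebra_simps)
  ultimately show ?case using step.IH by simp
qed

text \<open>The deviation from the line is periodic with period \<open>m\<close> from index 1 on,
  and so is bounded by its values up to \<open>m\<close>. Periodicity of the deviation starts at 1
  because the site 0 is exempt from that of the densities.\<close>

lemma rho_sum_affine: obtains B where "\<And>k. \<bar>rho_sum k - density * real k\<bar> \<le> B"
proof -
  define D where "D = (\<lambda>k. \<bar>rho_sum k - density * real k\<bar>)"
  have per: "D (k + m) = D k" if "k \<ge> 1" for k
  proof -
    have "rho_sum (k + m) = rho_sum k + (\<Sum>j=k..<k + m. \<rho> (- int j))"
      unfolding rho_sum_def lessThan_atLeast0 by (rule sum.atLeastLessThan_concat[symmetric]) auto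
    then show ?thesis using rho_period_sum[OF that] by (simp add: D_def algebra_simps)
  qed
  have "D k \<le> (\<Sum>i\<le>m. D i)" for k
  proof (induction k rule: less_induct)
    case (less k)
    show ?case
    proof (cases "k \<le> m")
      case True
      then show ?thesis by (intro member_le_sum) (auto simp: D_def)
    next
      case False
      then have "D k = D (k - m)" using per[of "k - m"] by simp
      with less.IH[of "k - m"] False period_pos show ?thesis by simp
    qed
  qed
  with that show thesis by (auto simp: D_def)
qed

context
  fixes x :: real
begin

definition level :: "real \<Rightarrow> int" where
  "level t = \<lfloor>\<sigma> * b_norm t * (a_norm t + x)\<rfloor>"

text \<open>The saddle point: the minimiser of
  \<open>\<sigma>\<^sup>2 t \<theta>\<^sup>2 / 2 - \<theta> N\<close>, the Gaussian approximation of
  \<open>t * (rmgf p \<theta> - 1) - \<theta> * N\<close>.\<close>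

definition tilt :: "real \<Rightarrow> real" where
  "tilt t = real_of_int (level t) / (\<sigma>\<^sup>2 * t)"

lemmas level_limits = floor_scale_limits[OF std_pos, where x = x, folded level_def, folded tilt_def]

text \<open>The moderate deviation asymptotics and the last limit of the scaling share one
  normalising factor, so dividing one by the other leaves the limit of \<open>rate\<close>.\<close>

lemma rate_tendsto: "((\<lambda>t. rate t (level t)) \<longlongrightarrow> \<sigma> * density * exp (- x)) at_top"
proof -
  obtain B where B: "\<And>k. \<bar>rho_sum k - density * real k\<bar> \<le> B" using rho_sum_affine by blast
  have "((\<lambda>t. sqrt t * (tilt t)\<^sup>2 * exp (\<sigma>\<^sup>2 * t * (tilt t)\<^sup>2 / 2) * rate t (level t)) \<longlongrightarrow> density / (\<sigma> * sqrt (2 * pi))) at_top"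
    unfolding rate_def by (rule walk_series_asymptotics[OF rho_sum_bound B level_limits(1-4)])
  from tendsto_divide[OF this level_limits(5)]
  have "((\<lambda>t. sqrt t * (tilt t)\<^sup>2 * exp (\<sigma>\<^sup>2 * t * (tilt t)\<^sup>2 / 2) * rate t (level t) / (sqrt t * (tilt t)\<^sup>2 * exp (\<sigma>\<^sup>2 * t * (tilt t)\<^sup>2 / 2)))
     \<longlongrightarrow> density / (\<sigma> * sqrt (2 * pi)) / (exp x / (\<sigma>\<^sup>2 * sqrt (2 * pi)))) at_top"
    using std_pos by simp
  moreover have "density / (\<sigma> * sqrt (2 * pi)) / (exp x / (\<sigma>\<^sup>2 * sqrt (2 * pi))) = \<sigma> * density * exp (- x)"
    using std_pos by (simp add: exp_minus field_simps power2_eq_square)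
  ultimately have "((\<lambda>t. sqrt t * (tilt t)\<^sup>2 * exp (\<sigma>\<^sup>2 * t * (tilt t)\<^sup>2 / 2) * rate t (level t) / (sqrt t * (tilt t)\<^sup>2 * exp (\<sigma>\<^sup>2 * t * (tilt t)\<^sup>2 / 2)))
     \<longlongrightarrow> \<sigma> * density * exp (- x)) at_top" by simp
  then show ?thesis
  proof (rule Lim_transform_eventually)
    have "eventually (\<lambda>t. sqrt t * tilt t > 0) at_top"
      using level_limits(3) by (auto simp: filterlim_at_top_dense)
    then show "eventually (\<lambda>t. sqrt t * (tilt t)\<^sup>2 * exp (\<sigma>\<^sup>2 * t * (tilt t)\<^sup>2 / 2) * rate t (level t) / (sqrt t * (tilt t)\<^sup>2 * exp (\<sigma>\<^sup>2 * t * (tilt t)\<^sup>2 / 2)) = rate t (level t)) at_top"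
      by eventually_elim auto
  qed
qed

text \<open>The upper half is \<open>prob_empty_le\<close>. For the lower half,
  \<open>\<tau>\<close> and \<open>V\<close> tend to 0, whereas the density error is only made as
  small as desired through \<open>\<epsilon>\<close>, at the expense of a larger strip constant
  \<open>\<kappa>\<close>.\<close>

lemma prob_empty_limit:
  "((\<lambda>t. prob (empty_beyond t (level t))) \<longlongrightarrow> exp (- (\<sigma> * density * exp (- x)))) at_top"
proof (rule order_tendstoI)
  let ?lam = "\<sigma> * density * exp (- x)"
  have lam: "?lam > 0" using std_pos density_pos by simp
  fix a
  assume "a > exp (- ?lam)"
  moreover have "((\<lambda>t. exp (- rate t (level t))) \<longlongrightarrow> exp (- ?lam)) at_top"
    by (intro tendsto_intros rate_tendsto)
  ultimately have "eventually (\<lambda>t. exp (- rate t (level t)) < a) at_top" by (rule order_tendstoD(2)[rotated])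
  then show "eventually (\<lambda>t. prob (empty_beyond t (level t)) < a) at_top"
    using eventually_ge_at_top[of 0]
  proof eventually_elim
    case (elim t)
    with prob_empty_le[of t "level t"] show ?case by linarith
  qed
next
  let ?lam = "\<sigma> * density * exp (- x)"
  have lam: "?lam > 0" using std_pos density_pos by simp
  fix a
  assume a: "a < exp (- ?lam)"
  obtain C where C: "C > 0"
    "\<And>t N K \<theta> \<theta>'. t > 0 \<Longrightarrow> 0 \<le> \<theta> \<Longrightarrow> \<theta> \<le> \<theta>\<^sub>0 \<Longrightarrow> 0 \<le> \<theta>' \<Longrightarrow> \<theta>' \<le> \<theta>\<^sub>0 \<Longrightarrow>
       exp (t * (rmgf p \<theta> - 1) - \<theta> * of_int N) \<le> 1 / 2 \<Longrightarrow>
       exp (- ((1 + 2 * exp (t * (rmgf p \<theta> - 1) - \<theta> * of_int N)) * rate t N))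
         - exp 2 * exp (t * (rmgf p \<theta>' - 1) - \<theta>' * of_int K) * rate t N
         - C * sqrt t * (exp (t * (rmgf p \<theta> - 1) - \<theta> * of_int (N - K)))\<^sup>2
       \<le> prob (empty_beyond t N)"
    using prob_empty_ge by blast
  obtain C' where C': "C' > 0" "\<And>\<theta>. \<bar>\<theta>\<bar> \<le> \<theta>\<^sub>0 / 2 \<Longrightarrow> \<bar>rmgf p \<theta> - 1 - \<sigma>\<^sup>2 * \<theta>\<^sup>2 / 2\<bar> \<le> C' * \<theta> ^ 4"
    using rmgf_taylor by blast
  \<comment> \<open>The density error \<open>exp 2 * \<epsilon> * ?lam\<close> may use up at most
    half of the distance between \<open>a\<close> and the limit. The cap at 1 makes
    \<open>ln \<epsilon> \<le> 0\<close>, hence \<open>\<kappa> > 0\<close>.\<close>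
  define \<epsilon> where "\<epsilon> = min 1 ((exp (- ?lam) - a) / (2 * exp 2 * ?lam))"
  have eps: "0 < \<epsilon>" "\<epsilon> \<le> 1" using a lam by (auto simp: \<epsilon>_def)
  have eps2: "a < exp (- ?lam) - exp 2 * \<epsilon> * ?lam"
  proof -
    have "\<epsilon> \<le> (exp (- ?lam) - a) / (2 * exp 2 * ?lam)" by (simp add: \<epsilon>_def)
    then have "\<epsilon> * (2 * exp 2 * ?lam) \<le> exp (- ?lam) - a"
      using lam by (subst (asm) pos_le_divide_eq) auto
    then show ?thesis using a by (simp add: algebra_simps)
  qed
  \<comment> \<open>At the diffusive tilt \<open>1 / sqrt t\<close> one has
    \<open>t * (rmgf p \<theta>' - 1) \<le> \<sigma>\<^sup>2 / 2 + C'\<close>, and the cut at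
    \<open>\<kappa> * sqrt t\<close> subtracts at least \<open>\<kappa>\<close>; the difference is
    \<open>ln \<epsilon>\<close>.\<close>
  define \<kappa> where "\<kappa> = \<sigma>\<^sup>2 / 2 + C' - ln \<epsilon>"
  have kap: "\<kappa> > 0"
  proof -
    have "ln \<epsilon> \<le> 0" using eps by simp
    moreover have "\<sigma>\<^sup>2 / 2 > 0" using std_pos by simp
    ultimately show ?thesis using C'(1) unfolding \<kappa>_def by linarith
  qed
  define K where "K = (\<lambda>t. \<lceil>\<kappa> * sqrt t\<rceil>)"
  define \<theta>' where "\<theta>' = (\<lambda>t::real. 1 / sqrt t)"
  define \<tau> where "\<tau> = (\<lambda>t. exp (t * (rmgf p (tilt t) - 1) - tilt t * of_int (level t)))"
  define V where "V = (\<lambda>t. sqrt t * (exp (t * (rmgf p (tilt t) - 1) - tilt t * of_int (level t - K t)))\<^sup>2)"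

  have "eventually (\<lambda>t. sqrt t * tilt t > 0) at_top"
    using level_limits(3) by (auto simp: filterlim_at_top_dense)
  then have ev_pos: "eventually (\<lambda>t. t > 1 \<and> tilt t > 0) at_top"
    using eventually_gt_at_top[of 1] by eventually_elim (auto simp: zero_less_mult_iff)
  have ev_small: "eventually (\<lambda>t. \<bar>tilt t\<bar> < min (\<theta>\<^sub>0 / 2) 1) at_top"
    using tendstoD[OF level_limits(2), of "min (\<theta>\<^sub>0 / 2) 1"] exponent_pos by simp
  have "((\<lambda>t. C' * (sqrt t * (tilt t)\<^sup>2)\<^sup>2) \<longlongrightarrow> C' * 0\<^sup>2) at_top"
    by (intro tendsto_intros level_limits(4))
  then have "eventually (\<lambda>t. C' * (sqrt t * (tilt t)\<^sup>2)\<^sup>2 < 1) at_top"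
    by (intro order_tendstoD) auto
  then have ev_quart: "eventually (\<lambda>t. t * (C' * (tilt t) ^ 4) < 1) at_top"
    using eventually_gt_at_top[of 0]
    by eventually_elim (simp add: power_mult_distrib mult_ac flip: power_mult)
  \<comment> \<open>At the saddle point the exponent is
    \<open>- \<sigma>\<^sup>2 t \<theta>\<^sup>2 / 2\<close> up to the quartic error, which is
    eventually below 1.\<close>
  have ev_psi: "eventually (\<lambda>t. t * (rmgf p (tilt t) - 1) - tilt t * of_int (level t) \<le> 1 - \<sigma>\<^sup>2 * t * (tilt t)\<^sup>2 / 2) at_top"
    using ev_pos ev_small ev_quart
  proof eventually_elim
    case (elim t)
    have "t * (rmgf p (tilt t) - 1 - \<sigma>\<^sup>2 * (tilt t)\<^sup>2 / 2) \<le> t * (C' * (tilt t) ^ 4)"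
      using elim C'(2)[of "tilt t"] by (intro mult_left_mono) auto
    also have "\<dots> \<le> 1" using elim by simp
    finally show ?case unfolding level_limits(1) by (simp add: algebra_simps power2_eq_square)
  qed
  have tau_lim: "(\<tau> \<longlongrightarrow> 0) at_top"
  proof (rule tendsto_sandwich[OF _ _ tendsto_const])
    have "filterlim (\<lambda>t. \<sigma>\<^sup>2 / 2 * ((sqrt t * tilt t) * (sqrt t * tilt t))) at_top at_top"
      using std_pos by (intro filterlim_tendsto_pos_mult_at_top[OF tendsto_const] filterlim_at_top_mult_at_top level_limits(3)) auto
    then have "((\<lambda>t. exp (- (\<sigma>\<^sup>2 / 2 * ((sqrt t * tilt t) * (sqrt t * tilt t))))) \<longlongrightarrow> 0) at_top"
      by (intro filterlim_compose[OF exp_at_bot] filterlim_uminus_at_bot_at_top[THEN filterlim_compose])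
    then have "((\<lambda>t. exp 1 * exp (- (\<sigma>\<^sup>2 / 2 * ((sqrt t * tilt t) * (sqrt t * tilt t))))) \<longlongrightarrow> exp 1 * 0) at_top"
      by (rule tendsto_mult_left)
    then show "((\<lambda>t. exp 1 * exp (- (\<sigma>\<^sup>2 / 2 * ((sqrt t * tilt t) * (sqrt t * tilt t))))) \<longlongrightarrow> 0) at_top" by simp
    show "eventually (\<lambda>t. \<tau> t \<le> exp 1 * exp (- (\<sigma>\<^sup>2 / 2 * ((sqrt t * tilt t) * (sqrt t * tilt t))))) at_top"
      using ev_psi ev_pos
    proof eventually_elim
      case (elim t)
      have "\<sigma>\<^sup>2 / 2 * ((sqrt t * tilt t) * (sqrt t * tilt t)) = \<sigma>\<^sup>2 * (sqrt t * sqrt t) * (tilt t)\<^sup>2 / 2"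
        by (simp add: power2_eq_square)
      also have "\<dots> = \<sigma>\<^sup>2 * t * (tilt t)\<^sup>2 / 2" using elim by simp
      finally have e: "\<sigma>\<^sup>2 / 2 * ((sqrt t * tilt t) * (sqrt t * tilt t)) = \<sigma>\<^sup>2 * t * (tilt t)\<^sup>2 / 2" .
      have "\<tau> t \<le> exp (1 + - (\<sigma>\<^sup>2 * t * (tilt t)\<^sup>2 / 2))"
        unfolding \<tau>_def exp_le_cancel_iff using elim by linarith
      then show ?case unfolding e exp_add .
    qed
  qed (auto simp: \<tau>_def)
  \<comment> \<open>Since \<open>?n\<close> has a positive limit, dividing by its square trades the
    Gaussian factor for \<open>(sqrt t * tilt t) ^ 4 / sqrt t\<close>. The strip adds only the
    factor \<open>exp (2 * \<kappa> * (sqrt t * tilt t))\<close>, which is too small to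
    matter.\<close>
  have V_lim: "(V \<longlongrightarrow> 0) at_top"
  proof (rule tendsto_sandwich[OF _ _ tendsto_const])
    let ?n = "\<lambda>t. sqrt t * (tilt t)\<^sup>2 * exp (\<sigma>\<^sup>2 * t * (tilt t)\<^sup>2 / 2)"
    have "((\<lambda>t. exp 2 * ((sqrt t * tilt t) ^ 4 / sqrt t * exp (2 * \<kappa> * (sqrt t * tilt t) + 2)) / (?n t)\<^sup>2)
       \<longlongrightarrow> exp 2 * 0 / (exp x / (\<sigma>\<^sup>2 * sqrt (2 * pi)))\<^sup>2) at_top"
      using std_pos by (intro tendsto_intros level_limits(5,6) kap) auto
    then show "((\<lambda>t. exp 2 * ((sqrt t * tilt t) ^ 4 / sqrt t * exp (2 * \<kappa> * (sqrt t * tilt t) + 2)) / (?n t)\<^sup>2) \<longlongrightarrow> 0) at_top" by simp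
    show "eventually (\<lambda>t. V t \<le> exp 2 * ((sqrt t * tilt t) ^ 4 / sqrt t * exp (2 * \<kappa> * (sqrt t * tilt t) + 2)) / (?n t)\<^sup>2) at_top"
      using ev_psi ev_pos ev_small
    proof eventually_elim
      case (elim t)
      have t: "t > 0" and th: "tilt t > 0" "tilt t \<le> 1" using elim by auto
      have "of_int (K t) \<le> \<kappa> * sqrt t + 1" unfolding K_def by linarith
      then have "tilt t * of_int (K t) \<le> tilt t * (\<kappa> * sqrt t + 1)" using th by (intro mult_left_mono) auto
      also have "\<dots> \<le> \<kappa> * (sqrt t * tilt t) + 1" using th by (simp add: algebra_simps)
      finally have "t * (rmgf p (tilt t) - 1) - tilt t * of_int (level t - K t) \<le> 1 - \<sigma>\<^sup>2 * t * (tilt t)\<^sup>2 / 2 + (\<kappa> * (sqrt t * tilt t) + 1)"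
        using elim by (simp add: algebra_simps)
      then have "exp (t * (rmgf p (tilt t) - 1) - tilt t * of_int (level t - K t)) \<le> exp (1 - \<sigma>\<^sup>2 * t * (tilt t)\<^sup>2 / 2 + (\<kappa> * (sqrt t * tilt t) + 1))" by simp
      then have "V t \<le> sqrt t * (exp (1 - \<sigma>\<^sup>2 * t * (tilt t)\<^sup>2 / 2 + (\<kappa> * (sqrt t * tilt t) + 1)))\<^sup>2"
        unfolding V_def using t by (intro mult_left_mono power_mono) auto
      also have "(exp (1 - \<sigma>\<^sup>2 * t * (tilt t)\<^sup>2 / 2 + (\<kappa> * (sqrt t * tilt t) + 1)))\<^sup>2
          = exp 2 * exp (2 * \<kappa> * (sqrt t * tilt t) + 2) / (exp (\<sigma>\<^sup>2 * t * (tilt t)\<^sup>2 / 2))\<^sup>2"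
        by (simp add: power2_eq_square algebra_simps exp_diff[symmetric] flip: exp_add)
      also have "sqrt t * \<dots> = exp 2 * ((sqrt t * tilt t) ^ 4 / sqrt t * exp (2 * \<kappa> * (sqrt t * tilt t) + 2)) / (?n t)\<^sup>2"
      proof -
        have "sqrt t * (E / X\<^sup>2) = ((sqrt t * tilt t) ^ 4 / sqrt t * E) / (sqrt t * (tilt t)\<^sup>2 * X)\<^sup>2" if "X > 0" for E X :: real
        proof -
          have "(sqrt t * tilt t) ^ 4 = (sqrt t * (tilt t)\<^sup>2)\<^sup>2 * (sqrt t * sqrt t)"
            by (simp add: power_mult_distrib power2_eq_square power4_eq_xxxx mult_ac)
          then show ?thesis
            using that t th by (simp add: power_mult_distrib field_simps)
        qed
        from this[of "exp (\<sigma>\<^sup>2 * t * (tilt t)\<^sup>2 / 2)" "exp 2 * exp (2 * \<kappa> * (sqrt t * tilt t) + 2)"]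
        show ?thesis by (simp add: mult_ac)
      qed
      finally show ?case .
    qed
    show "eventually (\<lambda>t. 0 \<le> V t) at_top" using ev_pos by eventually_elim (simp add: V_def)
  qed
  have occ_small: "eventually (\<lambda>t. \<theta>' t \<le> \<theta>\<^sub>0 \<and> 0 \<le> \<theta>' t \<and> exp (t * (rmgf p (\<theta>' t) - 1) - \<theta>' t * of_int (K t)) \<le> \<epsilon>) at_top"
  proof -
    have "(\<theta>' \<longlongrightarrow> 0) at_top" unfolding \<theta>'_def by real_asymp
    then have "eventually (\<lambda>t. \<theta>' t < \<theta>\<^sub>0 / 2) at_top" using exponent_pos by (intro order_tendstoD) auto
    then show ?thesis
      using eventually_ge_at_top[of 1]
    proof eventually_elim
      case (elim t)
      have t: "t > 0" using elim by simp
      have th: "0 \<le> \<theta>' t" using t by (simp add: \<theta>'_def)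
      have t2: "t * (\<theta>' t)\<^sup>2 = 1" using t by (simp add: \<theta>'_def power_divide)
      have t4: "t * (\<theta>' t) ^ 4 \<le> 1"
      proof -
        have "t * (\<theta>' t) ^ 4 = (t * (\<theta>' t)\<^sup>2) * (\<theta>' t)\<^sup>2" by (simp add: power2_eq_square power4_eq_xxxx)
        also have "\<dots> = 1 / t" unfolding t2 using t by (simp add: \<theta>'_def power_divide)
        finally show ?thesis using elim by simp
      qed
      have "t * (rmgf p (\<theta>' t) - 1 - \<sigma>\<^sup>2 * (\<theta>' t)\<^sup>2 / 2) \<le> t * (C' * (\<theta>' t) ^ 4)"
        using t th elim C'(2)[of "\<theta>' t"] by (intro mult_left_mono) auto
      also have "\<dots> \<le> C'" using mult_left_mono[OF t4, of C'] C'(1) by (simp add: mult_ac)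
      finally have "t * (rmgf p (\<theta>' t) - 1) \<le> \<sigma>\<^sup>2 / 2 * (t * (\<theta>' t)\<^sup>2) + C'" by (simp add: algebra_simps)
      then have 1: "t * (rmgf p (\<theta>' t) - 1) \<le> \<sigma>\<^sup>2 / 2 + C'" by (simp add: t2)
      have "\<kappa> = \<theta>' t * (\<kappa> * sqrt t)" using t by (simp add: \<theta>'_def)
      also have "\<dots> \<le> \<theta>' t * of_int (K t)" using th by (intro mult_left_mono) (simp_all add: K_def)
      finally have "t * (rmgf p (\<theta>' t) - 1) - \<theta>' t * of_int (K t) \<le> ln \<epsilon>" using 1 by (simp add: \<kappa>_def)
      then have "exp (t * (rmgf p (\<theta>' t) - 1) - \<theta>' t * of_int (K t)) \<le> exp (ln \<epsilon>)" by simp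
      then show ?case using elim th eps exponent_pos by simp
    qed
  qed
  have "((\<lambda>t. exp (- ((1 + 2 * \<tau> t) * rate t (level t))) - exp 2 * \<epsilon> * rate t (level t) - C * V t)
      \<longlongrightarrow> exp (- ((1 + 2 * 0) * ?lam)) - exp 2 * \<epsilon> * ?lam - C * 0) at_top"
    by (intro tendsto_intros tau_lim V_lim rate_tendsto)
  then have "eventually (\<lambda>t. a < exp (- ((1 + 2 * \<tau> t) * rate t (level t))) - exp 2 * \<epsilon> * rate t (level t) - C * V t) at_top"
    using eps2 by (intro order_tendstoD) auto
  moreover have "eventually (\<lambda>t. \<tau> t < 1 / 2) at_top" using tau_lim by (intro order_tendstoD) auto
  ultimately show "eventually (\<lambda>t. a < prob (empty_beyond t (level t))) at_top"
    using ev_pos ev_small occ_small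
  proof eventually_elim
    case (elim t)
    have "exp (- ((1 + 2 * \<tau> t) * rate t (level t))) - exp 2 * exp (t * (rmgf p (\<theta>' t) - 1) - \<theta>' t * of_int (K t)) * rate t (level t)
         - C * sqrt t * (exp (t * (rmgf p (tilt t) - 1) - tilt t * of_int (level t - K t)))\<^sup>2 \<le> prob (empty_beyond t (level t))"
      unfolding \<tau>_def using elim exponent_pos by (intro C(2)) (auto simp: \<tau>_def)
    moreover have "exp 2 * exp (t * (rmgf p (\<theta>' t) - 1) - \<theta>' t * of_int (K t)) * rate t (level t) \<le> exp 2 * \<epsilon> * rate t (level t)"
      using elim by (intro mult_right_mono mult_left_mono rate_nonneg) auto
    moreover have "C * V t = C * sqrt t * (exp (t * (rmgf p (tilt t) - 1) - tilt t * of_int (level t - K t)))\<^sup>2"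
      by (simp add: V_def)
    ultimately show ?case using elim by linarith
  qed
qed

end

text \<open>A vacant configuration is empty beyond every level, so its probability is asymptotically
  bounded by the limit law at each \<open>x\<close>, which tends to 0 as \<open>x\<close> tends to
  minus infinity.\<close>

lemma prob_vacant_tendsto: "((\<lambda>t. prob (vacant t)) \<longlongrightarrow> 0) at_top"
proof (rule order_tendstoI)
  fix a :: real assume "a < 0"
  then show "eventually (\<lambda>t. a < prob (vacant t)) at_top" by (simp add: less_le_trans[OF _ measure_nonneg])
next
  fix a :: real assume a: "0 < a"
  have "filterlim (\<lambda>x. \<sigma> * density * exp (- x)) at_top at_bot"
    using std_pos density_pos
    by (intro filterlim_tendsto_pos_mult_at_top[OF tendsto_const] filterlim_compose[OF exp_at_top] filterlim_uminus_at_top_at_bot) auto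
  then have "((\<lambda>x. exp (- (\<sigma> * density * exp (- x)))) \<longlongrightarrow> 0) at_bot"
    by (intro filterlim_compose[OF exp_at_bot] filterlim_compose[OF filterlim_uminus_at_bot_at_top])
  then have "eventually (\<lambda>x. exp (- (\<sigma> * density * exp (- x))) < a) at_bot"
    using a by (intro order_tendstoD)
  then obtain x where "exp (- (\<sigma> * density * exp (- x))) < a"
    by (auto simp: eventually_at_bot_linorder)
  from order_tendstoD(2)[OF prob_empty_limit this]
  show "eventually (\<lambda>t. prob (vacant t) < a) at_top"
    using eventually_ge_at_top[of 0]
  proof eventually_elim
    case (elim t)
    have "prob (vacant t) \<le> prob (empty_beyond t (level x t))"
      using elim by (intro finite_measure_mono empty_beyond_event) (auto simp: vacant_def empty_beyond_def)
    with elim show ?case by simp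
  qed
qed

text \<open>Dividing by the positive scale turns the event into
  \<open>rightmost \<le> level\<close>. This differs from emptiness beyond the level only on vacant
  configurations and on a null set of configurations unbounded above.\<close>

theorem rightmost_limit:
  "((\<lambda>t. prob {\<omega> \<in> space M. real_of_int (rightmost (\<eta> t \<omega>)) / (\<sigma> * b_norm t) - a_norm t \<le> x})
     \<longlongrightarrow> exp (- (\<sigma> * density * exp (- x)))) at_top"
proof (rule tendsto_sandwich)
  show "((\<lambda>t. prob (empty_beyond t (level x t)) - prob (vacant t)) \<longlongrightarrow> exp (- (\<sigma> * density * exp (- x)))) at_top"
    using tendsto_diff[OF prob_empty_limit prob_vacant_tendsto] by simp
  show "((\<lambda>t. prob (empty_beyond t (level x t))) \<longlongrightarrow> exp (- (\<sigma> * density * exp (- x)))) at_top"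
    by (rule prob_empty_limit)
  have ev: "eventually (\<lambda>t. {\<omega> \<in> space M. real_of_int (rightmost (\<eta> t \<omega>)) / (\<sigma> * b_norm t) - a_norm t \<le> x}
      = {\<omega> \<in> space M. rightmost (\<eta> t \<omega>) \<le> level x t}) at_top"
    using eventually_gt_at_top[of 1]
  proof eventually_elim
    case (elim t)
    have pos: "\<sigma> * b_norm t > 0" using elim std_pos by (simp add: b_norm_def)
    have "real_of_int k / (\<sigma> * b_norm t) - a_norm t \<le> x \<longleftrightarrow> k \<le> level x t" for k
    proof -
      have "real_of_int k / (\<sigma> * b_norm t) - a_norm t \<le> x \<longleftrightarrow> real_of_int k / (\<sigma> * b_norm t) \<le> a_norm t + x" by linarith
      also have "\<dots> \<longleftrightarrow> real_of_int k \<le> (a_norm t + x) * (\<sigma> * b_norm t)" by (rule pos_divide_le_eq[OF pos])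
      also have "\<dots> \<longleftrightarrow> k \<le> level x t" by (simp add: level_def le_floor_iff mult_ac)
      finally show ?thesis .
    qed
    then show ?case by simp
  qed
  have bounds: "eventually (\<lambda>t. prob (empty_beyond t (level x t)) - prob (vacant t) \<le> prob {\<omega> \<in> space M. rightmost (\<eta> t \<omega>) \<le> level x t}
      \<and> prob {\<omega> \<in> space M. rightmost (\<eta> t \<omega>) \<le> level x t} \<le> prob (empty_beyond t (level x t))) at_top"
    using eventually_ge_at_top[of 0]
  proof eventually_elim
    case (elim t)
    let ?R = "{\<omega> \<in> space M. rightmost (\<eta> t \<omega>) \<le> level x t}"
    note R = rightmost_event[OF elim, of "level x t"]
    have "prob (empty_beyond t (level x t)) \<le> prob (?R \<union> vacant t)"
    proof (rule finite_measure_mono)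
      show "empty_beyond t (level x t) \<subseteq> ?R \<union> vacant t"
      proof
        fix \<omega> assume \<omega>: "\<omega> \<in> empty_beyond t (level x t)"
        show "\<omega> \<in> ?R \<union> vacant t"
        proof (cases "\<exists>z. \<eta> t \<omega> z")
          case True
          then obtain z where z: "\<eta> t \<omega> z" by blast
          have le: "\<And>y. \<eta> t \<omega> y \<Longrightarrow> y \<le> level x t" using \<omega> by (auto simp: empty_beyond_def not_le[symmetric])
          then have "rightmost (\<eta> t \<omega>) \<le> level x t" using rightmost_attained(1)[of "\<eta> t \<omega>", OF z le] by blast
          then show ?thesis using \<omega> by (simp add: empty_beyond_def)
        next
          case False
          then show ?thesis using \<omega> by (simp add: vacant_def empty_beyond_def)
        qed
      qed
      show "?R \<union> vacant t \<in> events" using R vacant_event[OF elim] by auto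
    qed
    also have "\<dots> \<le> prob ?R + prob (vacant t)"
      using R vacant_event[OF elim] by (rule measure_Un_le)
    finally have 1: "prob (empty_beyond t (level x t)) - prob (vacant t) \<le> prob ?R" by simp
    have "prob ?R \<le> prob (empty_beyond t (level x t))"
    proof (rule finite_measure_mono_AE)
      show "AE \<omega> in M. \<omega> \<in> ?R \<longrightarrow> \<omega> \<in> empty_beyond t (level x t)"
        using AE_bounded_above[OF elim] AE_space
      proof eventually_elim
        case (elim \<omega>)
        then obtain N where N: "\<And>y. \<eta> t \<omega> y \<Longrightarrow> y \<le> N" by blast
        have "y \<le> rightmost (\<eta> t \<omega>)" if "\<eta> t \<omega> y" for y
          using rightmost_attained(2)[of "\<eta> t \<omega>", OF that N that] .
        then show ?case using elim by (fastforce simp: empty_beyond_def)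
      qed
    qed (rule empty_beyond_event[OF elim])
    with 1 show ?case by simp
  qed
  show "eventually (\<lambda>t. prob (empty_beyond t (level x t)) - prob (vacant t) \<le> prob {\<omega> \<in> space M. real_of_int (rightmost (\<eta> t \<omega>)) / (\<sigma> * b_norm t) - a_norm t \<le> x}) at_top"
    using ev bounds by eventually_elim simp
  show "eventually (\<lambda>t. prob {\<omega> \<in> space M. real_of_int (rightmost (\<eta> t \<omega>)) / (\<sigma> * b_norm t) - a_norm t \<le> x} \<le> prob (empty_beyond t (level x t))) at_top"
    using ev bounds by eventually_elim simp
qed

end

theorem theorem2p1:
  fixes p :: "int pmf" and \<sigma> :: real and m :: nat and \<rho> :: "int \<Rightarrow> real"
    and M :: "'a measure" and \<eta> :: "real \<Rightarrow> 'a \<Rightarrow> config"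
  assumes symmetric: "\<And>i. pmf p (- i) = pmf p i"
    and irreducible: "rw_irreducible p"
    and exp_moment: "\<exists>\<theta>>0. (\<lambda>i. exp (\<theta> * real_of_int i) * pmf p i) summable_on UNIV"
    and sigma_pos: "\<sigma> > 0"
    and sigma: "\<sigma>\<^sup>2 = (\<Sum>\<^sub>\<infinity>i\<in>UNIV. (real_of_int i)\<^sup>2 * pmf p i)"
    and m: "m \<ge> 1"
    and rho_range: "\<And>x. \<rho> x \<in> {0..1}"
    and rho_0: "\<rho> 0 = 1"
    and rho_right: "\<And>x. x > 0 \<Longrightarrow> \<rho> x = 0"
    and rho_periodic: "\<And>i. i \<le> - 1 \<Longrightarrow> \<rho> i = \<rho> (i - int m)"
    and rho_nonzero: "\<exists>j\<in>{1..m}. \<rho> (- int j) \<noteq> 0"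
    and process: "symmetric_exclusion_process p (bernoulli_product \<rho>) M \<eta>"
  defines "\<rho>bar \<equiv> (1 / real m) * (\<Sum>j=1..m. \<rho> (- int j))"
  shows "\<forall>x::real.
    ((\<lambda>t. measure M {\<omega> \<in> space M.
        real_of_int (rightmost (\<eta> t \<omega>)) / (\<sigma> * b_norm t) - a_norm t \<le> x})
      \<longlongrightarrow> exp (- \<sigma> * \<rho>bar * exp (- x))) at_top"
proof -
  obtain S where S: "exclusion_semigroup p S" "markov_process_with S M \<eta>"
    and init: "distr M config_space (\<eta> 0) = bernoulli_product \<rho>"
    using process by (auto simp: symmetric_exclusion_process_def)
  obtain \<theta> where th: "\<theta> > 0" "(\<lambda>i. exp (\<theta> * real_of_int i) * pmf p i) summable_on UNIV"
    using exp_moment by blast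
  \<comment> \<open>Symmetry makes the one-sided exponential moment two-sided, through \<open>exp
    (\<theta> * \<bar>i\<bar>) \<le> exp (\<theta> * i) + exp (- \<theta> * i)\<close>.\<close>
  have "mgf_finite p \<theta>"
    unfolding mgf_finite_def
  proof (rule summable_on_of_abs_le)
    have "(\<lambda>i. exp (\<theta> * real_of_int (- i)) * pmf p (- i)) summable_on UNIV"
      using th(2) by (subst summable_on_reindex_bij_witness[of _ uminus uminus]) auto
    then show "(\<lambda>i. exp (\<theta> * real_of_int i) * pmf p i + exp (\<theta> * real_of_int (- i)) * pmf p (- i)) summable_on UNIV"
      by (intro summable_on_add th(2))
    show "\<bar>pmf p i * exp (\<theta> * \<bar>real_of_int i\<bar>)\<bar> \<le> exp (\<theta> * real_of_int i) * pmf p i + exp (\<theta> * real_of_int (- i)) * pmf p (- i)" for i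
      by (cases "i \<ge> 0") (simp_all add: abs_mult symmetric mult.commute)
  qed
  interpret exclusion_periodic p \<theta> \<sigma> S M \<eta> \<rho> m
  proof unfold_locales
    show "\<theta> > 0" by (rule th(1))
    show "mgf_finite p \<theta>" by fact
  qed (fact assms S init)+
  show ?thesis
    using rightmost_limit by (simp add: \<rho>bar_def density_def)
qed

end
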